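(* Let $E,F$ be complex Banach spaces, $U\subseteq E$ open, $v$ a weight on $U$, $p\in[1,\infty)$, and $f\in\mathcal H_v^\infty(U,F)$. Let $\mathcal I$ be any one of the Banach operator ideals $\mathcal K_p,\mathcal K_{wp},\mathcal K_{up}$, and set $\mathcal A=\mathcal K_{wp}$ if $\mathcal I=\mathcal K_p$, and $\mathcal A=\mathcal I$ if $\mathcal I=\mathcal K_{wp}$ or $\mathcal I=\mathcal K_{up}$. The following are equivalent: (i) $f\in\mathcal H^\infty_{v\mathcal I}(U,F)$; (ii) there exist a quotient space $G$ of $\ell_{p^*}$ (of $c_0$ if $p=1$), an operator $S\in\mathcal I(G,F)$ and a mapping $g\in\mathcal H^\infty_{v\mathcal A}(U,G)$ such that $f=S\circ g$. In this case, $\|f\|_{\mathcal H^\infty_{v\mathcal I}}=\inf\{\|S\|_{\mathcal I}\|g\|_{\mathcal H^\infty_{v\mathcal A}}\}$, where the infimum is taken over all such factorizations.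
   Context: A weight on $U$ is a strictly positive continuous function. $\mathcal H_v^\infty(U,F)$ is the Banach space of holomorphic $f\colon U\to F$ with $\|f\|_v:=\sup_{x\in U}v(x)\|f(x)\|<\infty$. $\mathcal L(X,Y)$ denotes the bounded linear operators. $p^*$ is the conjugate index of $p$. Sequences in a Banach space $X$: for $1\le p<\infty$, $\ell_p(X)$ is the space of sequences with $\|(x_n)\|_p=(\sum\|x_n\|^p)^{1/p}<\infty$; $\ell_p^w(X)$ of those with $\|(x_n)\|_p^w=\sup_{x^*\in B_{X^*}}(\sum|x^*(x_n)|^p)^{1/p}<\infty$; $\ell_p^u(X)$ of those $(x_n)\in\ell_p^w(X)$ with $\|(x_n)_{n\ge m}\|_p^w\to0$ as $m\to\infty$. $p\text{-}\mathrm{conv}(x_n)=\{\sum_n a_nx_n:(a_n)\in B\}$, where $B=B_{\ell_{p^*}}$ if $1<p<\infty$ and $B=B_{c_0}$ if $p=1$. A set $K\subseteq X$ is relatively $p$-compact (resp. relatively weakly $p$-compact, relatively unconditionally $p$-compact) if $K\subseteq p\text{-}\mathrm{conv}(x_n)$ for some $(x_n)$ in $\ell_p(X)$ (resp. $\ell_p^w(X)$, $\ell_p^u(X)$). The corresponding sizes $m_{\mathcal K_p}(K)$, $m_{\mathcal K_{wp}}(K)$, $m_{\mathcal K_{up}}(K)$ are the infima over all such sequences of $\|(x_n)\|_p$ (resp. $\|(x_n)\|_p^w$, $\|(x_n)\|_p^w$). An operator $T\in\mathcal L(X,Y)$ is in $\mathcal K_p(X,Y)$ (resp. $\mathcal K_{wp}(X,Y)$,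 $\mathcal K_{up}(X,Y)$) if $T(B_X)$ is relatively $p$-compact (resp. relatively weakly, relatively unconditionally $p$-compact), with $\|T\|_{\mathcal I}=m_{\mathcal I}(T(B_X))$. For $\mathcal I=\mathcal K_p,\mathcal K_{wp},\mathcal K_{up}$, $\mathcal H^\infty_{v\mathcal I}(U,F)$ is the set of $f\in\mathcal H_v^\infty(U,F)$ such that $(vf)(U)=\{v(x)f(x):x\in U\}$ is relatively $p$-compact (resp. relatively weakly, relatively unconditionally $p$-compact), with $\|f\|_{\mathcal H^\infty_{v\mathcal I}}=m_{\mathcal I}((vf)(U))$. *)

theory Defs
  imports "HOL-Analysis.Analysis"
begin

section \<open>Complex Banach spaces as types\<close>

class complex_banach = banach +
  fixes scaleC :: "complex \<Rightarrow> 'a \<Rightarrow> 'a"  (infixr "*\<^sub>C" 75)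
  assumes scaleC_add_right: "a *\<^sub>C (x + y) = a *\<^sub>C x + a *\<^sub>C y"
    and scaleC_add_left: "(a + b) *\<^sub>C x = a *\<^sub>C x + b *\<^sub>C x"
    and scaleC_scaleC: "a *\<^sub>C (b *\<^sub>C x) = (a * b) *\<^sub>C x"
    and scaleC_of_real: "of_real r *\<^sub>C x = r *\<^sub>R x"
    and norm_scaleC: "norm (a *\<^sub>C x) = cmod a * norm x"

instantiation complex :: complex_banach
begin

definition scaleC_complex :: "complex \<Rightarrow> complex \<Rightarrow> complex"
  where "scaleC_complex a x = a * x"

instance
  by standard
    (simp_all add: scaleC_complex_def algebra_simps norm_mult scaleR_conv_of_real)

end

section \<open>Normed spaces with explicit carrier\<close>

text \<open>
  The sequence spaces and their quotients depend on the real number \<open>p\<close> and on a subspace, so they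
  cannot be types. They are represented by records of operations, and all notions that are needed
  both for them and for Banach spaces given as types are defined for such records; a type enters
  through \<open>type_space\<close>. No axioms are attached to the record: it is only used for
  types of class \<open>complex_banach\<close>, for \<open>conj_seq_space p\<close> and for quotients of the latter
  by closed subspaces. Values of operators outside the carrier are irrelevant.
\<close>

record 'a cspace =
  cs_carrier :: "'a set"
  cs_zero :: 'a
  cs_add :: "'a \<Rightarrow> 'a \<Rightarrow> 'a"
  cs_scale :: "complex \<Rightarrow> 'a \<Rightarrow> 'a"
  cs_norm :: "'a \<Rightarrow> real"

definition type_space :: "'a::complex_banach cspace"
  where "type_space =
    \<lparr>cs_carrier = UNIV, cs_zero = 0, cs_add = (+), cs_scale = scaleC, cs_norm = norm\<rparr>"

definition cs_diff :: "'a cspace \<Rightarrow> 'a \<Rightarrow> 'a \<Rightarrow> 'a"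
  where "cs_diff X x y = cs_add X x (cs_scale X (-1) y)"

definition cs_ball :: "'a cspace \<Rightarrow> 'a set"
  where "cs_ball X = {x \<in> cs_carrier X. cs_norm X x \<le> 1}"

definition bounded_operator :: "'a cspace \<Rightarrow> 'b cspace \<Rightarrow> ('a \<Rightarrow> 'b) \<Rightarrow> bool"
  where "bounded_operator X Y T \<longleftrightarrow>
    (\<forall>x\<in>cs_carrier X. T x \<in> cs_carrier Y) \<and>
    (\<forall>x\<in>cs_carrier X. \<forall>y\<in>cs_carrier X. T (cs_add X x y) = cs_add Y (T x) (T y)) \<and>
    (\<forall>c. \<forall>x\<in>cs_carrier X. T (cs_scale X c x) = cs_scale Y c (T x)) \<and>
    (\<exists>K. \<forall>x\<in>cs_carrier X. cs_norm Y (T x) \<le> K * cs_norm X x)"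

text \<open>The closed unit ball of the dual space.\<close>

definition dual_ball :: "'a cspace \<Rightarrow> ('a \<Rightarrow> complex) set"
  where "dual_ball X =
    {\<phi>. bounded_operator X type_space \<phi> \<and> (\<forall>x\<in>cs_ball X. cmod (\<phi> x) \<le> 1)}"

primrec cs_psum :: "'a cspace \<Rightarrow> (nat \<Rightarrow> 'a) \<Rightarrow> nat \<Rightarrow> 'a"
  where
    "cs_psum X y 0 = cs_zero X"
  | "cs_psum X y (Suc n) = cs_add X (cs_psum X y n) (y n)"

definition cs_sums :: "'a cspace \<Rightarrow> (nat \<Rightarrow> 'a) \<Rightarrow> 'a \<Rightarrow> bool"
  where "cs_sums X y s \<longleftrightarrow>
    s \<in> cs_carrier X \<and> (\<lambda>n. cs_norm X (cs_diff X (cs_psum X y n) s)) \<longlonglongrightarrow> 0"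

definition closed_subspace :: "'a cspace \<Rightarrow> 'a set \<Rightarrow> bool"
  where "closed_subspace X M \<longleftrightarrow>
    M \<subseteq> cs_carrier X \<and> cs_zero X \<in> M \<and>
    (\<forall>x\<in>M. \<forall>y\<in>M. cs_add X x y \<in> M) \<and> (\<forall>c. \<forall>x\<in>M. cs_scale X c x \<in> M) \<and>
    (\<forall>x\<in>cs_carrier X. (\<forall>\<epsilon>>0. \<exists>m\<in>M. cs_norm X (cs_diff X x m) < \<epsilon>) \<longrightarrow> x \<in> M)"

text \<open>
  The elements of the quotient are the cosets of \<open>M\<close>. Adding \<open>M\<close> again in the scalar multiplication
  matters only for the scalar \<open>0\<close>, where the set of all multiples would be \<open>{0}\<close> instead of \<open>M\<close>.
\<close>

definition quotient_cspace :: "'a cspace \<Rightarrow> 'a set \<Rightarrow> 'a set cspace"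
  where "quotient_cspace X M =
    \<lparr>cs_carrier = {{cs_add X x m | m. m \<in> M} | x. x \<in> cs_carrier X},
     cs_zero = M,
     cs_add = (\<lambda>A B. {cs_add X a b | a b. a \<in> A \<and> b \<in> B}),
     cs_scale = (\<lambda>c A. {cs_add X (cs_scale X c a) m | a m. a \<in> A \<and> m \<in> M}),
     cs_norm = (\<lambda>A. Inf (cs_norm X ` A))\<rparr>"

section \<open>The sequence spaces\<close>

text \<open>\<open>conj_seq_space p\<close> is \<open>\<ell>\<^sub>q\<close> for the conjugate index \<open>q\<close> if \<open>1 < p\<close>, and \<open>c\<^sub>0\<close> if \<open>p = 1\<close>.\<close>

definition conj_index :: "real \<Rightarrow> real"
  where "conj_index p = p / (p - 1)"

definition conj_seq_space :: "real \<Rightarrow> (nat \<Rightarrow> complex) cspace"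
  where "conj_seq_space p =
    \<lparr>cs_carrier =
       (if p = 1 then {a. a \<longlonglongrightarrow> 0} else {a. summable (\<lambda>n. cmod (a n) powr conj_index p)}),
     cs_zero = (\<lambda>n. 0),
     cs_add = (\<lambda>a b n. a n + b n),
     cs_scale = (\<lambda>c a n. c * a n),
     cs_norm = (\<lambda>a. if p = 1 then (SUP n. cmod (a n))
       else (\<Sum>n. cmod (a n) powr conj_index p) powr (1 / conj_index p))\<rparr>"

definition conj_seq_quotients :: "real \<Rightarrow> (nat \<Rightarrow> complex) set cspace set"
  where "conj_seq_quotients p =
    {quotient_cspace (conj_seq_space p) M | M. closed_subspace (conj_seq_space p) M}"

definition strong_seqs :: "real \<Rightarrow> 'a cspace \<Rightarrow> (nat \<Rightarrow> 'a) set"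
  where "strong_seqs p X =
    {x. (\<forall>n. x n \<in> cs_carrier X) \<and> summable (\<lambda>n. cs_norm X (x n) powr p)}"

definition strong_norm :: "real \<Rightarrow> 'a cspace \<Rightarrow> (nat \<Rightarrow> 'a) \<Rightarrow> real"
  where "strong_norm p X x = (\<Sum>n. cs_norm X (x n) powr p) powr (1 / p)"

definition weak_seqs :: "real \<Rightarrow> 'a cspace \<Rightarrow> (nat \<Rightarrow> 'a) set"
  where "weak_seqs p X =
    {x. (\<forall>n. x n \<in> cs_carrier X) \<and>
        (\<forall>\<phi>\<in>dual_ball X. summable (\<lambda>n. cmod (\<phi> (x n)) powr p)) \<and>
        bdd_above ((\<lambda>\<phi>. (\<Sum>n. cmod (\<phi> (x n)) powr p) powr (1 / p)) ` dual_ball X)}"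

definition weak_norm :: "real \<Rightarrow> 'a cspace \<Rightarrow> (nat \<Rightarrow> 'a) \<Rightarrow> real"
  where "weak_norm p X x =
    (SUP \<phi>\<in>dual_ball X. (\<Sum>n. cmod (\<phi> (x n)) powr p) powr (1 / p))"

definition uncond_seqs :: "real \<Rightarrow> 'a cspace \<Rightarrow> (nat \<Rightarrow> 'a) set"
  where "uncond_seqs p X =
    {x \<in> weak_seqs p X. (\<lambda>m. weak_norm p X (\<lambda>n. x (m + n))) \<longlonglongrightarrow> 0}"

definition p_conv :: "real \<Rightarrow> 'a cspace \<Rightarrow> (nat \<Rightarrow> 'a) \<Rightarrow> 'a set"
  where "p_conv p X x =
    {s. \<exists>a\<in>cs_ball (conj_seq_space p). cs_sums X (\<lambda>n. cs_scale X (a n) (x n)) s}"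

section \<open>The three kinds of compactness and their operator ideals\<close>

datatype compactness = Kp | Kwp | Kup

primrec gen_seqs :: "compactness \<Rightarrow> real \<Rightarrow> 'a cspace \<Rightarrow> (nat \<Rightarrow> 'a) set"
  where
    "gen_seqs Kp p X = strong_seqs p X"
  | "gen_seqs Kwp p X = weak_seqs p X"
  | "gen_seqs Kup p X = uncond_seqs p X"

primrec gen_norm :: "compactness \<Rightarrow> real \<Rightarrow> 'a cspace \<Rightarrow> (nat \<Rightarrow> 'a) \<Rightarrow> real"
  where
    "gen_norm Kp p X x = strong_norm p X x"
  | "gen_norm Kwp p X x = weak_norm p X x"
  | "gen_norm Kup p X x = weak_norm p X x"

definition relatively_compact :: "compactness \<Rightarrow> real \<Rightarrow> 'a cspace \<Rightarrow> 'a set \<Rightarrow> bool"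
  where "relatively_compact I p X K \<longleftrightarrow> (\<exists>x\<in>gen_seqs I p X. K \<subseteq> p_conv p X x)"

definition compactness_size :: "compactness \<Rightarrow> real \<Rightarrow> 'a cspace \<Rightarrow> 'a set \<Rightarrow> real"
  where "compactness_size I p X K =
    Inf {gen_norm I p X x | x. x \<in> gen_seqs I p X \<and> K \<subseteq> p_conv p X x}"

definition ideal_operators ::
    "compactness \<Rightarrow> real \<Rightarrow> 'a cspace \<Rightarrow> 'b cspace \<Rightarrow> ('a \<Rightarrow> 'b) set"
  where "ideal_operators I p X Y =
    {T. bounded_operator X Y T \<and> relatively_compact I p Y (T ` cs_ball X)}"

definition ideal_norm ::
    "compactness \<Rightarrow> real \<Rightarrow> 'a cspace \<Rightarrow> 'b cspace \<Rightarrow> ('a \<Rightarrow> 'b) \<Rightarrow> real"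
  where "ideal_norm I p X Y T = compactness_size I p Y (T ` cs_ball X)"

section \<open>Weighted spaces of holomorphic mappings\<close>

definition weight :: "'e::complex_banach set \<Rightarrow> ('e \<Rightarrow> real) \<Rightarrow> bool"
  where "weight U v \<longleftrightarrow> continuous_on U v \<and> (\<forall>x\<in>U. 0 < v x)"

text \<open>
  Holomorphic means complex Frechet differentiable at every point of the open set \<open>U\<close>;
  see \<open>holomorphic_into_type_space\<close> for the agreement with \<open>has_derivative\<close>.
\<close>

definition holomorphic_into ::
    "'b cspace \<Rightarrow> 'e::complex_banach set \<Rightarrow> ('e \<Rightarrow> 'b) \<Rightarrow> bool"
  where "holomorphic_into Y U f \<longleftrightarrow>
    (\<forall>x\<in>U. f x \<in> cs_carrier Y) \<and>
    (\<forall>x\<in>U. \<exists>L. bounded_operator type_space Y L \<and>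
      ((\<lambda>h. cs_norm Y (cs_diff Y (cs_diff Y (f (x + h)) (f x)) (L h)) / norm h) \<longlongrightarrow> 0) (at 0))"

definition H_weighted ::
    "'e::complex_banach set \<Rightarrow> ('e \<Rightarrow> real) \<Rightarrow> 'b cspace \<Rightarrow> ('e \<Rightarrow> 'b) set"
  where "H_weighted U v Y =
    {f. holomorphic_into Y U f \<and> bdd_above ((\<lambda>x. v x * cs_norm Y (f x)) ` U)}"

definition weighted_range ::
    "'e::complex_banach set \<Rightarrow> ('e \<Rightarrow> real) \<Rightarrow> 'b cspace \<Rightarrow> ('e \<Rightarrow> 'b) \<Rightarrow> 'b set"
  where "weighted_range U v Y f = (\<lambda>x. cs_scale Y (of_real (v x)) (f x)) ` U"

definition H_ideal :: "compactness \<Rightarrow> real \<Rightarrow>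
    'e::complex_banach set \<Rightarrow> ('e \<Rightarrow> real) \<Rightarrow> 'b cspace \<Rightarrow> ('e \<Rightarrow> 'b) set"
  where "H_ideal I p U v Y =
    {f \<in> H_weighted U v Y. relatively_compact I p Y (weighted_range U v Y f)}"

definition H_ideal_norm :: "compactness \<Rightarrow> real \<Rightarrow>
    'e::complex_banach set \<Rightarrow> ('e \<Rightarrow> real) \<Rightarrow> 'b cspace \<Rightarrow> ('e \<Rightarrow> 'b) \<Rightarrow> real"
  where "H_ideal_norm I p U v Y f = compactness_size I p Y (weighted_range U v Y f)"

primrec inner_ideal :: "compactness \<Rightarrow> compactness"
  where
    "inner_ideal Kp = Kwp"
  | "inner_ideal Kwp = Kwp"
  | "inner_ideal Kup = Kup"

section \<open>Agreement with the library notions on types\<close>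

lemma bounded_operator_type_space:
  "bounded_operator type_space type_space T \<longleftrightarrow>
    bounded_linear T \<and> (\<forall>c x. T (c *\<^sub>C x) = c *\<^sub>C T x)"
proof
  assume T: "bounded_operator type_space type_space T"
  then have add: "\<And>x y. T (x + y) = T x + T y"
    and scale: "\<And>c x. T (c *\<^sub>C x) = c *\<^sub>C T x"
    by (simp_all add: bounded_operator_def type_space_def)
  from T obtain K where K: "\<And>x. norm (T x) \<le> K * norm x"
    by (auto simp: bounded_operator_def type_space_def)
  have "bounded_linear T"
  proof (rule bounded_linear_intro[where K = K])
    show "T (r *\<^sub>R x) = r *\<^sub>R T x" for r x
      using scale[of "of_real r" x] by (simp add: scaleC_of_real)
  qed (use add K in \<open>auto simp: mult.commute\<close>)
  with scale show "bounded_linear T \<and> (\<forall>c x. T (c *\<^sub>C x) = c *\<^sub>C T x)"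
    by blast
next
  assume T: "bounded_linear T \<and> (\<forall>c x. T (c *\<^sub>C x) = c *\<^sub>C T x)"
  then interpret bounded_linear T by blast
  from bounded obtain K where "\<forall>x. norm (T x) \<le> norm x * K" by blast
  with T show "bounded_operator type_space type_space T"
    by (auto simp: bounded_operator_def type_space_def add mult.commute)
qed

lemma cs_diff_type_space: "cs_diff type_space x y = x - y"
  using scaleC_of_real[of "-1" y] by (simp add: cs_diff_def type_space_def)

lemma cs_sums_type_space: "cs_sums type_space y s \<longleftrightarrow> y sums s"
proof -
  have "cs_psum type_space y n = (\<Sum>i<n. y i)" for n
    by (induction n) (simp_all add: type_space_def)
  then show ?thesis
    by (simp add: cs_sums_def cs_diff_type_space)
       (simp add: type_space_def sums_def tendsto_norm_zero_iff LIM_zero_iff)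
qed

lemma holomorphic_into_type_space:
  "holomorphic_into type_space U f \<longleftrightarrow>
    (\<forall>x\<in>U. \<exists>L. (f has_derivative L) (at x) \<and> (\<forall>c h. L (c *\<^sub>C h) = c *\<^sub>C L h))"
  by (auto simp: holomorphic_into_def bounded_operator_type_space cs_diff_type_space has_derivative_at)
     (auto simp: type_space_def)

end

theory Submission
  imports Defs "HOL-Complex_Analysis.Complex_Analysis"
begin

text \<open>
  If the weighted range of \<open>f\<close> lies in the \<open>p\<close>-convex hull of \<open>(x\<^sub>n)\<close>, let \<open>\<Phi>\<close> be the operator
  \<open>a \<mapsto> \<Sum>n. a\<^sub>n x\<^sub>n\<close> on \<open>\<ell>\<^sub>q\<close> (or \<open>c\<^sub>0\<close>), let \<open>G\<close> be the quotient by its kernel, \<open>S\<close> the induced injection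
  and \<open>g = S\<^sup>-\<^sup>1 \<circ> f\<close>; the images of the unit vectors generate a \<open>p\<close>-convex hull containing the
  weighted range of \<open>g\<close>. In the unconditional case one first writes \<open>x\<^sub>n = \<theta>\<^sub>n y\<^sub>n\<close> with \<open>\<theta>\<^sub>n\<close> decreasing to
  \<open>0\<close>. The only delicate point is that \<open>g\<close> is holomorphic, since the unit ball of \<open>c\<^sub>0\<close> is not weakly
  compact. On bounded holomorphic functions on the unit disc, each functional
  \<open>\<phi> \<mapsto> \<Sum>k. \<mu>\<^sub>k \<phi>\<^sup>(\<^sup>k\<^sup>)(0)/k!\<close> with \<open>\<mu>\<close> of geometric decay is an absolutely convergent sum of point evaluations.
  Hence derivatives and Taylor remainders of \<open>f\<close> are absolutely convergent sums of values of \<open>f\<close>,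
  so they lie in the range of \<open>S\<close> with control of the norm in \<open>G\<close>.

  Conversely, if \<open>f = S \<circ> g\<close>, the Hahn-Banach theorem and Hoelder's inequality bound the weighted
  range of \<open>g\<close> by the weak norm of a generating sequence.
\<close>

section \<open>The sequence spaces\<close>

text \<open>Functionals on \<open>F\<close> composed with \<open>S\<close> separate the points of
  \<open>G\<close> but need not determine its norm. Knowing that every such functional makes
  \<open>g\<close> holomorphic therefore gives no estimate in \<open>G\<close>, and each estimate
  there has to come from an explicit preimage in the sequence space. This is the purpose of the
  point evaluations: their nodes and coefficients are the same for all functionals, so the preimages
  of the values of \<open>f\<close> can be summed in the sequence space before any functional is
  applied. The images of the unit vectors are weakly \<open>p\<close>-summable with norm at most 1,
  but in general not strongly summable; hence \<open>Kwp\<close> is the inner ideal of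
  \<open>Kp\<close>. Their tails need not become small either, and this is what the factors
  \<theta>_n repair in the unconditional case. Neither the quotient norm nor the sizes are attained
  in general, so the norm formula is reached through approximations: a factor 1 + \<epsilon> on one
  side, a limit on the other.\<close>

lemma Holder_sum:
  fixes f g :: "'i \<Rightarrow> real"
  assumes "p > 1" "q > 1" "1/p + 1/q = 1" "finite A"
    and nn: "\<And>i. i \<in> A \<Longrightarrow> f i \<ge> 0" "\<And>i. i \<in> A \<Longrightarrow> g i \<ge> 0"
  shows "(\<Sum>i\<in>A. f i * g i) \<le> (\<Sum>i\<in>A. f i powr p) powr (1/p) * (\<Sum>i\<in>A. g i powr q) powr (1/q)"
proof -
  define a where "a = (\<Sum>i\<in>A. f i powr p) powr (1/p)"
  define b where "b = (\<Sum>i\<in>A. g i powr q) powr (1/q)"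
  have ap: "a powr p = (\<Sum>i\<in>A. f i powr p)" and bq: "b powr q = (\<Sum>i\<in>A. g i powr q)"
    using assms(1,2) by (simp_all add: a_def b_def powr_powr sum_nonneg)
  show ?thesis
  proof (cases "a = 0 \<or> b = 0")
    case True
    have "f i * g i = 0" if "i \<in> A" for i
      using True
    proof
      assume "a = 0"
      then have "(\<Sum>i\<in>A. f i powr p) = 0" by (simp add: a_def)
      then show ?thesis using that assms by (simp add: sum_nonneg_eq_0_iff)
    next
      assume "b = 0"
      then have "(\<Sum>i\<in>A. g i powr q) = 0" by (simp add: b_def)
      then show ?thesis using that assms by (simp add: sum_nonneg_eq_0_iff)
    qed
    then show ?thesis by (simp add: sum.neutral)
  next
    case False
    then have pos: "a > 0" "b > 0" by (auto simp: a_def b_def)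
    have "f i / a * (g i / b) \<le> f i powr p / a powr p / p + g i powr q / b powr q / q" if "i \<in> A" for i
      using Youngs_inequality[OF assms(1-3), of "f i / a" "g i / b"] pos nn that
      by (simp add: powr_divide)
    then have "(\<Sum>i\<in>A. f i / a * (g i / b)) \<le> (\<Sum>i\<in>A. f i powr p / a powr p / p + g i powr q / b powr q / q)"
      by (rule sum_mono)
    also have "\<dots> = a powr p / a powr p / p + b powr q / b powr q / q"
      by (simp add: sum.distrib ap bq flip: sum_divide_distrib)
    also have "\<dots> = 1" using pos assms(3) by simp
    also have "(\<Sum>i\<in>A. f i / a * (g i / b)) = (\<Sum>i\<in>A. f i * g i) / (a * b)"
      by (simp add: sum_divide_distrib)
    finally show ?thesis using pos by (simp add: a_def b_def)
  qed
qed

lemma Holder_sum_attained: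
  fixes a :: "'i \<Rightarrow> complex"
  assumes "p > 1" "q > 1" "1/p + 1/q = 1" "finite A"
  obtains b where "(\<Sum>i\<in>A. cmod (b i) powr q) \<le> 1"
    "(\<Sum>i\<in>A. a i * b i) = of_real ((\<Sum>i\<in>A. cmod (a i) powr p) powr (1/p))"
proof (cases "(\<Sum>i\<in>A. cmod (a i) powr p) = 0")
  case True
  show ?thesis by (rule that[of "\<lambda>_. 0"]) (use True assms in simp_all)
next
  case False
  define s where "s = (\<Sum>i\<in>A. cmod (a i) powr p)"
  have s: "s > 0" using False by (simp add: s_def sum_nonneg less_le)
  \<comment> \<open>The equality case of Hoelder's inequality: (p - 1) q = p makes |b i|^q
    proportional to |a i|^p, and the denominator normalises the sum to 1.\<close>
  define b where "b i = cnj (sgn (a i)) * of_real (cmod (a i) powr (p - 1) / s powr (1/q))" for i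
  have pq: "(p - 1) * q = p" and q': "1 - 1/q = 1/p" using assms by (simp_all add: field_simps)
  have "cmod (b i) powr q = cmod (a i) powr p / s" for i
  proof (cases "a i = 0")
    case False
    then have "cmod (b i) = cmod (a i) powr (p - 1) / s powr (1/q)"
      using s by (simp add: b_def norm_mult norm_sgn norm_divide)
    then show ?thesis using s assms by (simp add: powr_divide powr_powr pq)
  qed (use assms in \<open>simp add: b_def\<close>)
  then have 1: "(\<Sum>i\<in>A. cmod (b i) powr q) = 1" using s by (simp add: s_def flip: sum_divide_distrib)
  have "a i * b i = of_real (cmod (a i) powr p / s powr (1/q))" for i
  proof (cases "a i = 0")
    case False
    have "a i * b i = (a i * cnj (sgn (a i))) * of_real (cmod (a i) powr (p - 1) / s powr (1/q))"
      by (simp add: b_def)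
    also have "a i * cnj (sgn (a i)) = of_real (cmod (a i))"
      using False by (simp add: sgn_eq complex_norm_square[symmetric] power2_eq_square)
    also have "of_real (cmod (a i)) * of_real (cmod (a i) powr (p - 1) / s powr (1/q))
       = (of_real (cmod (a i) * cmod (a i) powr (p - 1) / s powr (1/q)) :: complex)" by simp
    also have "cmod (a i) * cmod (a i) powr (p - 1) = cmod (a i) powr p"
      using False by (simp add: powr_diff)
    finally show ?thesis .
  qed (use assms in simp)
  then have "(\<Sum>i\<in>A. a i * b i) = of_real (s / s powr (1/q))"
    by (simp add: s_def flip: of_real_sum sum_divide_distrib)
  also have "s / s powr (1/q) = s powr (1/p)"
    using s q' by (metis powr_diff powr_one less_imp_le)
  finally show ?thesis using that[of b] 1 by (simp add: s_def)
qed

lemma conj_index: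
  assumes "1 < p"
  shows "1 < conj_index p" "1/p + 1/conj_index p = 1" "1/conj_index p + 1/p = 1" "conj_index p > 0"
  using assms by (auto simp: conj_index_def field_simps)

lemma conj_seq_space_simps [simp]:
  "cs_zero (conj_seq_space p) = (\<lambda>n. 0)"
  "cs_add (conj_seq_space p) a b = (\<lambda>n. a n + b n)"
  "cs_scale (conj_seq_space p) c a = (\<lambda>n. c * a n)"
  by (simp_all add: conj_seq_space_def)

lemma cs_diff_conj_seq_space [simp]: "cs_diff (conj_seq_space p) a b = (\<lambda>n. a n - b n)"
  by (simp add: cs_diff_def)

text \<open>The norm as a supremum over finitely supported elements of the dual ball; this treats
  \<open>c\<^sub>0\<close> and \<open>\<ell>\<^sub>q\<close> uniformly.\<close>

definition dual_bound :: "real \<Rightarrow> (nat \<Rightarrow> complex) \<Rightarrow> real \<Rightarrow> bool"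
  where "dual_bound p a K \<longleftrightarrow>
    (\<forall>N b. cmod (\<Sum>n<N. a n * b n) \<le> K * (\<Sum>n<N. cmod (b n) powr p) powr (1/p))"

lemma c0_bdd_above: "(a :: nat \<Rightarrow> complex) \<longlonglongrightarrow> 0 \<Longrightarrow> bdd_above (range (\<lambda>n. cmod (a n)))"
proof -
  assume "a \<longlonglongrightarrow> 0"
  then have "Bseq a" by (metis Bseq_eq_bounded convergentI convergent_imp_Bseq)
  then show ?thesis by (auto simp: Bseq_def bdd_above_def)
qed

lemma conj_norm_one: "cs_norm (conj_seq_space 1) a = (SUP n. cmod (a n))"
  and conj_carrier_one: "cs_carrier (conj_seq_space 1) = {a. a \<longlonglongrightarrow> 0}"
  by (simp_all add: conj_seq_space_def)

lemma conj_norm_gt: "1 < p \<Longrightarrow> cs_norm (conj_seq_space p) a = (\<Sum>n. cmod (a n) powr conj_index p) powr (1 / conj_index p)"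
  and conj_carrier_gt: "1 < p \<Longrightarrow> cs_carrier (conj_seq_space p) = {a. summable (\<lambda>n. cmod (a n) powr conj_index p)}"
  by (simp_all add: conj_seq_space_def)

lemma dual_bound_one:
  assumes "0 \<le> K"
  shows "dual_bound 1 a K \<longleftrightarrow> (\<forall>n. cmod (a n) \<le> K)"
proof
  assume D: "dual_bound 1 a K"
  show "\<forall>n. cmod (a n) \<le> K"
  proof
    fix n
    have "(\<Sum>m<Suc n. a m * (if m = n then 1 else 0)) = a n"
      by (simp add: sum.neutral)
    moreover have "(\<Sum>m<Suc n. cmod (if m = n then 1 else 0) powr 1) = 1"
      by (simp add: sum.neutral)
    ultimately show "cmod (a n) \<le> K"
      using D[unfolded dual_bound_def, rule_format, of "\<lambda>m. if m = n then 1 else 0" "Suc n"]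
      by (simp del: sum.lessThan_Suc)
  qed
next
  assume "\<forall>n. cmod (a n) \<le> K"
  then show "dual_bound 1 a K"
    unfolding dual_bound_def
    by (auto intro!: order.trans[OF norm_sum] sum_mono mult_right_mono
        simp: norm_mult sum_distrib_left sum_nonneg)
qed

lemma dual_bound_gt:
  assumes p: "1 < p" and "0 \<le> K"
  shows "dual_bound p a K \<longleftrightarrow>
    a \<in> cs_carrier (conj_seq_space p) \<and> cs_norm (conj_seq_space p) a \<le> K" (is "_ \<longleftrightarrow> ?R")
proof
  define q where "q = conj_index p"
  note q = conj_index[OF p, folded q_def]
  {
    assume D: "dual_bound p a K"
    have le: "(\<Sum>n<N. cmod (a n) powr q) \<le> K powr q" for N
    proof -
      obtain b where b: "(\<Sum>n<N. cmod (b n) powr p) \<le> 1"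
        "(\<Sum>n<N. a n * b n) = of_real ((\<Sum>n<N. cmod (a n) powr q) powr (1/q))"
        using Holder_sum_attained[OF q(1) p q(3), of "{..<N}" a] by auto
      have "(\<Sum>n<N. cmod (a n) powr q) powr (1/q) \<le> K * (\<Sum>n<N. cmod (b n) powr p) powr (1/p)"
        using D[unfolded dual_bound_def, rule_format, of b N] b(2) by simp
      also have "\<dots> \<le> K * 1"
        using b(1) p \<open>0 \<le> K\<close> by (intro mult_left_mono powr_le1) (auto simp: abs_of_nonneg sum_nonneg)
      finally have "((\<Sum>n<N. cmod (a n) powr q) powr (1/q)) powr q \<le> K powr q"
        using q by (intro powr_mono2) auto
      then show ?thesis using q by (simp add: powr_powr sum_nonneg)
    qed
    then have s: "summable (\<lambda>n. cmod (a n) powr q)"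
      by (intro summableI_nonneg_bounded[where x = "K powr q"]) auto
    have "(\<Sum>n. cmod (a n) powr q) \<le> K powr q"
      using le s by (intro suminf_le_const) auto
    then have "(\<Sum>n. cmod (a n) powr q) powr (1/q) \<le> (K powr q) powr (1/q)"
      using q s by (intro powr_mono2) (auto intro: suminf_nonneg)
    then show ?R using s p q \<open>0 \<le> K\<close>
      by (simp add: conj_norm_gt conj_carrier_gt powr_powr flip: q_def)
  next
    assume ?R
    then have s: "summable (\<lambda>n. cmod (a n) powr q)"
      and le: "(\<Sum>n. cmod (a n) powr q) powr (1/q) \<le> K"
      using p by (simp_all add: conj_norm_gt conj_carrier_gt q_def)
    show "dual_bound p a K"
      unfolding dual_bound_def
    proof (intro allI)
      fix N b
      have "cmod (\<Sum>n<N. a n * b n) \<le> (\<Sum>n<N. cmod (a n) * cmod (b n))"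
        by (intro order.trans[OF norm_sum]) (simp add: norm_mult)
      also have "\<dots> \<le> (\<Sum>n<N. cmod (a n) powr q) powr (1/q) * (\<Sum>n<N. cmod (b n) powr p) powr (1/p)"
        using q p by (intro Holder_sum) auto
      also have "(\<Sum>n<N. cmod (a n) powr q) powr (1/q) \<le> (\<Sum>n. cmod (a n) powr q) powr (1/q)"
        using q s by (intro powr_mono2 sum_le_suminf) (auto intro: sum_nonneg)
      also note le
      finally show "cmod (\<Sum>n<N. a n * b n) \<le> K * (\<Sum>n<N. cmod (b n) powr p) powr (1/p)"
        by (simp add: mult_right_mono)
    qed
  }
qed

lemma conj_norm_nonneg: "1 \<le> p \<Longrightarrow> a \<in> cs_carrier (conj_seq_space p) \<Longrightarrow> 0 \<le> cs_norm (conj_seq_space p) a"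
proof (cases "p = 1")
  case True
  assume "a \<in> cs_carrier (conj_seq_space p)"
  then have "cmod (a 0) \<le> (SUP n. cmod (a n))" using True
    by (intro cSUP_upper c0_bdd_above) (auto simp: conj_carrier_one)
  then have "0 \<le> (SUP n. cmod (a n))"
    using norm_ge_zero order_trans by blast
  then show ?thesis by (simp add: True conj_norm_one)
next
  case False
  assume "1 \<le> p"
  then show ?thesis using False by (simp add: conj_norm_gt)
qed

text \<open>Membership is a hypothesis because for \<open>p = 1\<close> the predicate
  \<open>dual_bound\<close> expresses boundedness only, not convergence to 0.\<close>

lemma conj_norm_le_iff:
  assumes "1 \<le> p" "0 \<le> K" "a \<in> cs_carrier (conj_seq_space p)"
  shows "cs_norm (conj_seq_space p) a \<le> K \<longleftrightarrow> dual_bound p a K"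
proof (cases "p = 1")
  case True
  with assms have "bdd_above (range (\<lambda>n. cmod (a n)))"
    by (intro c0_bdd_above) (simp add: conj_carrier_one)
  then show ?thesis using assms(2) True
    by (auto simp: conj_norm_one dual_bound_one cSUP_le_iff)
next
  case False
  with assms show ?thesis by (simp add: dual_bound_gt)
qed

lemma conj_dual_bound:
  "1 \<le> p \<Longrightarrow> a \<in> cs_carrier (conj_seq_space p) \<Longrightarrow> dual_bound p a (cs_norm (conj_seq_space p) a)"
  using conj_norm_le_iff[OF _ conj_norm_nonneg] by blast

lemma conj_Holder:
  assumes "1 \<le> p" "a \<in> cs_carrier (conj_seq_space p)"
  shows "cmod (\<Sum>n<N. a n * b n) \<le> cs_norm (conj_seq_space p) a * (\<Sum>n<N. cmod (b n) powr p) powr (1/p)"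
  using conj_dual_bound[OF assms] by (simp add: dual_bound_def)

lemma dual_bound_mono:
  assumes "dual_bound p b K" "\<And>n. cmod (a n) \<le> cmod (b n)" "0 < p" "0 \<le> K"
  shows "dual_bound p a K"
  unfolding dual_bound_def
proof (intro allI)
  fix N c
  \<comment> \<open>The ratio of \<open>a\<close> to \<open>b\<close> has modulus at most 1 and is
    moved to the test sequence; where \<open>b n = 0\<close>, also \<open>a n = 0\<close>.\<close>
  define d where "d n = (if b n = 0 then 0 else a n / b n) * c n" for n
  have "cmod (d n) \<le> cmod (c n)" for n
    using assms(2)[of n] by (auto simp: d_def norm_mult norm_divide field_simps intro!: mult_right_mono)
  then have "(\<Sum>n<N. cmod (d n) powr p) powr (1/p) \<le> (\<Sum>n<N. cmod (c n) powr p) powr (1/p)"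
    using assms(3) by (intro powr_mono2 sum_mono sum_nonneg) auto
  moreover have "a n * c n = b n * d n" for n
    using assms(2)[of n] by (auto simp: d_def)
  then have "cmod (\<Sum>n<N. a n * c n) \<le> K * (\<Sum>n<N. cmod (d n) powr p) powr (1/p)"
    using assms(1) by (simp add: dual_bound_def)
  ultimately show "cmod (\<Sum>n<N. a n * c n) \<le> K * (\<Sum>n<N. cmod (c n) powr p) powr (1/p)"
    using assms(4) by (meson mult_left_mono order_trans)
qed

lemma conj_dominated:
  assumes "1 \<le> p" "b \<in> cs_carrier (conj_seq_space p)" "\<And>n. cmod (a n) \<le> cmod (b n)"
  shows "a \<in> cs_carrier (conj_seq_space p)"
    "cs_norm (conj_seq_space p) a \<le> cs_norm (conj_seq_space p) b"
proof -
  have D: "dual_bound p a (cs_norm (conj_seq_space p) b)"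
    using assms by (intro dual_bound_mono[OF conj_dual_bound]) (auto intro: conj_norm_nonneg)
  show a: "a \<in> cs_carrier (conj_seq_space p)"
  proof (cases "p = 1")
    case True
    with assms show ?thesis by (auto simp: conj_carrier_one intro!: Lim_null_comparison[where g = "\<lambda>n. cmod (b n)"] tendsto_norm_zero)
  next
    case False
    with D assms show ?thesis by (simp add: dual_bound_gt conj_norm_nonneg)
  qed
  show "cs_norm (conj_seq_space p) a \<le> cs_norm (conj_seq_space p) b"
    using conj_norm_le_iff[OF assms(1) _ a] conj_norm_nonneg assms D by blast
qed

text \<open>Minkowski's inequality comes from duality for all \<open>p\<close> at once, since
  \<open>dual_bound\<close> is additive in its bounds.\<close>

lemma conj_add:
  assumes p: "1 \<le> p" and a: "a \<in> cs_carrier (conj_seq_space p)" and b: "b \<in> cs_carrier (conj_seq_space p)"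
  shows "(\<lambda>n. a n + b n) \<in> cs_carrier (conj_seq_space p)"
    "cs_norm (conj_seq_space p) (\<lambda>n. a n + b n) \<le> cs_norm (conj_seq_space p) a + cs_norm (conj_seq_space p) b"
proof -
  let ?K = "cs_norm (conj_seq_space p) a + cs_norm (conj_seq_space p) b"
  have K: "0 \<le> ?K" using assms by (simp add: conj_norm_nonneg)
  have D: "dual_bound p (\<lambda>n. a n + b n) ?K"
    unfolding dual_bound_def
    using conj_Holder[OF p a] conj_Holder[OF p b]
    by (simp add: algebra_simps sum.distrib) (meson add_mono norm_triangle_le)
  show c: "(\<lambda>n. a n + b n) \<in> cs_carrier (conj_seq_space p)"
  proof (cases "p = 1")
    case True
    with assms show ?thesis using tendsto_add[of a 0 sequentially b 0] by (simp add: conj_carrier_one)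
  next
    case False
    with D p K show ?thesis by (simp add: dual_bound_gt)
  qed
  show "cs_norm (conj_seq_space p) (\<lambda>n. a n + b n) \<le> ?K"
    using conj_norm_le_iff[OF p K c] D by blast
qed

lemma conj_zero: "1 \<le> p \<Longrightarrow> (\<lambda>n. 0) \<in> cs_carrier (conj_seq_space p)"
  by (cases "p = 1") (simp_all add: conj_carrier_one conj_carrier_gt)

lemma conj_scale:
  assumes p: "1 \<le> p" and a: "a \<in> cs_carrier (conj_seq_space p)"
  shows "(\<lambda>n. c * a n) \<in> cs_carrier (conj_seq_space p)"
    "cs_norm (conj_seq_space p) (\<lambda>n. c * a n) = cmod c * cs_norm (conj_seq_space p) a"
proof -
  have c: "(\<lambda>n. c * a n) \<in> cs_carrier (conj_seq_space p)
     \<and> cs_norm (conj_seq_space p) (\<lambda>n. c * a n) \<le> cmod c * cs_norm (conj_seq_space p) a"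
    if a: "a \<in> cs_carrier (conj_seq_space p)" for a c
  proof -
    have "(\<lambda>n. c * a n) \<in> cs_carrier (conj_seq_space p)"
    proof (cases "p = 1")
      case True
      with a show ?thesis using tendsto_mult_right_zero[of a sequentially c] by (simp add: conj_carrier_one)
    next
      case False
      with a p show ?thesis by (simp add: conj_carrier_gt norm_mult powr_mult summable_mult)
    qed
    moreover have "dual_bound p (\<lambda>n. c * a n) (cmod c * cs_norm (conj_seq_space p) a)"
      unfolding dual_bound_def using conj_Holder[OF p a]
      by (simp add: mult.assoc norm_mult mult_left_mono flip: sum_distrib_left)
    ultimately show ?thesis using conj_norm_le_iff[OF p] conj_norm_nonneg[OF p a]
      by (meson mult_nonneg_nonneg norm_ge_zero)
  qed
  show 1: "(\<lambda>n. c * a n) \<in> cs_carrier (conj_seq_space p)" using c[OF a] by blast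
  show "cs_norm (conj_seq_space p) (\<lambda>n. c * a n) = cmod c * cs_norm (conj_seq_space p) a"
  proof (cases "c = 0")
    case True
    then show ?thesis using c[OF a, of c] conj_norm_nonneg[OF p 1] by simp
  next
    case False
    have "cs_norm (conj_seq_space p) a \<le> inverse (cmod c) * cs_norm (conj_seq_space p) (\<lambda>n. c * a n)"
      using c[OF 1, of "inverse c"] False by (simp add: norm_inverse flip: mult.assoc)
    then show ?thesis using c[OF a, of c] False by (simp add: field_simps)
  qed
qed

lemma conj_norm_coord:
  assumes "1 \<le> p" "a \<in> cs_carrier (conj_seq_space p)"
  shows "cmod (a k) \<le> cs_norm (conj_seq_space p) a"
proof -
  have "(\<Sum>n<Suc k. a n * (if n = k then 1 else 0)) = a k" by (simp add: sum.neutral)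
  moreover have "(\<Sum>n<Suc k. cmod (if n = k then 1 else 0) powr p) = 1"
    by (simp add: sum.neutral)
  ultimately show ?thesis
    using conj_Holder[OF assms, of "\<lambda>n. if n = k then 1 else 0" "Suc k"]
    by (simp del: sum.lessThan_Suc)
qed

text \<open>Density of the finitely supported sequences. It fails in \<ell>_\<infinity>, which is
  why \<open>p = 1\<close> goes with c_0; the convergence of all series with coefficients in the
  space rests on it.\<close>

lemma conj_tail:
  assumes p: "1 \<le> p" and a: "a \<in> cs_carrier (conj_seq_space p)"
  shows "(\<lambda>N. cs_norm (conj_seq_space p) (\<lambda>n. if n < N then 0 else a n)) \<longlonglongrightarrow> 0"
proof (cases "p = 1")
  case True
  show ?thesis
  proof (rule LIMSEQ_I)
    fix r :: real assume "r > 0"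
    then obtain M where M: "\<And>n. n \<ge> M \<Longrightarrow> cmod (a n) < r/2"
      using a True LIMSEQ_D[of a 0 "r/2"] by (auto simp: conj_carrier_one)
    have "norm (cs_norm (conj_seq_space p) (\<lambda>n. if n < N then 0 else a n) - 0) < r" if "N \<ge> M" for N
    proof -
      have c: "(\<lambda>n. if n < N then 0 else a n) \<in> cs_carrier (conj_seq_space p)"
        by (rule conj_dominated[OF p a]) auto
      have "cs_norm (conj_seq_space p) (\<lambda>n. if n < N then 0 else a n) \<le> r/2"
        unfolding True conj_norm_one using M that \<open>r > 0\<close> by (intro cSUP_least) (auto simp: less_imp_le)
      then show ?thesis using conj_norm_nonneg[OF p c] \<open>r > 0\<close> by simp
    qed
    then show "\<exists>M. \<forall>N\<ge>M. norm (cs_norm (conj_seq_space p) (\<lambda>n. if n < N then 0 else a n) - 0) < r" by blast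
  qed
next
  case False
  with p have p: "1 < p" by simp
  define q where "q = conj_index p"
  note q = conj_index[OF p, folded q_def]
  have s: "summable (\<lambda>n. cmod (a n) powr q)" using a p by (simp add: conj_carrier_gt q_def)
  have "(\<Sum>n. cmod (if n < N then 0 else a n) powr q) = (\<Sum>n. cmod (a n) powr q) - (\<Sum>n<N. cmod (a n) powr q)" for N
  proof -
    have "(\<Sum>n. cmod (if n < N then 0 else a n) powr q)
       = (\<Sum>n. cmod (a n) powr q - (if n \<in> {..<N} then cmod (a n) powr q else 0))"
      using q by (intro suminf_cong) auto
    also have "\<dots> = (\<Sum>n. cmod (a n) powr q) - (\<Sum>n<N. cmod (a n) powr q)"
      by (rule suminf_diff[OF s, symmetric, THEN trans])
        (use sums_If_finite_set[of "{..<N}" "\<lambda>n. cmod (a n) powr q"] in \<open>auto simp: sums_iff\<close>)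
    finally show ?thesis .
  qed
  moreover have "(\<lambda>N. ((\<Sum>n. cmod (a n) powr q) - (\<Sum>n<N. cmod (a n) powr q)) powr (1/q)) \<longlonglongrightarrow> 0"
  proof (rule tendsto_zero_powrI)
    show "(\<lambda>N. (\<Sum>n. cmod (a n) powr q) - (\<Sum>n<N. cmod (a n) powr q)) \<longlonglongrightarrow> 0"
      using tendsto_diff[OF tendsto_const summable_LIMSEQ[OF s], of "\<Sum>n. cmod (a n) powr q"] by simp
  qed (use q in \<open>auto intro!: always_eventually sum_le_suminf[OF s]\<close>)
  ultimately show ?thesis using p by (simp add: conj_norm_gt flip: q_def)
qed

text \<open>Completeness in the form used later: an absolutely convergent series may be summed
  coordinatewise, and its norm is at most the sum of the norms.\<close>

lemma conj_suminf:
  assumes p: "1 \<le> p" and b: "\<And>i. b i \<in> cs_carrier (conj_seq_space p)"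
    and le: "\<And>i. cs_norm (conj_seq_space p) (b i) \<le> K i" and K: "summable K"
  shows "(\<lambda>n. \<Sum>i. b i n) \<in> cs_carrier (conj_seq_space p)"
    "cs_norm (conj_seq_space p) (\<lambda>n. \<Sum>i. b i n) \<le> (\<Sum>i. K i)"
    "\<And>n. summable (\<lambda>i. b i n)"
proof -
  have K0: "0 \<le> K i" for i using conj_norm_nonneg[OF p b] le order_trans by blast
  have ble: "cmod (b i n) \<le> K i" for i n
    using conj_norm_coord[OF p b] le order_trans by blast
  show s: "summable (\<lambda>i. b i n)" for n
    by (rule summable_comparison_test'[OF K]) (use ble in auto)
  have D: "dual_bound p (\<lambda>n. \<Sum>i. b i n) (\<Sum>i. K i)"
    unfolding dual_bound_def
  proof (intro allI)
    fix N :: nat and c :: "nat \<Rightarrow> complex"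
    let ?d = "(\<Sum>n<N. cmod (c n) powr p) powr (1/p)"
    have "cmod (\<Sum>n<N. b i n * c n) \<le> K i * ?d" for i
      using conj_Holder[OF p b[of i], of c N] le[of i] by (meson mult_right_mono order_trans powr_ge_zero)
    moreover have "(\<Sum>n<N. (\<Sum>i. b i n) * c n) = (\<Sum>i. \<Sum>n<N. b i n * c n)"
    proof -
      have "(\<Sum>n<N. (\<Sum>i. b i n) * c n) = (\<Sum>n<N. \<Sum>i. b i n * c n)"
        by (rule sum.cong[OF refl], rule suminf_mult2[OF s])
      also have "\<dots> = (\<Sum>i. \<Sum>n<N. b i n * c n)"
        by (rule suminf_sum[symmetric], rule summable_mult2[OF s])
      finally show ?thesis .
    qed
    moreover have "cmod (\<Sum>i. \<Sum>n<N. b i n * c n) \<le> (\<Sum>i. K i * ?d)"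
      by (rule norm_suminf_le[OF calculation(1) summable_mult2[OF K]])
    ultimately show "cmod (\<Sum>n<N. (\<Sum>i. b i n) * c n) \<le> (\<Sum>i. K i) * ?d"
      by (metis suminf_mult2[OF K])
  qed
  show c: "(\<lambda>n. \<Sum>i. b i n) \<in> cs_carrier (conj_seq_space p)"
  proof (cases "p = 1")
    case True
    \<comment> \<open>In c_0 the bound \<open>D\<close> does not yield membership; the limit 0 is
      inherited from the partial sums by uniform convergence.\<close>
    have u: "uniform_limit UNIV (\<lambda>m n. \<Sum>i<m. b i n) (\<lambda>n. \<Sum>i. b i n) sequentially"
      by (rule Weierstrass_m_test[OF _ K]) (use ble in auto)
    have "(\<lambda>n. \<Sum>i<m. b i n) \<longlonglongrightarrow> 0" for m
      by (rule tendsto_null_sum) (use b True in \<open>auto simp: conj_carrier_one\<close>)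
    then have "\<forall>\<^sub>F m in sequentially. (\<lambda>n. \<Sum>i<m. b i n) \<longlonglongrightarrow> 0" by simp
    then have "(\<lambda>n. \<Sum>i. b i n) \<longlonglongrightarrow> 0"
      by (rule swap_uniform_limit'[OF _ tendsto_const u]) simp_all
    then show ?thesis by (simp add: True conj_carrier_one)
  next
    case False
    with D p K0 K show ?thesis by (simp add: dual_bound_gt suminf_nonneg)
  qed
  show "cs_norm (conj_seq_space p) (\<lambda>n. \<Sum>i. b i n) \<le> (\<Sum>i. K i)"
    using conj_norm_le_iff[OF p _ c] D K K0 by (meson suminf_nonneg)
qed

lemma conj_Holder_attained:
  assumes p: "1 \<le> p"
  obtains a where "a \<in> cs_ball (conj_seq_space p)" "\<And>n. n \<ge> N \<Longrightarrow> a n = 0"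
    "(\<Sum>n<N. a n * b n) = of_real ((\<Sum>n<N. cmod (b n) powr p) powr (1/p))"
proof (cases "p = 1")
  case True
  \<comment> \<open>Cutting the conjugate signs off at \<open>N\<close> keeps them in c_0.\<close>
  define a where "a n = (if n < N then cnj (sgn (b n)) else 0)" for n
  have "a \<longlonglongrightarrow> 0"
    by (rule tendsto_eventually, rule eventually_sequentiallyI[of N]) (simp add: a_def)
  moreover have "(SUP n. cmod (a n)) \<le> 1"
    by (rule cSUP_least) (auto simp: a_def norm_sgn)
  moreover have "cnj (sgn z) * z = of_real (cmod z)" for z
  proof -
    have "cnj (sgn z) * z = of_real (inverse (cmod z)) * (z * cnj z)"
      by (simp add: sgn_eq divide_inverse)
    then show ?thesis by (cases "z = 0") (simp_all add: complex_norm_square[symmetric] power2_eq_square)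
  qed
  then have "(\<Sum>n<N. a n * b n) = of_real ((\<Sum>n<N. cmod (b n) powr p) powr (1/p))"
    by (simp add: True a_def sum_nonneg)
  ultimately show ?thesis using that[of a]
    by (auto simp: True cs_ball_def conj_carrier_one conj_norm_one a_def)
next
  case False
  with p have p: "1 < p" by simp
  define q where "q = conj_index p"
  note q = conj_index[OF p, folded q_def]
  obtain c where c: "(\<Sum>n<N. cmod (c n) powr q) \<le> 1"
    "(\<Sum>n<N. b n * c n) = of_real ((\<Sum>n<N. cmod (b n) powr p) powr (1/p))"
    using Holder_sum_attained[OF p q(1,2), of "{..<N}" b] by auto
  define a where "a n = (if n < N then c n else 0)" for n
  have "(\<lambda>n. cmod (a n) powr q) sums (\<Sum>n<N. cmod (a n) powr q)"
    using q by (intro sums_finite) (auto simp: a_def)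
  then have s: "(\<lambda>n. cmod (a n) powr q) sums (\<Sum>n<N. cmod (c n) powr q)"
    by (simp add: a_def)
  have "a \<in> cs_ball (conj_seq_space p)"
    using s c(1) p q by (auto simp: cs_ball_def conj_carrier_gt conj_norm_gt sums_iff sum_nonneg
        simp flip: q_def intro!: powr_le1)
  moreover have "(\<Sum>n<N. a n * b n) = of_real ((\<Sum>n<N. cmod (b n) powr p) powr (1/p))"
    using c(2) by (simp add: a_def mult.commute)
  ultimately show ?thesis using that[of a] by (simp add: a_def)
qed

section \<open>Seminormed complex vector spaces with explicit carrier\<close>

text \<open>One set of axioms covers \<open>type_space\<close>, \<open>conj_seq_space p\<close> and
  its quotients, so that the Hahn-Banach theorem and the theory of weak norms are developed once for
  all three.\<close>

locale cnormed =
  fixes X :: "'a cspace"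
  assumes zero_in [simp]: "cs_zero X \<in> cs_carrier X"
    and add_in [simp]: "x \<in> cs_carrier X \<Longrightarrow> y \<in> cs_carrier X \<Longrightarrow> cs_add X x y \<in> cs_carrier X"
    and scale_in [simp]: "x \<in> cs_carrier X \<Longrightarrow> cs_scale X c x \<in> cs_carrier X"
    and add_assoc: "x \<in> cs_carrier X \<Longrightarrow> y \<in> cs_carrier X \<Longrightarrow> z \<in> cs_carrier X \<Longrightarrow>
      cs_add X (cs_add X x y) z = cs_add X x (cs_add X y z)"
    and add_comm: "x \<in> cs_carrier X \<Longrightarrow> y \<in> cs_carrier X \<Longrightarrow> cs_add X x y = cs_add X y x"
    and add_zero [simp]: "x \<in> cs_carrier X \<Longrightarrow> cs_add X x (cs_zero X) = x"
    and scale_add_right: "x \<in> cs_carrier X \<Longrightarrow> y \<in> cs_carrier X \<Longrightarrow>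
      cs_scale X c (cs_add X x y) = cs_add X (cs_scale X c x) (cs_scale X c y)"
    and scale_add_left: "x \<in> cs_carrier X \<Longrightarrow>
      cs_scale X (b + c) x = cs_add X (cs_scale X b x) (cs_scale X c x)"
    and scale_scale [simp]: "x \<in> cs_carrier X \<Longrightarrow> cs_scale X b (cs_scale X c x) = cs_scale X (b * c) x"
    and scale_one [simp]: "x \<in> cs_carrier X \<Longrightarrow> cs_scale X 1 x = x"
    and scale_0 [simp]: "x \<in> cs_carrier X \<Longrightarrow> cs_scale X 0 x = cs_zero X"
    and norm_add: "x \<in> cs_carrier X \<Longrightarrow> y \<in> cs_carrier X \<Longrightarrow>
      cs_norm X (cs_add X x y) \<le> cs_norm X x + cs_norm X y"
    and norm_scale: "x \<in> cs_carrier X \<Longrightarrow> cs_norm X (cs_scale X c x) = cmod c * cs_norm X x"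
begin

abbreviation "C \<equiv> cs_carrier X"
abbreviation "N \<equiv> cs_norm X"
abbreviation addX (infixl "\<oplus>" 65) where "x \<oplus> y \<equiv> cs_add X x y"
abbreviation scaleX (infixr "\<odot>" 75) where "c \<odot> x \<equiv> cs_scale X c x"

lemma add_left_comm: "x \<in> C \<Longrightarrow> y \<in> C \<Longrightarrow> z \<in> C \<Longrightarrow> x \<oplus> (y \<oplus> z) = y \<oplus> (x \<oplus> z)"
  by (metis add_assoc add_comm)

lemmas add_ac' = add_assoc add_comm add_left_comm

lemma add_zero_left [simp]: "x \<in> C \<Longrightarrow> cs_zero X \<oplus> x = x"
  using add_comm[of "cs_zero X" x] by simp

lemma scale_zero [simp]: "c \<odot> cs_zero X = cs_zero X"
  using scale_scale[of "cs_zero X" c 0] by simp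

lemma add_minus [simp]: "x \<in> C \<Longrightarrow> x \<oplus> (-1) \<odot> x = cs_zero X"
  using scale_add_left[of x 1 "-1"] by simp

lemma minus_add [simp]: "x \<in> C \<Longrightarrow> (-1) \<odot> x \<oplus> x = cs_zero X"
  using add_comm[of x "(-1) \<odot> x"] by simp

lemma add_minus_cancel [simp]:
  "x \<in> C \<Longrightarrow> y \<in> C \<Longrightarrow> x \<oplus> ((-1) \<odot> x \<oplus> y) = y"
  "x \<in> C \<Longrightarrow> y \<in> C \<Longrightarrow> (-1) \<odot> x \<oplus> (x \<oplus> y) = y"
  by (metis add_assoc add_minus add_zero_left scale_in,
      metis add_assoc minus_add add_zero_left scale_in)

lemma diff_in [simp]: "x \<in> C \<Longrightarrow> y \<in> C \<Longrightarrow> cs_diff X x y \<in> C"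
  by (simp add: cs_diff_def)

lemma norm_zero [simp]: "N (cs_zero X) = 0"
  using norm_scale[of "cs_zero X" 0] by simp

lemma norm_nonneg [simp]: "x \<in> C \<Longrightarrow> 0 \<le> N x"
  using norm_add[of x "(-1) \<odot> x"] by (simp add: norm_scale)

lemma dual_ball_le_norm:
  assumes "\<phi> \<in> dual_ball X" "x \<in> C"
  shows "cmod (\<phi> x) \<le> N x"
proof -
  have sc: "cmod (\<phi> (c \<odot> x)) = cmod c * cmod (\<phi> x)" for c
    using assms by (simp add: dual_ball_def bounded_operator_def type_space_def scaleC_complex_def norm_mult)
  have le: "cmod (\<phi> y) \<le> 1" if "y \<in> C" "N y \<le> 1" for y
    using assms that by (simp add: dual_ball_def cs_ball_def)
  have *: "t * cmod (\<phi> x) \<le> 1" if "t \<ge> 0" "t * N x \<le> 1" for t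
    using sc[of "of_real t"] le[of "of_real t \<odot> x"] assms(2) that by (simp add: norm_scale)
  show ?thesis
  proof (cases "N x = 0")
    case True
    \<comment> \<open>All positive multiples of a vector of seminorm 0 stay in the unit ball, so a
      nonzero value of \<phi> could be scaled beyond 1.\<close>
    have "cmod (\<phi> x) = 0"
    proof (rule ccontr)
      assume "cmod (\<phi> x) \<noteq> 0"
      then show False using *[of "2 / cmod (\<phi> x)"] True by simp
    qed
    then show ?thesis using True by simp
  next
    case False
    then have "N x > 0" using assms(2) by (simp add: less_le)
    then show ?thesis using *[of "1 / N x"] by (simp add: divide_le_eq)
  qed
qed

section \<open>The Hahn-Banach theorem\<close>

definition sublinear :: "('a \<Rightarrow> real) \<Rightarrow> bool"
  where "sublinear q \<longleftrightarrow> (\<forall>x\<in>C. \<forall>y\<in>C. q (x \<oplus> y) \<le> q x + q y) \<and>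
    (\<forall>t\<ge>0. \<forall>x\<in>C. q (of_real t \<odot> x) = t * q x)"

text \<open>For sublinear \<open>q\<close> this is the greatest sublinear functional below
  \<open>q\<close> whose value at the negative of \<open>y\<close> is at most \<open>- q y\<close>.
  The value 0 outside the carrier lets the pointwise order on functions compare such functionals by
  their values on the carrier.\<close>

definition lower :: "('a \<Rightarrow> real) \<Rightarrow> 'a \<Rightarrow> 'a \<Rightarrow> real"
  where "lower q y x = (if x \<in> C then INF t\<in>{0..}. q (x \<oplus> of_real t \<odot> y) - t * q y else 0)"

lemma sublinearD:
  assumes "sublinear q"
  shows "x \<in> C \<Longrightarrow> y \<in> C \<Longrightarrow> q (x \<oplus> y) \<le> q x + q y"
    "t \<ge> 0 \<Longrightarrow> x \<in> C \<Longrightarrow> q (of_real t \<odot> x) = t * q x"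
    "q (cs_zero X) = 0"
proof -
  show 1: "t \<ge> 0 \<Longrightarrow> x \<in> C \<Longrightarrow> q (of_real t \<odot> x) = t * q x" for t x
    using assms by (simp add: sublinear_def)
  show "q (cs_zero X) = 0" using 1[of 0 "cs_zero X"] by simp
qed (use assms in \<open>simp add: sublinear_def\<close>)

text \<open>A lower bound independent of \<open>t\<close>, which makes the infimum in
  \<open>lower\<close> meaningful.\<close>

lemma lower_bound:
  assumes q: "sublinear q" and "x \<in> C" "y \<in> C" "t \<ge> 0"
  shows "- q ((-1) \<odot> x) \<le> q (x \<oplus> of_real t \<odot> y) - t * q y"
proof -
  have "t * q y = q ((-1) \<odot> x \<oplus> (x \<oplus> of_real t \<odot> y))"
    using assms by (simp add: sublinearD(2)[OF q])
  also have "\<dots> \<le> q ((-1) \<odot> x) + q (x \<oplus> of_real t \<odot> y)"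
    using assms by (intro sublinearD) auto
  finally show ?thesis by simp
qed

lemma lower_le:
  assumes q: "sublinear q" and "x \<in> C" "y \<in> C" "t \<ge> 0"
  shows "lower q y x \<le> q (x \<oplus> of_real t \<odot> y) - t * q y"
  unfolding lower_def using assms lower_bound[OF q]
  by (auto intro!: cINF_lower bdd_belowI2[where m = "- q ((-1) \<odot> x)"])

lemma le_lower:
  assumes "x \<in> C" "\<And>t. t \<ge> 0 \<Longrightarrow> r \<le> q (x \<oplus> of_real t \<odot> y) - t * q y"
  shows "r \<le> lower q y x"
  unfolding lower_def using assms by (auto intro!: cINF_greatest)

lemma lower_sublinear:
  assumes q: "sublinear q" and y: "y \<in> C"
  shows "sublinear (lower q y)"
  unfolding sublinear_def
proof (intro conjI ballI allI impI)
  fix a b assume ab: "a \<in> C" "b \<in> C"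
  \<comment> \<open>Shifts by \<open>s\<close> and \<open>t\<close> combine to the shift by
    \<open>s + t\<close>; the infima over \<open>s\<close> and \<open>t\<close> are then taken one
    after the other.\<close>
  have *: "lower q y (a \<oplus> b) \<le> (q (a \<oplus> of_real s \<odot> y) - s * q y) + (q (b \<oplus> of_real t \<odot> y) - t * q y)"
    if st: "s \<ge> 0" "t \<ge> 0" for s t
  proof -
    have "lower q y (a \<oplus> b) \<le> q ((a \<oplus> b) \<oplus> of_real (s + t) \<odot> y) - (s + t) * q y"
      using ab y st by (intro lower_le[OF q]) auto
    also have "(a \<oplus> b) \<oplus> of_real (s + t) \<odot> y = (a \<oplus> of_real s \<odot> y) \<oplus> (b \<oplus> of_real t \<odot> y)"
      using ab y by (simp add: scale_add_left add_ac')
    also have "q \<dots> \<le> q (a \<oplus> of_real s \<odot> y) + q (b \<oplus> of_real t \<odot> y)"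
      using ab y by (intro sublinearD[OF q]) auto
    finally show ?thesis by (simp add: algebra_simps)
  qed
  have "lower q y (a \<oplus> b) - (q (a \<oplus> of_real s \<odot> y) - s * q y) \<le> lower q y b" if "s \<ge> 0" for s
    using *[OF that] ab by (intro le_lower) (auto simp: algebra_simps)
  then have "lower q y (a \<oplus> b) - lower q y b \<le> lower q y a"
    using ab by (intro le_lower) (auto simp: algebra_simps)
  then show "lower q y (a \<oplus> b) \<le> lower q y a + lower q y b" by simp
next
  fix c :: real and x assume c: "0 \<le> c" and x: "x \<in> C"
  \<comment> \<open>This inequality, applied to \<open>c\<close> and to \<open>1/c\<close>, yields
    equality.\<close>
  have *: "lower q y (of_real c \<odot> x) \<le> c * lower q y x" if c: "c > 0" and x: "x \<in> C" for c x
  proof -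
    have "lower q y (of_real c \<odot> x) / c \<le> q (x \<oplus> of_real t \<odot> y) - t * q y" if "t \<ge> 0" for t
    proof -
      have "lower q y (of_real c \<odot> x) \<le> q (of_real c \<odot> x \<oplus> of_real (c * t) \<odot> y) - c * t * q y"
        using c x y that by (intro lower_le[OF q]) auto
      also have "of_real c \<odot> x \<oplus> of_real (c * t) \<odot> y = of_real c \<odot> (x \<oplus> of_real t \<odot> y)"
        using x y by (simp add: scale_add_right)
      also have "q \<dots> = c * q (x \<oplus> of_real t \<odot> y)"
        using x y c by (intro sublinearD[OF q]) auto
      finally show ?thesis using c by (simp add: field_simps)
    qed
    then have "lower q y (of_real c \<odot> x) / c \<le> lower q y x"
      by (intro le_lower x) auto
    then show ?thesis using c by (simp add: field_simps)
  qed
  show "lower q y (of_real c \<odot> x) = c * lower q y x"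
  proof (cases "c = 0")
    case True
    have "q (cs_zero X \<oplus> of_real t \<odot> y) - t * q y = 0" if "t \<ge> 0" for t
      using y that by (simp add: sublinearD[OF q])
    then have "lower q y (cs_zero X) = 0" unfolding lower_def by (simp del: add_zero_left)
    then show ?thesis using True x by simp
  next
    case False
    then have "c > 0" using c by simp
    moreover have "lower q y x \<le> (1 / c) * lower q y (of_real c \<odot> x)"
      using *[of "1/c" "of_real c \<odot> x"] \<open>c > 0\<close> x by (simp flip: of_real_mult)
    ultimately show ?thesis using *[of c x] x by (auto simp: field_simps)
  qed
qed

lemma norm_sublinear: "sublinear N"
  by (simp add: sublinear_def norm_add norm_scale)

text \<open>A minimal sublinear functional \<open>u\<close> is linear, since \<open>lower u y\<close> is a sublinear functional
  below it with value at most \<open>- u y\<close> at \<open>- y\<close>.\<close>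

lemma real_linear_norming:
  assumes x0: "x0 \<in> C"
  obtains u where "\<And>x y. x \<in> C \<Longrightarrow> y \<in> C \<Longrightarrow> u (x \<oplus> y) = u x + u y"
    "\<And>t x. x \<in> C \<Longrightarrow> u (of_real t \<odot> x) = t * u x"
    "\<And>x. x \<in> C \<Longrightarrow> u x \<le> N x" "u x0 = N x0"
proof -
  \<comment> \<open>The condition at the negative of \<open>x0\<close> is what forces a linear
    member to attain the norm at \<open>x0\<close>, and it persists for smaller functionals.\<close>
  define A where "A = {q. sublinear q \<and> (\<forall>x. x \<notin> C \<longrightarrow> q x = 0) \<and> (\<forall>x\<in>C. q x \<le> N x) \<and> q ((-1) \<odot> x0) \<le> - N x0}"
  have lowerA: "lower q y \<in> A \<and> lower q y \<le> q"
    if q: "sublinear q" "\<forall>x\<in>C. q x \<le> N x" "\<forall>x. x \<notin> C \<longrightarrow> q x \<ge> 0" and y: "y \<in> C"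
      and x0': "q ((-1) \<odot> x0) \<le> - N x0 \<or> y = x0 \<and> q y = N x0" for q y
  proof -
    have le: "lower q y x \<le> q x" if "x \<in> C" for x
      using lower_le[OF q(1) that y, of 0] that y by simp
    have "lower q y ((-1) \<odot> x0) \<le> - N x0"
      using x0'
    proof
      assume *: "y = x0 \<and> q y = N x0"
      then have "lower q y ((-1) \<odot> x0) \<le> - q y"
        using lower_le[OF q(1) _ y, of "(-1) \<odot> x0" 1] x0 by (simp add: sublinearD[OF q(1)])
      then show ?thesis using conjunct2[OF *] by simp
    qed (use le[of "(-1) \<odot> x0"] x0 in simp)
    moreover have "lower q y x \<le> N x" if "x \<in> C" for x
      using le[OF that] q that by fastforce
    moreover have "lower q y \<le> q"
      using le q(3) by (auto simp: le_fun_def lower_def)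
    ultimately show ?thesis using lower_sublinear[OF q(1) y] by (auto simp: A_def lower_def)
  qed
  \<comment> \<open>Zorn's lemma for the reversed order: the maximal element it provides is a
    minimal sublinear functional.\<close>
  have "\<exists>m\<in>A. \<forall>a\<in>A. a \<le> m \<longrightarrow> a = m"
  proof (rule predicate_Zorn)
    show "partial_order_on A (relation_of (\<lambda>a b. b \<le> a) A)"
      by (rule partial_order_on_relation_ofI) auto
    fix Q assume Q: "Q \<in> Chains (relation_of (\<lambda>a b. b \<le> a) A)"
    have sub: "Q \<subseteq> A" and tot: "\<And>a b. a \<in> Q \<Longrightarrow> b \<in> Q \<Longrightarrow> a \<le> b \<or> b \<le> a"
      using Q by (auto simp: Chains_def relation_of_def)
    show "\<exists>u\<in>A. \<forall>a\<in>Q. u \<le> a"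
    proof (cases "Q = {}")
      case True
      \<comment> \<open>The empty chain needs a member of \<open>A\<close>. The norm itself has the
        wrong value at the negative of \<open>x0\<close>, and one application of
        \<open>lower\<close> in the direction \<open>x0\<close> corrects this.\<close>
      have "lower (\<lambda>x. if x \<in> C then N x else 0) x0 \<in> A"
        using x0 norm_sublinear by (intro lowerA[THEN conjunct1]) (auto simp: sublinear_def)
      then show ?thesis using True by blast
    next
      case False
      define u where "u x = (INF q\<in>Q. q x)" for x
      have bdd: "bdd_below ((\<lambda>q. q x) ` Q)" for x
      proof (cases "x \<in> C")
        case True
        \<comment> \<open>From 0 \<le> q x + q (-x) and q (-x) \<le> N x; this makes the infimum
          over the chain finite.\<close>
        have "- N x \<le> q x" if "q \<in> Q" for q
        proof -
          have q: "sublinear q" "q ((-1) \<odot> x) \<le> N ((-1) \<odot> x)" using that sub True by (auto simp: A_def)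
          have "q (x \<oplus> (-1) \<odot> x) \<le> q x + q ((-1) \<odot> x)" using True by (intro sublinearD[OF q(1)]) auto
          then show ?thesis using q(2) True by (simp add: norm_scale sublinearD[OF q(1)])
        qed
        then show ?thesis by (intro bdd_belowI2)
      next
        case False
        then show ?thesis using sub by (intro bdd_belowI2[where m = 0]) (auto simp: A_def)
      qed
      have ule: "u x \<le> q x" if "q \<in> Q" for q x
        unfolding u_def using bdd that by (rule cINF_lower)
      have leu: "r \<le> u x" if "\<And>q. q \<in> Q \<Longrightarrow> r \<le> q x" for r x
        unfolding u_def using False that by (intro cINF_greatest)
      have "sublinear u"
        unfolding sublinear_def
      proof (intro conjI ballI allI impI)
        fix x y assume xy: "x \<in> C" "y \<in> C"
        have *: "u (x \<oplus> y) \<le> q x + r y" if qr: "q \<in> Q" "r \<in> Q" for q r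
        proof -
          obtain s where s: "s \<in> Q" "s \<le> q" "s \<le> r" using tot[OF qr] qr by auto
          have "u (x \<oplus> y) \<le> s (x \<oplus> y)" using s by (intro ule)
          also have "\<dots> \<le> s x + s y" using s sub xy by (intro sublinearD) (auto simp: A_def)
          also have "\<dots> \<le> q x + r y" using s by (intro add_mono) (auto simp: le_fun_def)
          finally show ?thesis .
        qed
        have "u (x \<oplus> y) - q x \<le> u y" if "q \<in> Q" for q
          by (rule leu) (use *[OF that] in \<open>simp add: diff_le_eq add.commute\<close>)
        then have "u (x \<oplus> y) - u y \<le> u x" by (intro leu) (auto simp: algebra_simps)
        then show "u (x \<oplus> y) \<le> u x + u y" by simp
      next
        fix t :: real and x assume t: "0 \<le> t" and x: "x \<in> C"
        have e: "q (of_real t \<odot> x) = t * q x" if "q \<in> Q" for q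
          using that sub t x by (intro sublinearD) (auto simp: A_def)
        show "u (of_real t \<odot> x) = t * u x"
        proof (cases "t = 0")
          case True
          have "u (of_real t \<odot> x) = (INF q\<in>Q. 0)"
            unfolding u_def by (rule INF_cong) (use e True in auto)
          then show ?thesis using True False by simp
        next
          case t0: False
          have "u (of_real t \<odot> x) / t \<le> u x"
            by (rule leu) (use e ule[of _ "of_real t \<odot> x"] t t0 in \<open>auto simp: field_simps\<close>)
          moreover have "t * u x \<le> u (of_real t \<odot> x)"
            by (rule leu) (simp add: e ule t mult_left_mono)
          ultimately show ?thesis using t t0 by (simp add: field_simps)
        qed
      qed
      moreover obtain q where q: "q \<in> Q" using False by blast
      have "u ((-1) \<odot> x0) \<le> - N x0" using ule[OF q, of "(-1) \<odot> x0"] sub q by (force simp: A_def)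
      moreover have "u x \<le> N x" if "x \<in> C" for x
        using ule[OF q, of x] sub q that by (force simp: A_def)
      moreover have "u x = 0" if "x \<notin> C" for x
        using sub False that unfolding u_def by (subst INF_cong[OF refl, of _ _ "\<lambda>_. 0"]) (auto simp: A_def)
      ultimately have "u \<in> A" by (simp add: A_def)
      then show ?thesis using ule by (auto simp: le_fun_def)
    qed
  qed
  then obtain u where u: "u \<in> A" and min: "\<And>a. a \<in> A \<Longrightarrow> a \<le> u \<Longrightarrow> a = u" by blast
  have su: "sublinear u" and le: "\<And>x. x \<in> C \<Longrightarrow> u x \<le> N x" and ux0: "u ((-1) \<odot> x0) \<le> - N x0"
    using u by (auto simp: A_def)
  have neg: "u ((-1) \<odot> y) = - u y" if y: "y \<in> C" for y
  proof -
    have "lower u y = u"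
      using lowerA[of u y] u y by (intro min) (auto simp: A_def)
    then have "u ((-1) \<odot> y) \<le> - u y"
      using lower_le[OF su _ y, of "(-1) \<odot> y" 1] y by (simp add: sublinearD[OF su])
    moreover have "u (y \<oplus> (-1) \<odot> y) \<le> u y + u ((-1) \<odot> y)" using y by (intro sublinearD[OF su]) auto
    ultimately show ?thesis using y by (simp add: sublinearD[OF su])
  qed
  show ?thesis
  proof (rule that[of u])
    fix x y assume xy: "x \<in> C" "y \<in> C"
    have "u ((-1) \<odot> (x \<oplus> y)) \<le> u ((-1) \<odot> x) + u ((-1) \<odot> y)"
      using xy by (simp add: scale_add_right sublinearD[OF su])
    then have "- u (x \<oplus> y) \<le> - u x + - u y" using xy by (simp only: neg add_in)
    moreover have "u (x \<oplus> y) \<le> u x + u y" using xy by (simp add: sublinearD[OF su])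
    ultimately show "u (x \<oplus> y) = u x + u y" by simp
  next
    fix t x assume x: "x \<in> C"
    show "u (of_real t \<odot> x) = t * u x"
    proof (cases "t \<ge> 0")
      case False
      have "u ((-1) \<odot> (of_real (-t) \<odot> x)) = - u (of_real (-t) \<odot> x)" using x by (intro neg) auto
      then show ?thesis using False x by (simp add: sublinearD[OF su] del: of_real_minus) simp
    qed (use x in \<open>simp add: sublinearD[OF su]\<close>)
  next
    show "u x0 = N x0" using ux0 neg[OF x0] le[OF x0] by simp
  qed (rule le)
qed

theorem hahn_banach:
  assumes x0: "x0 \<in> C"
  obtains \<phi> where "\<phi> \<in> dual_ball X" "cmod (\<phi> x0) = N x0"
proof -
  obtain u where add: "\<And>x y. x \<in> C \<Longrightarrow> y \<in> C \<Longrightarrow> u (x \<oplus> y) = u x + u y"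
    and sc: "\<And>t x. x \<in> C \<Longrightarrow> u (of_real t \<odot> x) = t * u x"
    and le: "\<And>x. x \<in> C \<Longrightarrow> u x \<le> N x" and x0': "u x0 = N x0"
    using real_linear_norming[OF x0] by blast
  \<comment> \<open>The complex linear functional with real part \<open>u\<close>.\<close>
  define \<phi> where "\<phi> x = Complex (u x) (- u (\<i> \<odot> x))" for x
  have u_scale: "u (c \<odot> x) = Re c * u x + Im c * u (\<i> \<odot> x)" if "x \<in> C" for c x
  proof -
    have "c \<odot> x = of_real (Re c) \<odot> x \<oplus> of_real (Im c) \<odot> (\<i> \<odot> x)"
      using that complex_eq[of c] by (simp add: mult.commute flip: scale_add_left)
    then show ?thesis using that by (simp only: add sc scale_in)
  qed
  have p_scale: "\<phi> (c \<odot> x) = c * \<phi> x" if "x \<in> C" for c x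
    using that u_scale[of x c] u_scale[of x "\<i> * c"] by (simp add: \<phi>_def complex_eq_iff)
  have p_add: "\<phi> (x \<oplus> y) = \<phi> x + \<phi> y" if "x \<in> C" "y \<in> C" for x y
    using that by (simp add: \<phi>_def complex_eq_iff add scale_add_right)
  have p_le: "cmod (\<phi> x) \<le> N x" if x: "x \<in> C" for x
  proof (cases "\<phi> x = 0")
    case False
    \<comment> \<open>Rotating \<open>x\<close> by a unimodular scalar makes the value of \<phi>
      real and nonnegative, where it is a value of \<open>u\<close>.\<close>
    define c where "c = cnj (sgn (\<phi> x))"
    have "cmod c = 1" using False by (simp add: c_def norm_sgn)
    have "c * \<phi> x = of_real (cmod (\<phi> x))"
      using False complex_norm_square[of "\<phi> x"]
      by (simp add: c_def sgn_eq power2_eq_square field_simps)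
    then have "cmod (\<phi> x) = Re (\<phi> (c \<odot> x))" using x by (simp add: p_scale)
    also have "\<dots> = u (c \<odot> x)" by (simp add: \<phi>_def)
    also have "\<dots> \<le> N x" using le[of "c \<odot> x"] x \<open>cmod c = 1\<close> by (simp add: norm_scale)
    finally show ?thesis .
  qed (use x in simp)
  have "\<phi> \<in> dual_ball X"
    unfolding dual_ball_def bounded_operator_def
    using p_add p_scale p_le order_trans[OF p_le] by (auto simp: type_space_def scaleC_complex_def cs_ball_def
        intro!: exI[of _ 1])
  moreover have "N x0 \<le> cmod (\<phi> x0)"
    using complex_Re_le_cmod[of "\<phi> x0"] by (simp add: x0' \<phi>_def)
  ultimately show ?thesis using that[of \<phi>] p_le[OF x0] by simp
qed

lemma norm_le_dual:
  assumes "x \<in> C" "\<And>\<phi>. \<phi> \<in> dual_ball X \<Longrightarrow> cmod (\<phi> x) \<le> K"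
  shows "N x \<le> K"
  using hahn_banach[OF assms(1)] assms(2) by metis

lemma zero_dual_ball: "(\<lambda>_. 0) \<in> dual_ball X"
  by (auto simp: dual_ball_def bounded_operator_def type_space_def scaleC_complex_def intro!: exI[of _ 0])

end

lemma scaleC_one [simp]: "1 *\<^sub>C x = x" and scaleC_zero [simp]: "0 *\<^sub>C x = 0"
  using scaleC_of_real[of 1 x] scaleC_of_real[of 0 x] by simp_all

lemma type_space_simps [simp]:
  "cs_carrier type_space = UNIV" "cs_zero type_space = 0" "cs_add type_space = (+)"
  "cs_scale type_space = (*\<^sub>C)" "cs_norm type_space = norm"
  by (simp_all add: type_space_def)

lemma cnormed_type_space: "cnormed (type_space :: 'a::complex_banach cspace)"
  by unfold_locales
    (auto simp: scaleC_add_right scaleC_add_left scaleC_scaleC norm_scaleC norm_triangle_ineq)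

lemma cnormed_conj_seq_space: "1 \<le> p \<Longrightarrow> cnormed (conj_seq_space p)"
  by unfold_locales (auto simp: conj_zero conj_add conj_scale algebra_simps)

section \<open>Quotients\<close>

locale cquotient = cnormed X for X :: "'a cspace" +
  fixes M :: "'a set"
  assumes M: "closed_subspace X M"
begin

definition coset :: "'a \<Rightarrow> 'a set"
  where "coset x = {x \<oplus> m | m. m \<in> M}"

abbreviation "Q \<equiv> quotient_cspace X M"

lemma M_in: "m \<in> M \<Longrightarrow> m \<in> C" and M_zero: "cs_zero X \<in> M"
  and M_add: "m \<in> M \<Longrightarrow> n \<in> M \<Longrightarrow> m \<oplus> n \<in> M" and M_scale: "m \<in> M \<Longrightarrow> c \<odot> m \<in> M"
  using M by (auto simp: closed_subspace_def)

lemma Q_carrier: "cs_carrier Q = coset ` C"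
  by (auto simp: quotient_cspace_def coset_def)

lemma Q_zero: "cs_zero Q = coset (cs_zero X)"
  using M_in by (force simp: quotient_cspace_def coset_def)

lemma mem_coset_iff: "x \<in> C \<Longrightarrow> y \<in> coset x \<longleftrightarrow> y \<in> C \<and> y \<oplus> (-1) \<odot> x \<in> M"
proof
  assume x: "x \<in> C" and "y \<in> coset x"
  then obtain m where m: "m \<in> M" "y = x \<oplus> m" by (auto simp: coset_def)
  then show "y \<in> C \<and> y \<oplus> (-1) \<odot> x \<in> M" using x M_in
    by (simp add: add_comm[of "x \<oplus> m"])
next
  assume x: "x \<in> C" and y: "y \<in> C \<and> y \<oplus> (-1) \<odot> x \<in> M"
  then have "y = x \<oplus> (y \<oplus> (-1) \<odot> x)" by (simp add: add_comm[of y])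
  then show "y \<in> coset x" using y by (auto simp: coset_def)
qed

lemma coset_in: "x \<in> C \<Longrightarrow> y \<in> coset x \<Longrightarrow> y \<in> C"
  by (simp add: mem_coset_iff)

lemma self_coset: "x \<in> C \<Longrightarrow> x \<in> coset x"
  by (simp add: mem_coset_iff M_zero)

lemma Q_add:
  assumes "x \<in> C" "y \<in> C"
  shows "cs_add Q (coset x) (coset y) = coset (x \<oplus> y)"
proof -
  have "{a \<oplus> b | a b. a \<in> coset x \<and> b \<in> coset y} = coset (x \<oplus> y)"
  proof (intro set_eqI iffI)
    fix z assume "z \<in> {a \<oplus> b | a b. a \<in> coset x \<and> b \<in> coset y}"
    then obtain m n where mn: "m \<in> M" "n \<in> M" "z = (x \<oplus> m) \<oplus> (y \<oplus> n)" by (auto simp: coset_def)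
    then have "z = (x \<oplus> y) \<oplus> (m \<oplus> n)" using assms M_in by (simp add: add_ac')
    then show "z \<in> coset (x \<oplus> y)" using mn M_add by (auto simp: coset_def)
  next
    fix z assume "z \<in> coset (x \<oplus> y)"
    then obtain m where m: "m \<in> M" "z = (x \<oplus> y) \<oplus> m" by (auto simp: coset_def)
    then have "z = x \<oplus> (y \<oplus> m)" using assms M_in by (simp add: add_assoc)
    then show "z \<in> {a \<oplus> b | a b. a \<in> coset x \<and> b \<in> coset y}"
      using self_coset[OF assms(1)] m by (auto simp: coset_def)
  qed
  then show ?thesis by (simp add: quotient_cspace_def)
qed

lemma Q_scale:
  assumes "x \<in> C"
  shows "cs_scale Q c (coset x) = coset (c \<odot> x)"
proof -
  have "{c \<odot> a \<oplus> m | a m. a \<in> coset x \<and> m \<in> M} = coset (c \<odot> x)"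
  proof (intro set_eqI iffI)
    fix z assume "z \<in> {c \<odot> a \<oplus> m | a m. a \<in> coset x \<and> m \<in> M}"
    then obtain m n where mn: "m \<in> M" "n \<in> M" "z = c \<odot> (x \<oplus> n) \<oplus> m" by (auto simp: coset_def)
    then have "z = c \<odot> x \<oplus> (c \<odot> n \<oplus> m)" using assms M_in by (simp add: scale_add_right add_assoc)
    then show "z \<in> coset (c \<odot> x)" using mn M_add M_scale by (auto simp: coset_def)
  next
    fix z assume "z \<in> coset (c \<odot> x)"
    then show "z \<in> {c \<odot> a \<oplus> m | a m. a \<in> coset x \<and> m \<in> M}"
      using self_coset[OF assms(1)] by (auto simp: coset_def)
  qed
  then show ?thesis by (simp add: quotient_cspace_def)
qed

lemma Q_norm: "cs_norm Q A = (INF a\<in>A. N a)"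
  by (simp add: quotient_cspace_def)

lemma Q_norm_le: "x \<in> C \<Longrightarrow> a \<in> coset x \<Longrightarrow> cs_norm Q (coset x) \<le> N a"
  unfolding Q_norm by (rule cINF_lower) (auto intro!: bdd_belowI2[where m = 0] simp: coset_in)

lemma le_Q_norm: "x \<in> C \<Longrightarrow> (\<And>a. a \<in> coset x \<Longrightarrow> r \<le> N a) \<Longrightarrow> r \<le> cs_norm Q (coset x)"
  unfolding Q_norm using self_coset[of x] by (intro cINF_greatest) auto

text \<open>The inequality is strict because the infimum over a coset need not be attained; the
  factor 1 + \<epsilon> in \<open>quotient_op_ideal\<close> stems from this.\<close>

lemma Q_norm_approx:
  assumes "x \<in> C" "cs_norm Q (coset x) < r"
  obtains a where "a \<in> coset x" "a \<in> C" "N a < r"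
  using le_Q_norm[of x r] assms coset_in by (meson not_le)

lemma cnormed_quotient: "cnormed Q"
proof
  fix A B D and b c assume A: "A \<in> cs_carrier Q"
  then obtain x where x: "A = coset x" "x \<in> C" by (auto simp: Q_carrier)
  show "cs_add Q A (cs_zero Q) = A" using x by (simp add: Q_zero Q_add)
  show "cs_scale Q c A \<in> cs_carrier Q" using x by (simp add: Q_carrier Q_scale)
  show "cs_scale Q (b + c) A = cs_add Q (cs_scale Q b A) (cs_scale Q c A)"
    using x by (simp add: Q_scale Q_add scale_add_left)
  show "cs_scale Q b (cs_scale Q c A) = cs_scale Q (b * c) A" using x by (simp add: Q_scale)
  show "cs_scale Q 1 A = A" "cs_scale Q 0 A = cs_zero Q" using x by (simp_all add: Q_scale Q_zero)
  \<comment> \<open>Applied to \<open>c\<close> and to its inverse this gives equality. The scalar 0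
    is treated apart, since it sends every coset to \<open>M\<close>.\<close>
  have *: "cs_norm Q (coset (c \<odot> y)) \<le> cmod c * cs_norm Q (coset y)" if y: "y \<in> C" and c: "c \<noteq> 0" for c y
  proof -
    have "cs_norm Q (coset (c \<odot> y)) / cmod c \<le> cs_norm Q (coset y)"
    proof (rule le_Q_norm[OF y])
      fix a assume a: "a \<in> coset y"
      then have "c \<odot> a \<in> coset (c \<odot> y)"
        using y M_scale M_in by (auto simp: coset_def scale_add_right)
      then have "cs_norm Q (coset (c \<odot> y)) \<le> N (c \<odot> a)" using y by (intro Q_norm_le) auto
      then show "cs_norm Q (coset (c \<odot> y)) / cmod c \<le> N a"
        using coset_in[OF y a] c by (simp add: norm_scale field_simps)
    qed
    then show ?thesis using c by (simp add: field_simps)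
  qed
  have nn: "0 \<le> cs_norm Q (coset y)" if "y \<in> C" for y
    using that by (intro le_Q_norm) (auto dest: coset_in)
  show "cs_norm Q (cs_scale Q c A) = cmod c * cs_norm Q A"
  proof (cases "c = 0")
    case True
    have "cs_norm Q (coset (cs_zero X)) \<le> N (cs_zero X)"
      by (intro Q_norm_le self_coset) auto
    then show ?thesis using True x nn[of "cs_zero X"] by (simp add: Q_scale)
  next
    case False
    have "cs_norm Q (coset (inverse c \<odot> (c \<odot> x))) \<le> cmod (inverse c) * cs_norm Q (coset (c \<odot> x))"
      using x False by (intro *) auto
    then have "cmod c * cs_norm Q (coset x) \<le> cs_norm Q (coset (c \<odot> x))"
      using x False by (simp add: norm_divide field_simps)
    then show ?thesis using *[of x c] False x by (simp add: Q_scale)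
  qed
  assume "B \<in> cs_carrier Q"
  then obtain y where y: "B = coset y" "y \<in> C" by (auto simp: Q_carrier)
  show "cs_add Q A B \<in> cs_carrier Q" using x y by (simp add: Q_carrier Q_add)
  show "cs_add Q A B = cs_add Q B A" using x y by (simp add: Q_add add_comm)
  show "cs_scale Q c (cs_add Q A B) = cs_add Q (cs_scale Q c A) (cs_scale Q c B)"
    using x y by (simp add: Q_add Q_scale scale_add_right)
  have **: "cs_norm Q (coset (x \<oplus> y)) \<le> N a + N b" if "a \<in> coset x" "b \<in> coset y" for a b
  proof -
    have "a \<oplus> b \<in> cs_add Q (coset x) (coset y)" using that by (auto simp: quotient_cspace_def)
    then have "cs_norm Q (coset (x \<oplus> y)) \<le> N (a \<oplus> b)"
      using x y by (intro Q_norm_le) (auto simp: Q_add)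
    then show ?thesis using norm_add[of a b] coset_in[OF x(2) that(1)] coset_in[OF y(2) that(2)] by simp
  qed
  have "cs_norm Q (coset (x \<oplus> y)) - N a \<le> cs_norm Q (coset y)" if "a \<in> coset x" for a
    using **[OF that] y by (intro le_Q_norm) (auto simp: algebra_simps)
  then have "cs_norm Q (coset (x \<oplus> y)) - cs_norm Q (coset y) \<le> cs_norm Q (coset x)"
    using x by (intro le_Q_norm) (auto simp: algebra_simps)
  then show "cs_norm Q (cs_add Q A B) \<le> cs_norm Q A + cs_norm Q B"
    using x y by (simp add: Q_add)
  assume "D \<in> cs_carrier Q"
  then obtain z where z: "D = coset z" "z \<in> C" by (auto simp: Q_carrier)
  show "cs_add Q (cs_add Q A B) D = cs_add Q A (cs_add Q B D)"
    using x y z by (simp add: Q_add add_assoc)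
next
  show "cs_zero Q \<in> cs_carrier Q" by (simp add: Q_zero Q_carrier)
qed

end

section \<open>Weakly summable sequences\<close>

context cnormed
begin

lemma dual_ballD:
  assumes "\<phi> \<in> dual_ball X"
  shows "x \<in> C \<Longrightarrow> y \<in> C \<Longrightarrow> \<phi> (x \<oplus> y) = \<phi> x + \<phi> y" "x \<in> C \<Longrightarrow> \<phi> (c \<odot> x) = c * \<phi> x"
    "\<phi> (cs_zero X) = 0"
proof -
  show s: "x \<in> C \<Longrightarrow> \<phi> (c \<odot> x) = c * \<phi> x" for x c
    using assms by (simp add: dual_ball_def bounded_operator_def scaleC_complex_def)
  show "\<phi> (cs_zero X) = 0" using s[of "cs_zero X" 0] by simp
qed (use assms in \<open>simp add: dual_ball_def bounded_operator_def\<close>)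

lemma psum_in: "(\<And>n. x n \<in> C) \<Longrightarrow> cs_psum X x k \<in> C"
  by (induction k) auto

lemma dual_psum:
  assumes "\<phi> \<in> dual_ball X" "\<And>n. x n \<in> C"
  shows "\<phi> (cs_psum X x k) = (\<Sum>n<k. \<phi> (x n))"
  by (induction k) (simp_all add: dual_ballD[OF assms(1)] psum_in assms(2))

text \<open>A uniform bound on finite sums gives summability, finiteness of the supremum and the
  norm bound together, so later estimates can stay with finite sums.\<close>

lemma weak_seqsI:
  assumes p: "0 < p" and x: "\<And>n. x n \<in> C" and K: "0 \<le> K"
    and le: "\<And>\<phi> k. \<phi> \<in> dual_ball X \<Longrightarrow> (\<Sum>n<k. cmod (\<phi> (x n)) powr p) \<le> K powr p"
  shows "x \<in> weak_seqs p X" "weak_norm p X x \<le> K"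
proof -
  have s: "summable (\<lambda>n. cmod (\<phi> (x n)) powr p)" if "\<phi> \<in> dual_ball X" for \<phi>
    using le[OF that] by (intro summableI_nonneg_bounded) auto
  have b: "(\<Sum>n. cmod (\<phi> (x n)) powr p) powr (1/p) \<le> K" if "\<phi> \<in> dual_ball X" for \<phi>
  proof -
    have "(\<Sum>n. cmod (\<phi> (x n)) powr p) powr (1/p) \<le> (K powr p) powr (1/p)"
      using p le[OF that] by (intro powr_mono2 suminf_le_const s that suminf_nonneg) auto
    then show ?thesis using p K by (simp add: powr_powr)
  qed
  show "x \<in> weak_seqs p X" using x s b by (auto simp: weak_seqs_def intro!: bdd_aboveI2)
  show "weak_norm p X x \<le> K" unfolding weak_norm_def using b zero_dual_ball by (intro cSUP_least) auto
qed

lemma weak_seqsD: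
  assumes p: "0 < p" and x: "x \<in> weak_seqs p X"
  shows "x n \<in> C" "0 \<le> weak_norm p X x"
    "\<phi> \<in> dual_ball X \<Longrightarrow> (\<Sum>n<k. cmod (\<phi> (x n)) powr p) \<le> weak_norm p X x powr p"
    "\<phi> \<in> dual_ball X \<Longrightarrow> (\<Sum>n<k. cmod (\<phi> (x n)) powr p) powr (1/p) \<le> weak_norm p X x"
proof -
  show "x n \<in> C" using x by (simp add: weak_seqs_def)
  have le: "(\<Sum>n. cmod (\<phi> (x n)) powr p) powr (1/p) \<le> weak_norm p X x" if "\<phi> \<in> dual_ball X" for \<phi>
    unfolding weak_norm_def using x that by (intro cSUP_upper) (auto simp: weak_seqs_def)
  show nn: "0 \<le> weak_norm p X x"
    using order_trans[OF powr_ge_zero le[OF zero_dual_ball]] .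
  assume \<phi>: "\<phi> \<in> dual_ball X"
  have s: "summable (\<lambda>n. cmod (\<phi> (x n)) powr p)" using x \<phi> by (simp add: weak_seqs_def)
  have "(\<Sum>n<k. cmod (\<phi> (x n)) powr p) powr (1/p) \<le> (\<Sum>n. cmod (\<phi> (x n)) powr p) powr (1/p)"
    using p s by (intro powr_mono2 sum_le_suminf sum_nonneg) auto
  then show 1: "(\<Sum>n<k. cmod (\<phi> (x n)) powr p) powr (1/p) \<le> weak_norm p X x" using le[OF \<phi>] by simp
  then have "((\<Sum>n<k. cmod (\<phi> (x n)) powr p) powr (1/p)) powr p \<le> weak_norm p X x powr p"
    using p by (intro powr_mono2) auto
  then show "(\<Sum>n<k. cmod (\<phi> (x n)) powr p) \<le> weak_norm p X x powr p"
    using p by (simp add: powr_powr sum_nonneg)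
qed

lemma weak_tail:
  assumes p: "0 < p" and x: "x \<in> weak_seqs p X"
  shows "(\<lambda>n. x (m + n)) \<in> weak_seqs p X"
proof (rule weak_seqsI(1)[OF p _ weak_seqsD(2)[OF p x]])
  fix \<phi> k assume \<phi>: "\<phi> \<in> dual_ball X"
  have "(\<Sum>n<k. cmod (\<phi> (x (m + n))) powr p) = (\<Sum>n\<in>(+) m ` {..<k}. cmod (\<phi> (x n)) powr p)"
    by (simp add: sum.reindex)
  also have "\<dots> \<le> (\<Sum>n<m+k. cmod (\<phi> (x n)) powr p)" by (intro sum_mono2) auto
  also have "\<dots> \<le> weak_norm p X x powr p" by (rule weak_seqsD(3)[OF p x \<phi>])
  finally show "(\<Sum>n<k. cmod (\<phi> (x (m + n))) powr p) \<le> weak_norm p X x powr p" .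
qed (rule weak_seqsD[OF p x])

lemma weak_scale:
  assumes p: "0 < p" and x: "x \<in> weak_seqs p X" and c: "0 \<le> c"
  shows "(\<lambda>n. of_real c \<odot> x n) \<in> weak_seqs p X"
    "weak_norm p X (\<lambda>n. of_real c \<odot> x n) \<le> c * weak_norm p X x"
proof -
  have le: "(\<Sum>n<k. cmod (\<phi> (of_real c \<odot> x n)) powr p) \<le> (c * weak_norm p X x) powr p"
    if "\<phi> \<in> dual_ball X" for \<phi> k
    using weak_seqsD[OF p x] that c
    by (simp add: dual_ballD[OF that] norm_mult powr_mult mult_left_mono flip: sum_distrib_left)
  show "(\<lambda>n. of_real c \<odot> x n) \<in> weak_seqs p X"
    "weak_norm p X (\<lambda>n. of_real c \<odot> x n) \<le> c * weak_norm p X x"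
    using weak_seqsI[of p "\<lambda>n. of_real c \<odot> x n" "c * weak_norm p X x"] p le weak_seqsD(1,2)[OF p x] c by auto
qed

lemma strong_imp_weak:
  assumes p: "0 < p" and x: "x \<in> strong_seqs p X"
  shows "x \<in> weak_seqs p X" "weak_norm p X x \<le> strong_norm p X x"
proof -
  have xC: "x n \<in> C" and s: "summable (\<lambda>n. N (x n) powr p)" for n
    using x by (auto simp: strong_seqs_def)
  have le: "(\<Sum>n<k. cmod (\<phi> (x n)) powr p) \<le> strong_norm p X x powr p" if "\<phi> \<in> dual_ball X" for \<phi> k
  proof -
    have "(\<Sum>n<k. cmod (\<phi> (x n)) powr p) \<le> (\<Sum>n<k. N (x n) powr p)"
      using p dual_ball_le_norm[OF that] xC by (intro sum_mono powr_mono2) auto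
    also have "\<dots> \<le> (\<Sum>n. N (x n) powr p)" using s by (intro sum_le_suminf) auto
    also have "\<dots> = strong_norm p X x powr p"
      using p by (simp add: strong_norm_def powr_powr suminf_nonneg[OF s])
    finally show ?thesis .
  qed
  show "x \<in> weak_seqs p X" "weak_norm p X x \<le> strong_norm p X x"
    using weak_seqsI[of p x "strong_norm p X x"] p xC le by (auto simp: strong_norm_def)
qed

lemma gen_imp_weak:
  assumes "0 < p" "x \<in> gen_seqs I p X"
  shows "x \<in> weak_seqs p X" "weak_norm p X x \<le> gen_norm I p X x"
  using assms strong_imp_weak by (cases I; simp add: uncond_seqs_def)+

lemma gen_norm_nonneg: "0 < p \<Longrightarrow> x \<in> gen_seqs I p X \<Longrightarrow> 0 \<le> gen_norm I p X x"
  using gen_imp_weak weak_seqsD(2) order_trans by blast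

lemma gen_scale:
  assumes p: "0 < p" and x: "x \<in> gen_seqs I p X" and c: "0 \<le> c"
  shows "(\<lambda>n. of_real c \<odot> x n) \<in> gen_seqs I p X"
    "gen_norm I p X (\<lambda>n. of_real c \<odot> x n) \<le> c * gen_norm I p X x"
proof -
  have "(\<lambda>n. of_real c \<odot> x n) \<in> gen_seqs I p X \<and>
    gen_norm I p X (\<lambda>n. of_real c \<odot> x n) \<le> c * gen_norm I p X x"
  proof (cases I)
    case Kp
    with x have xC: "x n \<in> C" and s: "summable (\<lambda>n. N (x n) powr p)" for n
      by (auto simp: strong_seqs_def)
    then show ?thesis using Kp c p
      by (simp add: strong_seqs_def strong_norm_def norm_scale powr_mult summable_mult suminf_mult
          powr_powr suminf_nonneg)
  next
    case Kwp
    with x show ?thesis using weak_scale[OF p _ c] by simp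
  next
    case Kup
    with x have xw: "x \<in> weak_seqs p X" and t: "(\<lambda>m. weak_norm p X (\<lambda>n. x (m + n))) \<longlonglongrightarrow> 0"
      by (auto simp: uncond_seqs_def)
    have "(\<lambda>m. weak_norm p X (\<lambda>n. of_real c \<odot> x (m + n))) \<longlonglongrightarrow> 0"
    proof (rule tendsto_sandwich[OF always_eventually always_eventually tendsto_const])
      show "(\<lambda>m. c * weak_norm p X (\<lambda>n. x (m + n))) \<longlonglongrightarrow> 0" using tendsto_mult_right_zero[OF t] .
    qed (use weak_scale[OF p weak_tail[OF p xw] c] weak_seqsD(2)[OF p] in auto)
    then show ?thesis using Kup weak_scale[OF p xw c] by (simp add: uncond_seqs_def)
  qed
  then show "(\<lambda>n. of_real c \<odot> x n) \<in> gen_seqs I p X"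
    "gen_norm I p X (\<lambda>n. of_real c \<odot> x n) \<le> c * gen_norm I p X x" by auto
qed

text \<open>Tested against a functional, the partial sum becomes a scalar sum to which Hoelder's
  inequality applies. Both the size of \<open>p\<close>-convex hulls and the boundedness of the
  synthesis operator rest on this.\<close>

lemma psum_weak_bound:
  assumes p: "1 \<le> p" and x: "x \<in> weak_seqs p X" and a: "a \<in> cs_carrier (conj_seq_space p)"
  shows "N (cs_psum X (\<lambda>n. a n \<odot> x n) k) \<le> cs_norm (conj_seq_space p) a * weak_norm p X x"
proof (rule norm_le_dual)
  have p0: "0 < p" using p by simp
  note xC = weak_seqsD(1)[OF p0 x]
  show "cs_psum X (\<lambda>n. a n \<odot> x n) k \<in> C" using xC by (intro psum_in) auto
  fix \<phi> assume \<phi>: "\<phi> \<in> dual_ball X"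
  have "\<phi> (cs_psum X (\<lambda>n. a n \<odot> x n) k) = (\<Sum>n<k. a n * \<phi> (x n))"
    using xC by (simp add: dual_psum[OF \<phi>] dual_ballD[OF \<phi>])
  also have "cmod \<dots> \<le> cs_norm (conj_seq_space p) a * (\<Sum>n<k. cmod (\<phi> (x n)) powr p) powr (1/p)"
    by (rule conj_Holder[OF p a])
  also have "\<dots> \<le> cs_norm (conj_seq_space p) a * weak_norm p X x"
    using weak_seqsD(4)[OF p0 x \<phi>] conj_norm_nonneg[OF p a] by (intro mult_left_mono) auto
  finally show "cmod (\<phi> (cs_psum X (\<lambda>n. a n \<odot> x n) k)) \<le> cs_norm (conj_seq_space p) a * weak_norm p X x" .
qed

lemma sums_norm_le:
  assumes "cs_sums X y s" "\<And>n. y n \<in> C" "\<And>k. N (cs_psum X y k) \<le> K"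
  shows "N s \<le> K"
proof (rule tendsto_lowerbound)
  have s: "s \<in> C" using assms(1) by (simp add: cs_sums_def)
  show "(\<lambda>k. N (cs_diff X (cs_psum X y k) s) + K) \<longlonglongrightarrow> K"
    using tendsto_add[OF _ tendsto_const[of K], of "\<lambda>k. N (cs_diff X (cs_psum X y k) s)" 0 sequentially] assms(1)
    by (simp add: cs_sums_def)
  have "N s \<le> N (cs_diff X (cs_psum X y k) s) + K" for k
  proof -
    let ?z = "cs_psum X y k"
    have z: "?z \<in> C" using assms(2) by (intro psum_in)
    have "s = (-1) \<odot> cs_diff X ?z s \<oplus> ?z"
      using s z by (simp add: cs_diff_def scale_add_right add_ac')
    then have "N s \<le> N ((-1) \<odot> cs_diff X ?z s) + N ?z"
      using norm_add[of "(-1) \<odot> cs_diff X ?z s" ?z] s z by simp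
    then show ?thesis using assms(3)[of k] s z by (simp add: norm_scale)
  qed
  then show "\<forall>\<^sub>F k in sequentially. N s \<le> N (cs_diff X (cs_psum X y k) s) + K" by simp
qed simp

lemma p_conv_norm_le:
  assumes p: "1 \<le> p" and x: "x \<in> weak_seqs p X" and s: "s \<in> p_conv p X x"
  shows "s \<in> C" "N s \<le> weak_norm p X x"
proof -
  have p0: "0 < p" using p by simp
  obtain a where a: "a \<in> cs_carrier (conj_seq_space p)" "cs_norm (conj_seq_space p) a \<le> 1"
    "cs_sums X (\<lambda>n. a n \<odot> x n) s"
    using s by (auto simp: p_conv_def cs_ball_def)
  show "s \<in> C" using a(3) by (simp add: cs_sums_def)
  show "N s \<le> weak_norm p X x"
  proof (rule sums_norm_le[OF a(3)])
    fix k
    show "N (cs_psum X (\<lambda>n. a n \<odot> x n) k) \<le> weak_norm p X x"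
      using psum_weak_bound[OF p x a(1), of k] mult_right_mono[OF a(2) weak_seqsD(2)[OF p0 x]] by simp
  qed (use weak_seqsD(1)[OF p0 x] in auto)
qed

end

section \<open>Splitting a null sequence of scalars off an unconditionally summable sequence\<close>

text \<open>The weights depend only on the common bound \<open>T\<close> for the tails and not on
  \<open>c\<close>; this uniformity is needed to treat the whole dual ball at once. They jump by 1
  at indices \<open>m k\<close> so late that the corresponding tails add up to at most
  \<delta>.\<close>

lemma slow_weights:
  fixes T :: "nat \<Rightarrow> real"
  assumes T: "T \<longlonglongrightarrow> 0" and "0 < \<delta>"
  obtains \<nu> :: "nat \<Rightarrow> real" where "\<And>n. 1 \<le> \<nu> n" "mono \<nu>" "filterlim \<nu> at_top sequentially"
    "\<And>c k. (\<And>n. 0 \<le> c n) \<Longrightarrow> (\<And>m k. (\<Sum>n\<in>{m..<k}. c n) \<le> T m) \<Longrightarrow> (\<Sum>n<k. c n * \<nu> n) \<le> T 0 + \<delta>"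
proof -
  \<comment> \<open>Requiring \<open>k \<le> m k\<close> makes each count in \<nu> finite and
    ensures that for \<open>n < k\<close> only indices \<open>j < k\<close> contribute.\<close>
  have "\<exists>m\<ge>k. T m \<le> \<delta> * (1/2) ^ Suc k" for k
  proof -
    have "eventually (\<lambda>m. T m < \<delta> * (1/2) ^ Suc k) sequentially"
      using T \<open>0 < \<delta>\<close> by (intro order_tendstoD) auto
    then obtain M where "\<And>m. m \<ge> M \<Longrightarrow> T m < \<delta> * (1/2) ^ Suc k" by (auto simp: eventually_sequentially)
    then show ?thesis by (intro exI[of _ "max k M"]) (auto intro: less_imp_le)
  qed
  then obtain m where m: "\<And>k. k \<le> m k" "\<And>k. T (m k) \<le> \<delta> * (1/2) ^ Suc k" by metis
  have fin: "finite {k. m k \<le> n}" for n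
    by (rule finite_subset[of _ "{..n}"]) (use m(1) order_trans in auto)
  define \<nu> where "\<nu> n = 1 + real (card {k. m k \<le> n})" for n
  show ?thesis
  proof (rule that[of \<nu>])
    show "1 \<le> \<nu> n" for n by (simp add: \<nu>_def)
    show "mono \<nu>" by (auto intro!: monoI card_mono fin simp: \<nu>_def)
    show "filterlim \<nu> at_top sequentially"
      unfolding filterlim_at_top
    proof
      fix Z :: real
      obtain K :: nat where K: "Z \<le> real K" using real_arch_simple by blast
      show "\<forall>\<^sub>F n in sequentially. Z \<le> \<nu> n"
      proof (rule eventually_sequentiallyI[of "\<Sum>k<K. m k"])
        fix n assume n: "(\<Sum>k<K. m k) \<le> n"
        have "m k \<le> n" if "k < K" for k
          using that n member_le_sum[of k "{..<K}" m] by simp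
        then have "card {..<K} \<le> card {k. m k \<le> n}" by (intro card_mono fin) auto
        then show "Z \<le> \<nu> n" using K by (simp add: \<nu>_def)
      qed
    qed
    fix c :: "nat \<Rightarrow> real" and k assume c: "\<And>n. 0 \<le> c n" and le: "\<And>m k. (\<Sum>n\<in>{m..<k}. c n) \<le> T m"
    have card: "real (card {j. m j \<le> n}) = (\<Sum>j<k. if m j \<le> n then 1 else 0)" if "n < k" for n
    proof -
      have "{j. m j \<le> n} = {j \<in> {..<k}. m j \<le> n}" using m(1) that by (auto intro: le_less_trans order_trans)
      then show ?thesis by (simp add: sum.If_cases Int_def)
    qed
    have "(\<Sum>n<k. c n * \<nu> n) = (\<Sum>n<k. c n + (\<Sum>j<k. if m j \<le> n then c n else 0))"
      by (intro sum.cong refl) (auto simp: \<nu>_def card distrib_left sum_distrib_left intro!: sum.cong)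
    \<comment> \<open>After interchanging the sums, each jump at \<open>m j\<close> contributes the
      tail of \<open>c\<close> from \<open>m j\<close> on.\<close>
    also have "\<dots> = (\<Sum>n<k. c n) + (\<Sum>j<k. \<Sum>n<k. if m j \<le> n then c n else 0)"
      by (simp add: sum.distrib) (rule sum.swap)
    also have "\<dots> = (\<Sum>n\<in>{0..<k}. c n) + (\<Sum>j<k. \<Sum>n\<in>{m j..<k}. c n)"
      by (intro arg_cong2[where f = "(+)"] sum.cong refl sum.mono_neutral_cong_right)
        (auto simp: atLeast0LessThan)
    also have "\<dots> \<le> T 0 + (\<Sum>j<k. \<delta> * (1/2) ^ Suc j)"
      by (intro add_mono sum_mono le order_trans[OF le m(2)])
    also have "(\<Sum>j<k. \<delta> * (1/2) ^ Suc j) = \<delta> * (1 - (1/2) ^ k)"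
      by (induction k) (auto simp: algebra_simps)
    also have "\<dots> \<le> \<delta>" using \<open>0 < \<delta>\<close> by (simp add: mult_left_le)
    finally show "(\<Sum>n<k. c n * \<nu> n) \<le> T 0 + \<delta>" by simp
  qed
qed

context cnormed
begin

text \<open>The sequence can be multiplied by weights tending to infinity without losing weak
  summability. Only a square root of the admissible weight is spent on \<open>y\<close>; the unspent
  root makes the tails of \<open>y\<close> tend to 0, so that \<open>y\<close> is again
  unconditionally summable.\<close>

lemma uncond_factor:
  assumes p: "1 \<le> p" and x: "x \<in> uncond_seqs p X" and "0 < \<epsilon>"
  obtains y \<theta> where "y \<in> uncond_seqs p X" "weak_norm p X y \<le> weak_norm p X x + \<epsilon>"
    "\<And>n. x n = of_real (\<theta> n) \<odot> y n" "\<And>n. 0 \<le> \<theta> n" "\<And>n. \<theta> n \<le> 1" "antimono \<theta>" "\<theta> \<longlonglongrightarrow> 0"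
proof -
  have p0: "0 < p" using p by simp
  have xw: "x \<in> weak_seqs p X" and t: "(\<lambda>m. weak_norm p X (\<lambda>n. x (m + n))) \<longlonglongrightarrow> 0"
    using x by (auto simp: uncond_seqs_def)
  note xC = weak_seqsD(1)[OF p0 xw]
  define T where "T m = weak_norm p X (\<lambda>n. x (m + n)) powr p" for m
  have T: "T \<longlonglongrightarrow> 0" unfolding T_def
    by (rule tendsto_zero_powrI[OF t tendsto_const _ p0])
      (use weak_seqsD(2)[OF p0 weak_tail[OF p0 xw]] in auto)
  \<comment> \<open>Chosen so that \<open>T 0 + \<delta>\<close> is exactly the \<open>p\<close>-th
    power of the norm allowed for \<open>y\<close>.\<close>
  define \<delta> where "\<delta> = (weak_norm p X x + \<epsilon>) powr p - T 0"
  have \<delta>: "0 < \<delta>" using \<open>0 < \<epsilon>\<close> p0 weak_seqsD(2)[OF p0 xw] by (auto simp: \<delta>_def T_def intro!: powr_less_mono2)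
  obtain \<nu> where \<nu>: "\<And>n. 1 \<le> \<nu> n" "mono \<nu>" "filterlim \<nu> at_top sequentially"
    and sum: "\<And>c k. (\<And>n. 0 \<le> c n) \<Longrightarrow> (\<And>m k. (\<Sum>n\<in>{m..<k}. c n) \<le> T m) \<Longrightarrow> (\<Sum>n<k. c n * \<nu> n) \<le> T 0 + \<delta>"
    using slow_weights[OF T \<delta>] by blast
  define K where "K = weak_norm p X x + \<epsilon>"
  have K: "T 0 + \<delta> = K powr p" "0 \<le> K" using weak_seqsD(2)[OF p0 xw] \<open>0 < \<epsilon>\<close> by (simp_all add: \<delta>_def K_def)
  have \<nu>0: "0 < \<nu> n" for n using \<nu>(1)[of n] by simp
  define \<theta> where "\<theta> n = \<nu> n powr (- (1/2)/p)" for n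
  define y where "y n = of_real (1 / \<theta> n) \<odot> x n" for n
  have \<theta>0: "0 < \<theta> n" for n using \<nu>0[of n] by (simp add: \<theta>_def)
  have \<theta>p: "(1 / \<theta> n) powr p = sqrt (\<nu> n)" for n
    using \<nu>0[of n] p0 by (simp add: \<theta>_def powr_divide powr_powr powr_minus_divide powr_half_sqrt)
  have yC: "y n \<in> C" for n using xC by (simp add: y_def)
  have \<phi>y: "cmod (\<phi> (y n)) powr p = cmod (\<phi> (x n)) powr p * sqrt (\<nu> n)" if "\<phi> \<in> dual_ball X" for \<phi> n
    using xC \<theta>0[of n] by (simp add: y_def dual_ballD[OF that] norm_divide powr_divide flip: \<theta>p)
  have bound: "(\<Sum>n<k. cmod (\<phi> (x n)) powr p * \<nu> n) \<le> K powr p" if \<phi>: "\<phi> \<in> dual_ball X" for \<phi> k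
    unfolding K(1)[symmetric]
  proof (rule sum)
    fix m k
    have "(\<Sum>n\<in>{m..<k}. cmod (\<phi> (x n)) powr p) = (\<Sum>n<k-m. cmod (\<phi> (x (m + n))) powr p)"
      by (cases "m \<le> k") (auto simp: sum.atLeastLessThan_shift_0 atLeast0LessThan add.commute)
    also have "\<dots> \<le> T m" unfolding T_def by (rule weak_seqsD(3)[OF p0 weak_tail[OF p0 xw] \<phi>])
    finally show "(\<Sum>n\<in>{m..<k}. cmod (\<phi> (x n)) powr p) \<le> T m" .
  qed simp
  have sq: "sqrt (\<nu> n) \<le> \<nu> n" for n
    using \<nu>(1)[of n] by (intro real_le_lsqrt[THEN order_trans[OF _ order_refl]]) (auto simp: power2_eq_square)
  have "(\<Sum>n<k. cmod (\<phi> (y n)) powr p) \<le> K powr p" if \<phi>: "\<phi> \<in> dual_ball X" for \<phi> k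
    by (rule order_trans[OF sum_mono bound[OF \<phi>]]) (auto simp: \<phi>y[OF \<phi>] intro: mult_left_mono sq)
  note yw = weak_seqsI[of p y K, OF p0 yC K(2) this]
  \<comment> \<open>Since \<nu> increases, the root of \<nu> at \<open>m + n\<close> is at most
    \<nu> at \<open>m + n\<close> divided by its root at \<open>m\<close>, and that divisor is the
    inverse of \<open>\<theta> m powr p\<close>.\<close>
  have tail: "weak_norm p X (\<lambda>n. y (m + n)) \<le> K * \<theta> m" for m
  proof (rule weak_seqsI(2)[OF p0 yC])
    show "0 \<le> K * \<theta> m" using K \<theta>0[of m] by simp
    fix \<phi> k assume \<phi>: "\<phi> \<in> dual_ball X"
    have "(\<Sum>n<k. cmod (\<phi> (y (m + n))) powr p) \<le> (\<Sum>n<k. cmod (\<phi> (x (m + n))) powr p * \<nu> (m + n) / sqrt (\<nu> m))"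
    proof (rule sum_mono)
      fix n
      have "sqrt (\<nu> (m + n)) * sqrt (\<nu> m) \<le> sqrt (\<nu> (m + n)) * sqrt (\<nu> (m + n))"
        using monoD[OF \<nu>(2), of m "m + n"] \<nu>0[of "m + n"] by (intro mult_left_mono) auto
      then have "sqrt (\<nu> (m + n)) \<le> \<nu> (m + n) / sqrt (\<nu> m)"
        using \<nu>0[of m] \<nu>0[of "m + n"] by (simp add: field_simps)
      then show "cmod (\<phi> (y (m + n))) powr p \<le> cmod (\<phi> (x (m + n))) powr p * \<nu> (m + n) / sqrt (\<nu> m)"
        by (simp add: \<phi>y[OF \<phi>] mult_left_mono flip: times_divide_eq_right)
    qed
    also have "\<dots> = (\<Sum>n\<in>(+) m ` {..<k}. cmod (\<phi> (x n)) powr p * \<nu> n) / sqrt (\<nu> m)"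
      by (simp add: sum.reindex sum_divide_distrib)
    also have "\<dots> \<le> K powr p / sqrt (\<nu> m)"
    proof (rule divide_right_mono)
      have "(\<Sum>n\<in>(+) m ` {..<k}. cmod (\<phi> (x n)) powr p * \<nu> n) \<le> (\<Sum>n<m+k. cmod (\<phi> (x n)) powr p * \<nu> n)"
        using \<nu>0 by (intro sum_mono2) (auto simp: less_imp_le)
      then show "(\<Sum>n\<in>(+) m ` {..<k}. cmod (\<phi> (x n)) powr p * \<nu> n) \<le> K powr p"
        using bound[OF \<phi>] order_trans by blast
    qed (use \<nu>0[of m] in simp)
    also have "\<dots> = (K * \<theta> m) powr p"
      using K(2) \<theta>0[of m] by (simp add: powr_mult powr_divide flip: \<theta>p)
    finally show "(\<Sum>n<k. cmod (\<phi> (y (m + n))) powr p) \<le> (K * \<theta> m) powr p" .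
  qed
  have "((\<lambda>r. r powr (- (1/2)/p)) \<longlongrightarrow> 0) at_top"
    using p0 by (intro tendsto_neg_powr filterlim_ident) auto
  then have \<theta>lim: "\<theta> \<longlonglongrightarrow> 0" unfolding \<theta>_def by (rule filterlim_compose[OF _ \<nu>(3)])
  show ?thesis
  proof (rule that[of y \<theta>])
    have "(\<lambda>m. weak_norm p X (\<lambda>n. y (m + n))) \<longlonglongrightarrow> 0"
      by (rule tendsto_sandwich[OF always_eventually always_eventually tendsto_const tendsto_mult_right_zero[OF \<theta>lim, of K]])
        (use tail weak_seqsD(2)[OF p0 weak_tail[OF p0 yw(1)]] in auto)
    then show "y \<in> uncond_seqs p X" using yw(1) by (simp add: uncond_seqs_def)
    show "weak_norm p X y \<le> weak_norm p X x + \<epsilon>" using yw(2) by (simp add: K_def)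
    show "x n = of_real (\<theta> n) \<odot> y n" for n using \<theta>0[of n] xC[of n] by (simp add: y_def flip: of_real_mult)
    show "0 \<le> \<theta> n" for n using \<theta>0[of n] by simp
    show "\<theta> n \<le> 1" for n using \<nu>(1)[of n] p0 powr_mono[of "- (1/2)/p" 0 "\<nu> n"] by (simp add: \<theta>_def)
    show "antimono \<theta>"
      using \<nu>(2) \<nu>0 p0 by (intro antimonoI) (auto simp: \<theta>_def mono_def intro!: powr_mono2')
    show "\<theta> \<longlonglongrightarrow> 0" by (rule \<theta>lim)
  qed
qed

end

section \<open>Functionals of Taylor coefficients as sums of point evaluations\<close>

text \<open>Discrete orthogonality: the sum is geometric, with a ratio that is an
  \<open>n\<close>-th root of unity.\<close>

lemma roots_of_unity_sum:
  assumes "l < n"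
  defines "w \<equiv> \<lambda>k. exp (2 * of_real pi * \<i> * of_nat k / of_nat n :: complex)"
  shows "(\<Sum>j<n. w k ^ j / w l ^ j) = (if l = k mod n then of_nat n else 0)"
proof -
  define x where "x = w k / w l"
  have w0: "w m \<noteq> 0" for m by (simp add: w_def)
  have "w m ^ n = 1" for m
    unfolding w_def using assms(1) by (intro complex_root_unity) auto
  then have xn: "x ^ n = 1" by (simp add: x_def power_divide)
  have "x = 1 \<longleftrightarrow> w k = w l" using w0 by (simp add: x_def)
  also have "\<dots> \<longleftrightarrow> k mod n = l mod n"
    unfolding w_def using assms(1) by (intro complex_root_unity_eq) auto
  also have "\<dots> \<longleftrightarrow> l = k mod n" using assms(1) by auto
  finally have x1: "x = 1 \<longleftrightarrow> l = k mod n" .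
  have "(\<Sum>j<n. w k ^ j / w l ^ j) = (\<Sum>j<n. x ^ j)" by (simp add: x_def power_divide)
  also have "\<dots> = (if x = 1 then of_nat n else 0)"
    using xn by (simp add: sum_gp_strict)
  finally show ?thesis by (simp add: x1)
qed

text \<open>Quadrature at the roots of unity on the circle of radius \<open>s\<close>; the aliasing error only
  involves degrees at least \<open>n\<close> and is small on a larger circle.\<close>

lemma quadrature_step:
  fixes \<mu> :: "nat \<Rightarrow> complex"
  assumes \<mu>: "\<And>k. cmod (\<mu> k) \<le> \<delta> * r ^ k" and r: "0 < r" "r < s" "s < r'" and "0 < \<epsilon>"
  obtains n :: nat and \<alpha> z :: "nat \<Rightarrow> complex" where "(\<Sum>j<n. cmod (\<alpha> j)) \<le> \<delta> / (1 - r / s)"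
    "\<And>j. cmod (z j) = s" "\<And>k. cmod (\<mu> k - (\<Sum>j<n. \<alpha> j * z j ^ k)) \<le> \<epsilon> * r' ^ k"
proof -
  have \<delta>: "0 \<le> \<delta>" using order_trans[OF norm_ge_zero \<mu>[of 0]] by simp
  have s: "0 < s" "0 < r'" using r by auto
  have "(\<lambda>n. 2 * \<delta> * (s / r') ^ n) \<longlonglongrightarrow> 2 * \<delta> * 0"
    using r s by (intro tendsto_mult tendsto_const LIMSEQ_power_zero) auto
  then have "eventually (\<lambda>n. 2 * \<delta> * (s / r') ^ n < \<epsilon>) sequentially"
    using \<open>0 < \<epsilon>\<close> by (intro order_tendstoD) auto
  then obtain m where m: "\<And>n. n \<ge> m \<Longrightarrow> 2 * \<delta> * (s / r') ^ n < \<epsilon>"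
    by (auto simp: eventually_sequentially)
  \<comment> \<open>Large \<open>n\<close> makes the aliasing error small; the maximum with 1
    protects the division by \<open>n\<close>.\<close>
  define n where "n = max 1 m"
  have n: "n \<ge> 1" "2 * \<delta> * (s / r') ^ n < \<epsilon>" using m[of n] by (auto simp: n_def)
  define w where "w = (\<lambda>k. exp (2 * of_real pi * \<i> * of_nat k / of_nat n :: complex))"
  have w0: "w m \<noteq> 0" and nw: "cmod (w m) = 1" for m by (simp_all add: w_def)
  have wpow: "w j ^ l = w l ^ j" for j l
    by (simp add: w_def mult_ac flip: exp_of_nat_mult)
  define z where "z j = of_real s * w j" for j
  \<comment> \<open>The inverse discrete Fourier transform of \<open>\<mu> l / s ^ l\<close>, so
    that the quadrature is exact in all degrees below \<open>n\<close>.\<close>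
  define \<alpha> where "\<alpha> j = (\<Sum>l<n. \<mu> l / (of_real s ^ l * w l ^ j)) / of_nat n" for j
  show ?thesis
  proof (rule that[of \<alpha> n z])
    have "cmod (\<alpha> j) \<le> (\<delta> / (1 - r / s)) / n" for j
    proof -
      have "cmod (\<Sum>l<n. \<mu> l / (of_real s ^ l * w l ^ j)) \<le> (\<Sum>l<n. \<delta> * (r / s) ^ l)"
      proof (rule order.trans[OF norm_sum sum_mono])
        fix l
        show "cmod (\<mu> l / (of_real s ^ l * w l ^ j)) \<le> \<delta> * (r / s) ^ l"
          using \<mu>[of l] s by (simp add: norm_divide norm_mult norm_power nw power_divide divide_right_mono)
      qed
      also have "\<dots> = \<delta> * (\<Sum>l<n. (r / s) ^ l)" by (simp add: sum_distrib_left)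
      also have "\<dots> \<le> \<delta> * (\<Sum>l. (r / s) ^ l)"
        using r s \<delta> by (intro mult_left_mono sum_le_suminf summable_geometric) auto
      also have "\<dots> = \<delta> / (1 - r / s)" using r s by (simp add: suminf_geometric)
      finally have "cmod (\<Sum>l<n. \<mu> l / (of_real s ^ l * w l ^ j)) / n \<le> \<delta> / (1 - r / s) / n"
        by (rule divide_right_mono) simp
      then show ?thesis by (simp only: \<alpha>_def norm_divide norm_of_nat)
    qed
    then have "(\<Sum>j<n. cmod (\<alpha> j)) \<le> (\<Sum>j<n. (\<delta> / (1 - r / s)) / n)" by (rule sum_mono)
    then show "(\<Sum>j<n. cmod (\<alpha> j)) \<le> \<delta> / (1 - r / s)" using n by simp
    show "cmod (z j) = s" for j using s by (simp add: z_def norm_mult nw)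
    fix k
    have "(\<Sum>j<n. \<alpha> j * z j ^ k)
      = (\<Sum>j<n. \<Sum>l<n. (\<mu> l * of_real s ^ k / of_real s ^ l / of_nat n) * (w k ^ j / w l ^ j))"
      by (simp add: \<alpha>_def z_def sum_distrib_left power_mult_distrib wpow[of _ k] mult_ac divide_inverse)
    also have "\<dots> = (\<Sum>l<n. (\<mu> l * of_real s ^ k / of_real s ^ l / of_nat n) * (\<Sum>j<n. w k ^ j / w l ^ j))"
      by (subst sum.swap) (simp add: sum_distrib_left)
    also have "\<dots> = (\<Sum>l<n. if l = k mod n then \<mu> l * of_real s ^ k / of_real s ^ l else 0)"
      using n by (intro sum.cong refl) (simp add: roots_of_unity_sum w_def)
    also have "\<dots> = \<mu> (k mod n) * of_real s ^ k / of_real s ^ (k mod n)"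
      using n by (simp add: sum.delta)
    \<comment> \<open>Aliasing: on the nodes, degree \<open>k\<close> cannot be told from
      \<open>k mod n\<close> except by the power of the radius.\<close>
    finally have eq: "(\<Sum>j<n. \<alpha> j * z j ^ k) = \<mu> (k mod n) * of_real s ^ k / of_real s ^ (k mod n)" .
    show "cmod (\<mu> k - (\<Sum>j<n. \<alpha> j * z j ^ k)) \<le> \<epsilon> * r' ^ k"
    proof (cases "k < n")
      case True
      then show ?thesis using eq s \<open>0 < \<epsilon>\<close> by simp
    next
      case False
      \<comment> \<open>For \<open>k \<ge> n\<close> both the coefficient and its alias are at most
        \<delta> s^k. Measured against r'^k this gains (s/r')^n, for which \<open>n\<close> was
        chosen.\<close>
      have "cmod (\<mu> (k mod n) * of_real s ^ k / of_real s ^ (k mod n)) = cmod (\<mu> (k mod n)) / s ^ (k mod n) * s ^ k"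
        using s by (simp add: norm_divide norm_mult norm_power)
      also have "\<dots> \<le> \<delta> * s ^ k"
      proof (rule mult_right_mono)
        have "cmod (\<mu> (k mod n)) \<le> \<delta> * s ^ (k mod n)"
          using \<mu>[of "k mod n"] r \<delta> by (meson less_imp_le mult_left_mono order_trans power_mono)
        then show "cmod (\<mu> (k mod n)) / s ^ (k mod n) \<le> \<delta>" using s by (simp add: divide_le_eq)
      qed (use s in simp)
      finally have "cmod (\<Sum>j<n. \<alpha> j * z j ^ k) \<le> \<delta> * s ^ k" by (simp add: eq)
      moreover have "cmod (\<mu> k) \<le> \<delta> * s ^ k"
        using \<mu>[of k] r \<delta> by (meson less_imp_le mult_left_mono order_trans power_mono)
      ultimately have "cmod (\<mu> k - (\<Sum>j<n. \<alpha> j * z j ^ k)) \<le> 2 * \<delta> * s ^ k"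
        using norm_triangle_ineq4[of "\<mu> k" "\<Sum>j<n. \<alpha> j * z j ^ k"] by linarith
      also have "\<dots> = 2 * \<delta> * (s / r') ^ k * r' ^ k" using s by (simp add: power_divide)
      also have "\<dots> \<le> 2 * \<delta> * (s / r') ^ n * r' ^ k"
        using s r \<delta> False by (intro mult_right_mono mult_left_mono power_decreasing) auto
      also have "\<dots> \<le> \<epsilon> * r' ^ k" using n s by (intro mult_right_mono) auto
      finally show ?thesis .
    qed
  qed
qed

text \<open>The error of one quadrature is again a coefficient sequence of geometric decay, with a
  ratio closer to 1, so quadrature can be repeated on it and the errors telescope. Nodes and
  coefficients are found from \<mu> alone, before the bounded sequence \<open>c\<close> is
  given.\<close>

lemma disc_functional:
  fixes \<mu> :: "nat \<Rightarrow> complex"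
  assumes \<mu>: "\<And>k. cmod (\<mu> k) \<le> (1/8) * (1/2) ^ k"
  obtains n :: "nat \<Rightarrow> nat" and \<alpha> z :: "nat \<Rightarrow> nat \<Rightarrow> complex"
  where "\<forall>i. (\<Sum>j<n i. cmod (\<alpha> i j)) \<le> (1/2) ^ i" "\<forall>i j. cmod (z i j) < 1"
    "\<forall>c B. (\<forall>k. cmod (c k) \<le> B) \<longrightarrow>
      (\<lambda>i. \<Sum>j<n i. \<alpha> i j * (\<Sum>k. c k * z i j ^ k)) sums (\<Sum>k. \<mu> k * c k)"
proof -
  define d where "d i = (1/2 :: real) ^ i" for i :: nat
  have d: "0 < d i" "d i \<le> 1" "d (Suc i) = d i / 2" for i by (simp_all add: d_def power_le_one)
  define r where "r i = 1 - d i / 2" for i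
  have r: "0 < r i" "r i < 1" for i using d[of i] by (auto simp: r_def)
  \<comment> \<open>The factor \<open>d i * d i\<close> compensates for
    \<open>1 / (1 - r i) = 2 / d i\<close>, so the remaining functionals still tend to 0. At
    \<open>i = 0\<close> the bound is the hypothesis on \<mu>.\<close>
  define P where "P i l \<longleftrightarrow> (\<forall>k. cmod (l k) \<le> d i * d i / 8 * r i ^ k)" for i and l :: "nat \<Rightarrow> complex"
  define Q where "Q i l l' \<longleftrightarrow> (\<exists>(n::nat) \<alpha> z. (\<Sum>j<n. cmod (\<alpha> j)) \<le> d i \<and> (\<forall>j. cmod (z j) < 1) \<and>
      (\<forall>k. l' k = l k - (\<Sum>j<n. \<alpha> j * z j ^ k)))" for i and l l' :: "nat \<Rightarrow> complex"
  have "\<exists>L. \<forall>i. (P i (L i) \<and> (i = 0 \<longrightarrow> L i = \<mu>)) \<and> Q i (L i) (L (Suc i))"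
  proof (rule dependent_nat_choice)
    show "\<exists>x. P 0 x \<and> (0 = 0 \<longrightarrow> x = \<mu>)"
      using \<mu> by (auto simp: P_def d_def r_def)
    fix l i assume l: "P i l \<and> (i = 0 \<longrightarrow> l = \<mu>)"
    \<comment> \<open>The midpoint of \<open>r i\<close> and \<open>r (Suc i)\<close>. The gap
      \<open>s - r i = d i / 8\<close> turns the quadrature cost into at most
      \<open>(d i * d i / 8) / (d i / 8) = d i\<close>.\<close>
    define s where "s = 1 - 3 * d i / 8"
    have s: "r i < s" "s < r (Suc i)" "0 < s" "s < 1" using d[of i] by (auto simp: r_def s_def)
    obtain n and \<alpha> z :: "nat \<Rightarrow> complex" where st: "(\<Sum>j<n. cmod (\<alpha> j)) \<le> (d i * d i / 8) / (1 - r i / s)"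
      "\<And>j. cmod (z j) = s"
      "\<And>k. cmod (l k - (\<Sum>j<n. \<alpha> j * z j ^ k)) \<le> (d (Suc i) * d (Suc i) / 8) * r (Suc i) ^ k"
    proof (rule quadrature_step[of l "d i * d i / 8" "r i" s "r (Suc i)" "d (Suc i) * d (Suc i) / 8"])
      show "0 < d (Suc i) * d (Suc i) / 8" using d(1)[of "Suc i"] by simp
    qed (use l s r d[of "Suc i"] in \<open>auto simp: P_def\<close>)
    have "d i / 8 = s - r i" by (simp add: s_def r_def)
    also have "\<dots> \<le> 1 - r i / s"
    proof -
      have "(s - r i) * s \<le> s - r i" using s by (intro mult_left_le) auto
      then show ?thesis using s by (simp add: field_simps)
    qed
    finally have "(d i * d i / 8) / (1 - r i / s) \<le> (d i * d i / 8) / (d i / 8)"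
      using d[of i] s by (intro divide_left_mono mult_pos_pos) auto
    then have "(\<Sum>j<n. cmod (\<alpha> j)) \<le> d i" using st(1) d(1)[of i] by simp
    then have "Q i l (\<lambda>k. l k - (\<Sum>j<n. \<alpha> j * z j ^ k))"
      unfolding Q_def using st(2) s by (intro exI[of _ n] exI[of _ \<alpha>] exI[of _ z]) auto
    moreover have "P (Suc i) (\<lambda>k. l k - (\<Sum>j<n. \<alpha> j * z j ^ k))"
      unfolding P_def using st(3) by blast
    ultimately show "\<exists>y. (P (Suc i) y \<and> (Suc i = 0 \<longrightarrow> y = \<mu>)) \<and> Q i l y" by blast
  qed
  then obtain L where LP: "\<And>i. P i (L i)" and L0: "L 0 = \<mu>" and LQ: "\<And>i. Q i (L i) (L (Suc i))" by auto
  have "\<forall>i. \<exists>(n::nat) \<alpha> z. (\<Sum>j<n. cmod (\<alpha> j)) \<le> d i \<and> (\<forall>j. cmod (z j) < 1) \<and>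
      (\<forall>k. L (Suc i) k = L i k - (\<Sum>j<n. \<alpha> j * z j ^ k))"
    using LQ by (simp add: Q_def)
  then obtain n :: "nat \<Rightarrow> nat" and \<alpha> z :: "nat \<Rightarrow> nat \<Rightarrow> complex" where "\<forall>i. (\<Sum>j<n i. cmod (\<alpha> i j)) \<le> d i \<and> (\<forall>j. cmod (z i j) < 1) \<and>
      (\<forall>k. L (Suc i) k = L i k - (\<Sum>j<n i. \<alpha> i j * z i j ^ k))"
    unfolding choice_iff by blast
  then have a: "\<And>i. (\<Sum>j<n i. cmod (\<alpha> i j)) \<le> d i" and z: "\<And>i j. cmod (z i j) < 1"
    and L: "\<And>i k. L (Suc i) k = L i k - (\<Sum>j<n i. \<alpha> i j * z i j ^ k)"
    by auto
  show ?thesis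
  proof (rule that[of \<alpha> n z])
    show "\<forall>i. (\<Sum>j<n i. cmod (\<alpha> i j)) \<le> (1/2) ^ i" using a by (simp add: d_def)
    show "\<forall>i j. cmod (z i j) < 1" using z by blast
    show "\<forall>c B. (\<forall>k. cmod (c k) \<le> B) \<longrightarrow>
      (\<lambda>i. \<Sum>j<n i. \<alpha> i j * (\<Sum>k. c k * z i j ^ k)) sums (\<Sum>k. \<mu> k * c k)"
    proof (intro allI impI)
      fix c :: "nat \<Rightarrow> complex" and B assume "\<forall>k. cmod (c k) \<le> B"
      then have c: "\<And>k. cmod (c k) \<le> B" by blast
      have B: "0 \<le> B" using c[of 0] norm_ge_zero order_trans by blast
      have sz: "summable (\<lambda>k. c k * w ^ k)" if "cmod w < 1" for w
      proof (rule summable_comparison_test')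
        show "summable (\<lambda>k. B * cmod w ^ k)" using that by (intro summable_mult summable_geometric) auto
      qed (use c in \<open>auto simp: norm_mult norm_power mult_right_mono\<close>)
      have bd: "cmod (L i k * c k) \<le> d i * d i / 8 * B * r i ^ k" for i k
      proof -
        have "cmod (L i k) * cmod (c k) \<le> (d i * d i / 8 * r i ^ k) * B"
          using LP c r[of i] d[of i] by (intro mult_mono) (auto simp: P_def)
        then show ?thesis by (simp add: norm_mult mult_ac)
      qed
      have sg: "(\<lambda>k. d i * d i / 8 * B * r i ^ k) sums (d i * d i / 8 * B * (1 / (1 - r i)))" for i
        using r[of i] by (intro sums_mult geometric_sums) auto
      have sL: "summable (\<lambda>k. L i k * c k)" for i
        by (rule summable_comparison_test'[OF sums_summable[OF sg]]) (use bd in auto)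
      \<comment> \<open>The value at \<open>c\<close> of the functional left after \<open>i\<close>
        rounds; each round contributes the difference of two consecutive values.\<close>
      define T where "T i = (\<Sum>k. L i k * c k)" for i
      have Tle: "cmod (T i) \<le> d i * (B / 4)" for i
      proof -
        have "cmod (T i) \<le> (\<Sum>k. d i * d i / 8 * B * r i ^ k)"
          unfolding T_def by (intro norm_suminf_le bd sums_summable[OF sg])
        also have "\<dots> = d i * d i / 8 * B * (1 / (1 - r i))" by (rule sums_unique[OF sg, symmetric])
        also have "\<dots> = d i * (B / 4)" using d(1)[of i] by (simp add: r_def field_simps)
        finally show ?thesis .
      qed
      have "d \<longlonglongrightarrow> 0" unfolding d_def by (intro LIMSEQ_power_zero) auto
      then have "(\<lambda>i. d i * (B / 4)) \<longlonglongrightarrow> 0" using tendsto_mult_left_zero by blast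
      then have T0: "T \<longlonglongrightarrow> 0" by (rule Lim_null_comparison[OF always_eventually, rotated]) (use Tle in auto)
      have "(\<Sum>j<n i. \<alpha> i j * (\<Sum>k. c k * z i j ^ k)) = T i - T (Suc i)" for i
      proof -
        have "(\<Sum>j<n i. \<alpha> i j * (\<Sum>k. c k * z i j ^ k)) = (\<Sum>j<n i. \<Sum>k. \<alpha> i j * (c k * z i j ^ k))"
          by (intro sum.cong refl suminf_mult[symmetric] sz z)
        also have "\<dots> = (\<Sum>k. \<Sum>j<n i. \<alpha> i j * (c k * z i j ^ k))"
          by (intro suminf_sum[symmetric] summable_mult sz z)
        also have "\<dots> = (\<Sum>k. L i k * c k - L (Suc i) k * c k)"
          by (simp add: L left_diff_distrib right_diff_distrib sum_distrib_left mult_ac)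
        also have "\<dots> = T i - T (Suc i)"
          unfolding T_def by (rule suminf_diff[OF sL sL, symmetric])
        finally show ?thesis .
      qed
      then have "(\<lambda>i. \<Sum>j<n i. \<alpha> i j * (\<Sum>k. c k * z i j ^ k)) = (\<lambda>i. T i - T (Suc i))" by auto
      also have "\<dots> sums (T 0 - 0)" by (rule telescope_sums'[OF T0])
      finally show "(\<lambda>i. \<Sum>j<n i. \<alpha> i j * (\<Sum>k. c k * z i j ^ k)) sums (\<Sum>k. \<mu> k * c k)"
        by (simp add: T_def L0)
    qed
  qed
qed

text \<open>Cauchy's inequality on a circle of radius r < 1 loses a factor r^(-k), which disappears
  as r tends to 1.\<close>

lemma taylor_coeff_bound:
  assumes "f holomorphic_on ball 0 1" "\<And>z. cmod z < 1 \<Longrightarrow> cmod (f z) \<le> B"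
  shows "cmod ((deriv ^^ k) f 0 / fact k) \<le> B"
proof -
  have *: "cmod ((deriv ^^ k) f 0 / fact k) * r ^ k \<le> B" if r: "0 < r" "r < 1" for r
  proof -
    have sub: "cball 0 r \<subseteq> ball (0::complex) 1" using r by auto
    have "f holomorphic_on ball 0 r" "continuous_on (cball 0 r) f"
      using assms(1) sub r holomorphic_on_subset holomorphic_on_imp_continuous_on
      by (blast intro: ball_subset_cball[THEN subsetD])+
    then have "cmod ((deriv ^^ k) f 0) \<le> fact k * B / r ^ k"
      using r assms(2) by (intro Cauchy_inequality) auto
    then show ?thesis using r by (simp add: norm_divide field_simps)
  qed
  show ?thesis
  proof (rule tendsto_upperbound)
    show "((\<lambda>r. cmod ((deriv ^^ k) f 0 / fact k) * r ^ k) \<longlongrightarrow> cmod ((deriv ^^ k) f 0 / fact k)) (at_left 1)"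
      by (auto intro!: tendsto_eq_intros)
    show "\<forall>\<^sub>F r in at_left 1. cmod ((deriv ^^ k) f 0 / fact k) * r ^ k \<le> B"
      using * by (auto simp: eventually_at_left[of 0] intro!: exI[of _ 0])
  qed simp
qed

section \<open>Quotients of the sequence spaces\<close>

context cquotient
begin

lemma Q_diff: "x \<in> C \<Longrightarrow> y \<in> C \<Longrightarrow> cs_diff Q (coset x) (coset y) = coset (cs_diff X x y)"
  by (simp add: cs_diff_def Q_add Q_scale)

end

lemma conj_finite_support:
  assumes "1 \<le> p"
  shows "(\<lambda>m. if m < k then c m else 0) \<in> cs_carrier (conj_seq_space p)"
proof (cases "p = 1")
  case True
  have "(\<lambda>m. if m < k then c m else 0) \<longlonglongrightarrow> 0"
    by (rule tendsto_eventually, rule eventually_sequentiallyI[of k]) simp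
  then show ?thesis by (simp add: True conj_carrier_one)
next
  case False
  have "summable (\<lambda>m. cmod (if m < k then c m else 0) powr conj_index p)"
    using conj_index(4)[of p] assms False by (intro summable_finite[of "{..<k}"]) auto
  then show ?thesis using assms False by (simp add: conj_carrier_gt)
qed

lemma conj_sum:
  assumes p: "1 \<le> p" and "finite J" and b: "\<And>j. j \<in> J \<Longrightarrow> b j \<in> cs_carrier (conj_seq_space p)"
  shows "(\<lambda>m. \<Sum>j\<in>J. \<alpha> j * b j m) \<in> cs_carrier (conj_seq_space p) \<and>
    cs_norm (conj_seq_space p) (\<lambda>m. \<Sum>j\<in>J. \<alpha> j * b j m) \<le> (\<Sum>j\<in>J. cmod (\<alpha> j) * cs_norm (conj_seq_space p) (b j))"
  using assms(2) b
proof (induction J rule: finite_induct)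
  case empty
  then show ?case using conj_zero[OF p] cnormed.norm_zero[OF cnormed_conj_seq_space[OF p]] by simp
next
  case (insert j J)
  have a: "(\<lambda>m. \<alpha> j * b j m) \<in> cs_carrier (conj_seq_space p)"
    "cs_norm (conj_seq_space p) (\<lambda>m. \<alpha> j * b j m) = cmod (\<alpha> j) * cs_norm (conj_seq_space p) (b j)"
    using conj_scale[OF p] insert.prems by auto
  have IH: "(\<lambda>m. \<Sum>j\<in>J. \<alpha> j * b j m) \<in> cs_carrier (conj_seq_space p)"
    "cs_norm (conj_seq_space p) (\<lambda>m. \<Sum>j\<in>J. \<alpha> j * b j m) \<le> (\<Sum>j\<in>J. cmod (\<alpha> j) * cs_norm (conj_seq_space p) (b j))"
    using insert by auto
  show ?case
    using insert.hyps conj_add[OF p a(1) IH(1)] a(2) IH(2) by simp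
qed

locale seq_quotient =
  fixes p :: real and M :: "(nat \<Rightarrow> complex) set"
  assumes p: "1 \<le> p" and closed: "closed_subspace (conj_seq_space p) M"
begin

sublocale cquotient "conj_seq_space p" M
  using cnormed_conj_seq_space[OF p] closed by (simp add: cquotient_def cquotient_axioms_def)

definition basis :: "nat \<Rightarrow> (nat \<Rightarrow> complex) set"
  where "basis k = coset (\<lambda>n. if n = k then 1 else 0)"

lemma unit_in: "(\<lambda>n. if n = k then 1 else 0) \<in> C"
proof -
  have "(\<lambda>n. if n = k then 1 else 0) = (\<lambda>m. if m < Suc k then (if m = k then 1 else 0) else 0)" by auto
  then show ?thesis
    using conj_finite_support[OF p] by (rule ssubst[where P = "\<lambda>z. z \<in> C"])
qed

lemma basis_in: "basis k \<in> cs_carrier Q"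
  by (auto simp: basis_def Q_carrier unit_in)

lemma Q_psum_basis: "cs_psum Q (\<lambda>n. cs_scale Q (c n) (basis n)) k = coset (\<lambda>m. if m < k then c m else 0)"
proof (induction k)
  case 0
  then show ?case by (simp add: Q_zero)
next
  case (Suc k)
  have "cs_psum Q (\<lambda>n. cs_scale Q (c n) (basis n)) (Suc k)
    = cs_add Q (coset (\<lambda>m. if m < k then c m else 0)) (coset (\<lambda>n. c k * (if n = k then 1 else 0)))"
    by (simp add: Suc Q_scale[OF unit_in] basis_def[of k])
  also have "\<dots> = coset (\<lambda>n. (if n < k then c n else 0) + c k * (if n = k then 1 else 0))"
    using conj_scale(1)[OF p unit_in[of k], of "c k"] by (subst Q_add) (auto simp: conj_finite_support[OF p])
  also have "(\<lambda>n. (if n < k then c n else 0) + c k * (if n = k then 1 else 0)) = (\<lambda>m. if m < Suc k then c m else 0)"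
    by (auto simp: fun_eq_iff less_Suc_eq)
  finally show ?case .
qed

text \<open>A finitely supported \<open>a\<close> in the unit ball attains equality in Hoelder's
  inequality for the values of \<phi>. Passing to its coset does not increase the norm, so \<phi> is
  at most 1 there in modulus.\<close>

lemma dual_basis_bound:
  assumes \<phi>: "\<phi> \<in> dual_ball Q"
  shows "(\<Sum>n<k. cmod (\<phi> (basis n)) powr p) \<le> 1"
proof -
  interpret G: cnormed Q by (rule cnormed_quotient)
  obtain a where a: "a \<in> cs_ball (conj_seq_space p)" "\<And>n. n \<ge> k \<Longrightarrow> a n = 0"
    "(\<Sum>n<k. a n * \<phi> (basis n)) = of_real ((\<Sum>n<k. cmod (\<phi> (basis n)) powr p) powr (1/p))"
    using conj_Holder_attained[OF p, of k "\<lambda>n. \<phi> (basis n)"] by blast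
  have aC: "a \<in> C" "N a \<le> 1" using a(1) by (auto simp: cs_ball_def)
  have "(\<lambda>m. if m < k then a m else 0) = a" using a(2) by (auto simp: fun_eq_iff)
  then have "\<phi> (coset a) = (\<Sum>n<k. a n * \<phi> (basis n))"
    using G.dual_psum[OF \<phi>, of "\<lambda>n. cs_scale Q (a n) (basis n)" k] basis_in
    by (simp add: Q_psum_basis G.dual_ballD[OF \<phi>])
  moreover have "cmod (\<phi> (coset a)) \<le> 1"
    using G.dual_ball_le_norm[OF \<phi>, of "coset a"] Q_norm_le[OF aC(1) self_coset[OF aC(1)]] aC
    by (simp add: Q_carrier)
  ultimately have "(\<Sum>n<k. cmod (\<phi> (basis n)) powr p) powr (1/p) \<le> 1" using a(3) by simp
  then have "((\<Sum>n<k. cmod (\<phi> (basis n)) powr p) powr (1/p)) powr p \<le> 1 powr p"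
    using p by (intro powr_mono2) auto
  then show ?thesis using p by (simp add: powr_powr sum_nonneg)
qed

text \<open>\<open>dual_basis_bound\<close> gives no decay of tails, so in the unconditional case
  all of it comes from \<theta>; since \<theta> decreases, \<open>\<theta> m\<close> bounds the
  entire tail from \<open>m\<close>.\<close>

lemma scaled_basis_gen:
  assumes \<theta>: "\<And>n. 0 \<le> \<theta> n" "\<And>n. \<theta> n \<le> 1" "antimono \<theta>" and J: "J = Kwp \<or> J = Kup \<and> \<theta> \<longlonglongrightarrow> 0"
  defines "y \<equiv> \<lambda>n. cs_scale Q (of_real (\<theta> n)) (basis n)"
  shows "y \<in> gen_seqs J p Q" "gen_norm J p Q y \<le> 1"
proof -
  interpret G: cnormed Q by (rule cnormed_quotient)
  have p0: "0 < p" using p by simp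
  have yC: "y n \<in> cs_carrier Q" for n using basis_in by (simp add: y_def)
  have tail: "(\<Sum>n<k. cmod (\<phi> (y (m + n))) powr p) \<le> \<theta> m powr p" if \<phi>: "\<phi> \<in> dual_ball Q" for \<phi> m k
  proof -
    have "(\<Sum>n<k. cmod (\<phi> (y (m + n))) powr p) \<le> (\<Sum>n<k. \<theta> m powr p * cmod (\<phi> (basis (m + n))) powr p)"
    proof (rule sum_mono)
      fix n
      have "\<theta> (m + n) powr p \<le> \<theta> m powr p"
        using \<theta> p0 by (intro powr_mono2) (auto simp: antimono_def)
      then show "cmod (\<phi> (y (m + n))) powr p \<le> \<theta> m powr p * cmod (\<phi> (basis (m + n))) powr p"
        using basis_in \<theta>(1) by (simp add: y_def G.dual_ballD[OF \<phi>] norm_mult powr_mult mult_right_mono)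
    qed
    also have "\<dots> = \<theta> m powr p * (\<Sum>n\<in>(+) m ` {..<k}. cmod (\<phi> (basis n)) powr p)"
      by (simp add: sum.reindex sum_distrib_left)
    also have "\<dots> \<le> \<theta> m powr p * 1"
    proof (rule mult_left_mono)
      have "(\<Sum>n\<in>(+) m ` {..<k}. cmod (\<phi> (basis n)) powr p) \<le> (\<Sum>n<m+k. cmod (\<phi> (basis n)) powr p)"
        by (intro sum_mono2) auto
      then show "(\<Sum>n\<in>(+) m ` {..<k}. cmod (\<phi> (basis n)) powr p) \<le> 1"
        using dual_basis_bound[OF \<phi>] order_trans by blast
    qed simp
    finally show ?thesis by simp
  qed
  have t: "(\<lambda>n. y (m + n)) \<in> weak_seqs p Q" "weak_norm p Q (\<lambda>n. y (m + n)) \<le> \<theta> m" for m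
    using G.weak_seqsI[of p "\<lambda>n. y (m + n)" "\<theta> m"] p0 yC \<theta>(1) tail by auto
  have "(\<lambda>m. weak_norm p Q (\<lambda>n. y (m + n))) \<longlonglongrightarrow> 0" if "\<theta> \<longlonglongrightarrow> 0"
    by (rule tendsto_sandwich[OF always_eventually always_eventually tendsto_const that])
      (use t G.weak_seqsD(2)[OF p0 t(1)] in auto)
  moreover have "weak_norm p Q y \<le> 1" using t(2)[of 0] \<theta>(2)[of 0] by simp
  ultimately show "y \<in> gen_seqs J p Q" "gen_norm J p Q y \<le> 1"
    using t(1)[of 0] J by (auto simp: uncond_seqs_def)
qed

text \<open>The error is the coset of a truncated tail of \<open>c\<close>, controlled by
  \<open>conj_tail\<close>. This places cosets of ball elements in the \<open>p\<close>-convex hull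
  of the basis.\<close>

lemma Q_sums_basis:
  assumes c: "c \<in> C"
  shows "cs_sums Q (\<lambda>n. cs_scale Q (c n) (basis n)) (coset c)"
proof -
  let ?t = "\<lambda>k m. if m < k then 0 else c m"
  have t: "?t k \<in> C" for k by (rule conj_dominated[OF p c]) auto
  have "cs_diff Q (cs_psum Q (\<lambda>n. cs_scale Q (c n) (basis n)) k) (coset c) = coset (\<lambda>m. - 1 * ?t k m)" for k
    unfolding Q_psum_basis using c
    by (subst Q_diff) (auto simp: conj_finite_support[OF p] intro!: arg_cong[where f = coset])
  moreover have "cs_norm Q (coset (\<lambda>m. - 1 * ?t k m)) \<le> N (?t k)" for k
    using Q_norm_le[OF conj_scale(1)[OF p t] self_coset[OF conj_scale(1)[OF p t]], of "-1" k]
      conj_scale(2)[OF p t[of k], of "-1"] by simp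
  moreover have "0 \<le> cs_norm Q (coset (\<lambda>m. - 1 * ?t k m))" for k
    using cnormed.norm_nonneg[OF cnormed_quotient, of "coset (\<lambda>m. - 1 * ?t k m)"] conj_scale(1)[OF p t, of "-1" k]
    by (auto simp: Q_carrier)
  ultimately have "(\<lambda>k. cs_norm Q (cs_diff Q (cs_psum Q (\<lambda>n. cs_scale Q (c n) (basis n)) k) (coset c))) \<longlonglongrightarrow> 0"
    by (intro tendsto_sandwich[OF always_eventually always_eventually tendsto_const conj_tail[OF p c]]) auto
  then show ?thesis using c by (auto simp: cs_sums_def Q_carrier)
qed

end

section \<open>The synthesis operator of a weakly summable sequence\<close>

lemma psum_type_space: "cs_psum type_space y n = (\<Sum>i<n. y i)"
  by (induction n) simp_all

lemma dual_ball_type_space: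
  assumes "\<psi> \<in> dual_ball (type_space :: 'a::complex_banach cspace)"
  shows "bounded_linear \<psi>" "\<psi> (c *\<^sub>C x) = c * \<psi> x"
  using assms by (auto simp: dual_ball_def bounded_operator_type_space scaleC_complex_def)

lemma dual_ball_separates:
  fixes x y :: "'a::complex_banach"
  assumes "\<And>\<psi>. \<psi> \<in> dual_ball type_space \<Longrightarrow> \<psi> x = \<psi> y"
  shows "x = y"
proof -
  have "cmod (\<psi> (x - y)) \<le> 0" if "\<psi> \<in> dual_ball type_space" for \<psi>
    using assms[OF that] dual_ball_type_space(1)[OF that] by (simp add: bounded_linear.linear linear_diff)
  then have "norm (x - y) \<le> 0"
    using cnormed.norm_le_dual[OF cnormed_type_space, of "x - y" 0] by simp
  then show ?thesis by simp
qed

lemma bounded_linear_scaleC: "bounded_linear (\<lambda>x :: 'a::complex_banach. c *\<^sub>C x)"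
proof (rule bounded_linear_intro[where K = "cmod c"])
  show "c *\<^sub>C (r *\<^sub>R x) = r *\<^sub>R c *\<^sub>C x" for r and x :: 'a
    unfolding scaleC_of_real[symmetric] scaleC_scaleC by (simp only: mult.commute)
qed (simp_all add: scaleC_add_right norm_scaleC mult.commute)

lemma bounded_linear_scaleC_left: "bounded_linear (\<lambda>c. c *\<^sub>C (x :: 'a::complex_banach))"
proof (rule bounded_linear_intro[where K = "norm x"])
  show "(r *\<^sub>R c) *\<^sub>C x = r *\<^sub>R c *\<^sub>C x" for r c
    by (simp only: scaleR_conv_of_real[of r c] scaleC_scaleC[symmetric] scaleC_of_real)
qed (simp_all add: scaleC_add_left norm_scaleC)

locale synthesis =
  fixes p :: real and Y :: "nat \<Rightarrow> 'f::complex_banach"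
  assumes p: "1 \<le> p" and Y: "Y \<in> weak_seqs p type_space"
begin

abbreviation "Z \<equiv> cs_carrier (conj_seq_space p)"
abbreviation "NZ \<equiv> cs_norm (conj_seq_space p)"

definition syn :: "(nat \<Rightarrow> complex) \<Rightarrow> 'f"
  where "syn a = (\<Sum>n. a n *\<^sub>C Y n)"

definition W :: real where "W = weak_norm p type_space Y"

lemma W_nonneg: "0 \<le> W"
  unfolding W_def using p by (intro cnormed.weak_seqsD(2)[OF cnormed_type_space _ Y]) simp

lemma partial_bound: "a \<in> Z \<Longrightarrow> norm (\<Sum>n<k. a n *\<^sub>C Y n) \<le> NZ a * W"
  using cnormed.psum_weak_bound[OF cnormed_type_space p Y, of a k] by (simp add: psum_type_space W_def)

lemma syn_sums: "a \<in> Z \<Longrightarrow> (\<lambda>n. a n *\<^sub>C Y n) sums syn a"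
proof -
  assume a: "a \<in> Z"
  have "summable (\<lambda>n. a n *\<^sub>C Y n)"
    unfolding summable_Cauchy
  proof (intro allI impI)
    fix e :: real assume "e > 0"
    have t: "(\<lambda>n. if n < m then 0 else a n) \<in> Z" for m by (rule conj_dominated[OF p a]) auto
    have "(\<lambda>m. NZ (\<lambda>n. if n < m then 0 else a n) * W) \<longlonglongrightarrow> 0"
      by (rule tendsto_mult_left_zero[OF conj_tail[OF p a]])
    then have "\<forall>\<^sub>F m in sequentially. NZ (\<lambda>n. if n < m then 0 else a n) * W < e"
      using \<open>e > 0\<close> by (intro order_tendstoD) auto
    then obtain K where K: "\<And>m. m \<ge> K \<Longrightarrow> NZ (\<lambda>n. if n < m then 0 else a n) * W < e"
      by (auto simp: eventually_sequentially)
    have "norm (\<Sum>i\<in>{m..<n}. a i *\<^sub>C Y i) < e" if "m \<ge> K" for m n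
    proof -
      \<comment> \<open>A block of the series is a partial sum for the truncated coefficients, whose
        norm tends to 0.\<close>
      have "(\<Sum>i\<in>{m..<n}. a i *\<^sub>C Y i) = (\<Sum>i<n. (if i < m then 0 else a i) *\<^sub>C Y i)"
        by (rule sum.mono_neutral_cong_left) auto
      then show ?thesis using partial_bound[OF t, of m n] K[OF that] by simp
    qed
    then show "\<exists>K. \<forall>m\<ge>K. \<forall>n. norm (\<Sum>i\<in>{m..<n}. a i *\<^sub>C Y i) < e" by blast
  qed
  then show ?thesis by (simp add: syn_def summable_sums)
qed

lemma syn_eqI: "(\<lambda>n. a n *\<^sub>C Y n) sums s \<Longrightarrow> syn a = s"
  by (simp add: syn_def sums_iff)

lemma syn_norm: "a \<in> Z \<Longrightarrow> norm (syn a) \<le> NZ a * W"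
  by (rule tendsto_upperbound[OF tendsto_norm[OF syn_sums[unfolded sums_def]]]) (simp_all add: partial_bound)

lemma syn_add: "a \<in> Z \<Longrightarrow> b \<in> Z \<Longrightarrow> syn (\<lambda>n. a n + b n) = syn a + syn b"
  using sums_add[OF syn_sums syn_sums] by (intro syn_eqI) (simp add: scaleC_add_left)

lemma syn_scale: "a \<in> Z \<Longrightarrow> syn (\<lambda>n. c * a n) = c *\<^sub>C syn a"
  using bounded_linear.sums[OF bounded_linear_scaleC[of c] syn_sums]
  by (intro syn_eqI) (simp add: scaleC_scaleC)

lemma syn_zero: "syn (\<lambda>n. 0) = 0"
  by (simp add: syn_def)

lemma syn_diff:
  assumes "a \<in> Z" "b \<in> Z"
  shows "(\<lambda>n. a n - b n) \<in> Z" "syn (\<lambda>n. a n - b n) = syn a - syn b"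
proof -
  have m: "(\<lambda>n. - 1 * b n) \<in> Z" by (rule conj_scale[OF p assms(2)])
  show "(\<lambda>n. a n - b n) \<in> Z" using conj_add(1)[OF p assms(1) m] by simp
  show "syn (\<lambda>n. a n - b n) = syn a - syn b"
    using syn_add[OF assms(1) m] syn_scale[OF assms(2), of "-1"] scaleC_of_real[of "-1" "syn b"] by simp
qed

lemma syn_sum:
  assumes "finite J" "\<And>j. j \<in> J \<Longrightarrow> b j \<in> Z"
  shows "syn (\<lambda>m. \<Sum>j\<in>J. \<alpha> j * b j m) = (\<Sum>j\<in>J. \<alpha> j *\<^sub>C syn (b j))"
  using assms
proof (induction J rule: finite_induct)
  case (insert j J)
  have "syn (\<lambda>m. \<alpha> j * b j m + (\<Sum>j\<in>J. \<alpha> j * b j m)) = syn (\<lambda>m. \<alpha> j * b j m) + syn (\<lambda>m. \<Sum>j\<in>J. \<alpha> j * b j m)"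
    using insert conj_sum[OF p, of J b \<alpha>] by (intro syn_add conj_scale[OF p]) auto
  then show ?case using insert by (simp add: syn_scale)
qed (simp add: syn_zero)

lemma syn_suminf:
  assumes b: "\<And>i. b i \<in> Z" and le: "\<And>i. NZ (b i) \<le> K i" and K: "summable K"
  shows "(\<lambda>i. syn (b i)) sums syn (\<lambda>m. \<Sum>i. b i m)"
  unfolding sums_def
proof (rule LIM_zero_cancel, rule Lim_null_comparison[OF always_eventually])
  note s = conj_suminf(3)[OF p b le K]
  show "(\<lambda>k. ((\<Sum>i. K i) - (\<Sum>i<k. K i)) * W) \<longlonglongrightarrow> 0"
    using tendsto_mult_left_zero[OF tendsto_diff[OF tendsto_const summable_LIMSEQ[OF K], of "\<Sum>i. K i", simplified]] .
  show "\<forall>k. norm ((\<Sum>i<k. syn (b i)) - syn (\<lambda>m. \<Sum>i. b i m)) \<le> ((\<Sum>i. K i) - (\<Sum>i<k. K i)) * W"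
  proof
    fix k
    have K': "summable (\<lambda>i. K (i + k))" using K by (simp add: summable_iff_shift)
    have t: "(\<lambda>m. \<Sum>i. b (i + k) m) \<in> Z" "NZ (\<lambda>m. \<Sum>i. b (i + k) m) \<le> (\<Sum>i. K (i + k))"
      using conj_suminf[OF p b le K'] by auto
    \<comment> \<open>The coefficient 1 brings the initial segment into the form of
      \<open>conj_sum\<close> and \<open>syn_sum\<close>.\<close>
    have i: "(\<lambda>m. \<Sum>i<k. 1 * b i m) \<in> Z" using conj_sum[OF p, of "{..<k}" b "\<lambda>_. 1"] b by auto
    have "(\<lambda>m. \<Sum>i. b i m) = (\<lambda>m. (\<Sum>i. b (i + k) m) + (\<Sum>i<k. 1 * b i m))"
      using suminf_split_initial_segment[OF s] by simp
    then have "syn (\<lambda>m. \<Sum>i. b i m) = syn (\<lambda>m. \<Sum>i. b (i + k) m) + (\<Sum>i<k. syn (b i))"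
      using syn_add[OF t(1) i] syn_sum[of "{..<k}" b "\<lambda>_. 1"] b by simp
    then have "norm ((\<Sum>i<k. syn (b i)) - syn (\<lambda>m. \<Sum>i. b i m)) = norm (syn (\<lambda>m. \<Sum>i. b (i + k) m))"
      by simp
    also have "\<dots> \<le> NZ (\<lambda>m. \<Sum>i. b (i + k) m) * W" by (rule syn_norm[OF t(1)])
    also have "\<dots> \<le> (\<Sum>i. K (i + k)) * W" by (rule mult_right_mono[OF t(2) W_nonneg])
    also have "(\<Sum>i. K (i + k)) = (\<Sum>i. K i) - (\<Sum>i<k. K i)"
      using suminf_split_initial_segment[OF K, of k] by simp
    finally show "norm ((\<Sum>i<k. syn (b i)) - syn (\<lambda>m. \<Sum>i. b i m)) \<le> ((\<Sum>i. K i) - (\<Sum>i<k. K i)) * W" .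
  qed
qed

text \<open>Preimages of the values of \<open>F\<close> at the nodes are combined with the
  coefficients of \<open>disc_functional\<close> into an absolutely convergent series in
  \<open>Z\<close>. Functionals serve only to identify the image of its sum. The constant 2 is the
  sum of the powers of 1/2.\<close>

lemma disc_representation:
  assumes F: "\<And>\<zeta>. cmod \<zeta> < 1 \<Longrightarrow> \<exists>a\<in>Z. syn a = F \<zeta> \<and> NZ a \<le> K" and K: "0 \<le> K"
    and hol: "\<And>\<psi>. \<psi> \<in> dual_ball type_space \<Longrightarrow> (\<lambda>\<zeta>. \<psi> (F \<zeta>)) holomorphic_on ball 0 1"
    and \<mu>: "\<And>k. cmod (\<mu> k) \<le> (1/8) * (1/2) ^ k"
  shows "\<exists>b\<in>Z. NZ b \<le> 2 * K \<and> (\<forall>\<psi>\<in>dual_ball type_space.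
      \<psi> (syn b) = (\<Sum>k. \<mu> k * ((deriv ^^ k) (\<lambda>\<zeta>. \<psi> (F \<zeta>)) 0 / fact k)))"
proof -
  obtain n :: "nat \<Rightarrow> nat" and \<alpha> z :: "nat \<Rightarrow> nat \<Rightarrow> complex"
    where \<alpha>: "\<forall>i. (\<Sum>j<n i. cmod (\<alpha> i j)) \<le> (1/2) ^ i" and z: "\<forall>i j. cmod (z i j) < 1"
    and rep: "\<forall>c B. (\<forall>k. cmod (c k) \<le> B) \<longrightarrow>
      (\<lambda>i. \<Sum>j<n i. \<alpha> i j * (\<Sum>k. c k * z i j ^ k)) sums (\<Sum>k. \<mu> k * c k)"
    by (rule disc_functional[OF \<mu>])
  \<comment> \<open>The preimages are chosen pointwise, without any regularity in \<zeta>; only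
    their norm bound enters.\<close>
  have "\<exists>a. \<forall>\<zeta>. cmod \<zeta> < 1 \<longrightarrow> a \<zeta> \<in> Z \<and> syn (a \<zeta>) = F \<zeta> \<and> NZ (a \<zeta>) \<le> K"
    by (intro choice allI) (use F in blast)
  then obtain a where a: "\<And>\<zeta>. cmod \<zeta> < 1 \<Longrightarrow> a \<zeta> \<in> Z" "\<And>\<zeta>. cmod \<zeta> < 1 \<Longrightarrow> syn (a \<zeta>) = F \<zeta>"
    "\<And>\<zeta>. cmod \<zeta> < 1 \<Longrightarrow> NZ (a \<zeta>) \<le> K"
    by blast
  define b where "b i = (\<lambda>m. \<Sum>j<n i. \<alpha> i j * a (z i j) m)" for i
  have bZ: "b i \<in> Z" and bsyn: "syn (b i) = (\<Sum>j<n i. \<alpha> i j *\<^sub>C F (z i j))" for i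
    using conj_sum[OF p, of "{..<n i}" "\<lambda>j. a (z i j)" "\<alpha> i"]
      syn_sum[of "{..<n i}" "\<lambda>j. a (z i j)" "\<alpha> i"] a z by (auto simp: b_def)
  have bn: "NZ (b i) \<le> (1/2) ^ i * K" for i
  proof -
    have "NZ (b i) \<le> (\<Sum>j<n i. cmod (\<alpha> i j) * NZ (a (z i j)))"
      using conj_sum[OF p, of "{..<n i}" "\<lambda>j. a (z i j)" "\<alpha> i"] a z by (auto simp: b_def)
    also have "\<dots> \<le> (\<Sum>j<n i. cmod (\<alpha> i j)) * K"
      unfolding sum_distrib_right using a z by (intro sum_mono mult_left_mono) auto
    also have "\<dots> \<le> (1/2) ^ i * K" using \<alpha> K by (intro mult_right_mono) auto
    finally show ?thesis .
  qed
  have gs: "(\<lambda>i. (1/2::real) ^ i * K) sums (2 * K)"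
    using sums_mult2[OF geometric_sums[of "1/2 :: real"], of K] by simp
  show ?thesis
  proof (intro bexI[of _ "\<lambda>m. \<Sum>i. b i m"] conjI ballI)
    show Zb: "(\<lambda>m. \<Sum>i. b i m) \<in> Z" "NZ (\<lambda>m. \<Sum>i. b i m) \<le> 2 * K"
      using conj_suminf[OF p bZ bn sums_summable[OF gs]] sums_unique[OF gs] by auto
    fix \<psi> :: "'f \<Rightarrow> complex" assume \<psi>: "\<psi> \<in> dual_ball type_space"
    define c where "c k = (deriv ^^ k) (\<lambda>\<zeta>. \<psi> (F \<zeta>)) 0 / fact k" for k
    have "cmod (\<psi> (F \<zeta>)) \<le> K * W" if "cmod \<zeta> < 1" for \<zeta>
    proof -
      have "cmod (\<psi> (F \<zeta>)) \<le> norm (F \<zeta>)"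
        using cnormed.dual_ball_le_norm[OF cnormed_type_space \<psi>, of "F \<zeta>"] by simp
      also have "\<dots> \<le> NZ (a \<zeta>) * W" using syn_norm[OF a(1)[OF that]] a(2)[OF that] by simp
      also have "\<dots> \<le> K * W" using a(3)[OF that] W_nonneg by (rule mult_right_mono)
      finally show ?thesis .
    qed
    then have cb: "cmod (c k) \<le> K * W" for k
      unfolding c_def by (intro taylor_coeff_bound hol \<psi>)
    have ser: "(\<Sum>k. c k * \<zeta> ^ k) = \<psi> (F \<zeta>)" if "cmod \<zeta> < 1" for \<zeta>
      using holomorphic_power_series[OF hol[OF \<psi>], of \<zeta>] that by (simp add: c_def sums_iff)
    have lin: "linear \<psi>" using dual_ball_type_space(1)[OF \<psi>] by (rule bounded_linear.linear)
    have "(\<lambda>i. \<psi> (syn (b i))) sums \<psi> (syn (\<lambda>m. \<Sum>i. b i m))"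
      by (rule bounded_linear.sums[OF dual_ball_type_space(1)[OF \<psi>] syn_suminf[OF bZ bn sums_summable[OF gs]]])
    moreover have "\<psi> (syn (b i)) = (\<Sum>j<n i. \<alpha> i j * (\<Sum>k. c k * z i j ^ k))" for i
      by (simp add: bsyn linear_sum[OF lin] dual_ball_type_space(2)[OF \<psi>] ser z)
    ultimately have s: "(\<lambda>i. \<Sum>j<n i. \<alpha> i j * (\<Sum>k. c k * z i j ^ k)) sums \<psi> (syn (\<lambda>m. \<Sum>i. b i m))" by simp
    have "(\<lambda>i. \<Sum>j<n i. \<alpha> i j * (\<Sum>k. c k * z i j ^ k)) sums (\<Sum>k. \<mu> k * c k)"
      using rep cb by blast
    from sums_unique2[OF s this]
    show "\<psi> (syn (\<lambda>m. \<Sum>i. b i m)) = (\<Sum>k. \<mu> k * ((deriv ^^ k) (\<lambda>\<zeta>. \<psi> (F \<zeta>)) 0 / fact k))"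
      by (simp add: c_def)
  qed
qed

end

section \<open>Derivatives and Taylor remainders in the range of the synthesis operator\<close>

lemma holomorphic_along_line:
  fixes f :: "'e::complex_banach \<Rightarrow> 'f::complex_banach"
  assumes D: "\<And>y. y \<in> ball x R \<Longrightarrow> (f has_derivative D y) (at y) \<and> (\<forall>c h. D y (c *\<^sub>C h) = c *\<^sub>C D y h)"
    and \<psi>: "\<psi> \<in> dual_ball type_space" and u: "norm u \<le> R" "0 < R"
  shows "(\<lambda>\<zeta>. \<psi> (f (x + \<zeta> *\<^sub>C u))) holomorphic_on ball 0 1"
    "deriv (\<lambda>\<zeta>. \<psi> (f (x + \<zeta> *\<^sub>C u))) 0 = \<psi> (D x u)"
proof -
  have d: "((\<lambda>\<zeta>. \<psi> (f (x + \<zeta> *\<^sub>C u))) has_field_derivative \<psi> (D (x + \<zeta> *\<^sub>C u) u)) (at \<zeta>)" if "cmod \<zeta> < 1" for \<zeta>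
  proof -
    have "norm (\<zeta> *\<^sub>C u) < R"
    proof (cases "u = 0")
      case False
      then have "cmod \<zeta> * norm u < 1 * norm u" using that by (intro mult_strict_right_mono) auto
      then show ?thesis using u by (simp add: norm_scaleC)
    qed (use u in \<open>simp add: norm_scaleC\<close>)
    then have y: "x + \<zeta> *\<^sub>C u \<in> ball x R" by (simp add: dist_norm)
    have 1: "((\<lambda>\<zeta>. x + \<zeta> *\<^sub>C u) has_derivative (\<lambda>t. t *\<^sub>C u)) (at \<zeta>)"
      using bounded_linear_imp_has_derivative[OF bounded_linear_scaleC_left[of u]] by (intro derivative_eq_intros) auto
    have 2: "((\<lambda>\<zeta>. f (x + \<zeta> *\<^sub>C u)) has_derivative (\<lambda>t. D (x + \<zeta> *\<^sub>C u) (t *\<^sub>C u))) (at \<zeta>)"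
      by (rule has_derivative_compose[OF 1]) (use D[OF y] in simp)
    have "((\<lambda>\<zeta>. \<psi> (f (x + \<zeta> *\<^sub>C u))) has_derivative (\<lambda>t. \<psi> (D (x + \<zeta> *\<^sub>C u) (t *\<^sub>C u)))) (at \<zeta>)"
      by (rule bounded_linear.has_derivative[OF dual_ball_type_space(1)[OF \<psi>] 2])
    moreover have "(\<lambda>t. \<psi> (D (x + \<zeta> *\<^sub>C u) (t *\<^sub>C u))) = (*) (\<psi> (D (x + \<zeta> *\<^sub>C u) u))"
      using D[OF y] by (simp add: fun_eq_iff dual_ball_type_space(2)[OF \<psi>])
    ultimately show ?thesis by (simp add: has_field_derivative_def)
  qed
  show "(\<lambda>\<zeta>. \<psi> (f (x + \<zeta> *\<^sub>C u))) holomorphic_on ball 0 1"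
    unfolding holomorphic_on_open[OF open_ball]
  proof
    fix w :: complex assume "w \<in> ball 0 1"
    then have "cmod w < 1" by simp
    then show "\<exists>f'. ((\<lambda>\<zeta>. \<psi> (f (x + \<zeta> *\<^sub>C u))) has_field_derivative f') (at w)"
      using d[of w] by blast
  qed
  show "deriv (\<lambda>\<zeta>. \<psi> (f (x + \<zeta> *\<^sub>C u))) 0 = \<psi> (D x u)"
    using DERIV_imp_deriv[OF d[of 0]] by simp
qed

context synthesis
begin

text \<open>On the complex line through \<open>x\<close> in the direction \<open>h\<close>, rescaled
  so that the unit disc maps into the ball of radius \<open>R\<close>, the derivative and the
  first-order remainder are functionals of the Taylor coefficients with geometric weights. Preimages
  of controlled norm thus come from \<open>disc_representation\<close>.\<close>

lemma taylor_representation: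
  fixes f :: "'e::complex_banach \<Rightarrow> 'f"
  assumes D: "\<And>y. y \<in> ball x R \<Longrightarrow> (f has_derivative D y) (at y) \<and> (\<forall>c h. D y (c *\<^sub>C h) = c *\<^sub>C D y h)"
    and rep: "\<And>y. y \<in> ball x R \<Longrightarrow> \<exists>a\<in>Z. syn a = f y \<and> NZ a \<le> K" and R: "0 < R" and K: "0 \<le> K"
  shows "(\<exists>b\<in>Z. syn b = D x h \<and> NZ b \<le> 32 * K / R * norm h) \<and>
      (norm h \<le> R / 2 \<longrightarrow> (\<exists>b\<in>Z. syn b = f (x + h) - f x - D x h \<and> NZ b \<le> 64 * K / R\<^sup>2 * (norm h)\<^sup>2))"
proof -
  have zero: "(\<lambda>n. 0) \<in> Z" "NZ (\<lambda>n. 0) = 0"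
    using conj_zero[OF p] cnormed.norm_zero[OF cnormed_conj_seq_space[OF p]] by auto
  have x: "x \<in> ball x R" using R by simp
  have linD: "linear (D x)" "D x (c *\<^sub>C k) = c *\<^sub>C D x k" for c k
    using D[OF x] has_derivative_linear by blast+
  \<comment> \<open>The direction of \<open>h\<close> stretched to length \<open>R\<close>; the
    increment \<open>h\<close> is then reached at the parameter \<zeta>.\<close>
  define u where "u = of_real (R / norm h) *\<^sub>C h"
  define \<zeta> where "\<zeta> = (of_real (norm h / R) :: complex)"
  show ?thesis
  proof (cases "h = 0")
    case True
    then show ?thesis
      using zero syn_zero linear_0[OF linD(1)] by (auto intro!: bexI[of _ "\<lambda>n. 0"])
  next
    case False
    have u: "norm u \<le> R" using R False by (simp add: u_def norm_scaleC norm_divide)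
    have hu: "\<zeta> *\<^sub>C u = h" using R False by (simp add: u_def \<zeta>_def scaleC_scaleC flip: of_real_mult of_real_divide)
    have Dh: "D x h = \<zeta> *\<^sub>C D x u" using linD(2)[of \<zeta> u] by (simp add: hu)
    have nz: "cmod \<zeta> = norm h / R" using R by (simp add: \<zeta>_def norm_divide)
    define F where "F w = f (x + w *\<^sub>C u)" for w
    have F: "\<exists>a\<in>Z. syn a = F w \<and> NZ a \<le> K" if "cmod w < 1" for w
    proof -
      have "cmod w * norm u < R"
      proof (cases "u = 0")
        case False
        then have "cmod w * norm u < 1 * norm u" using that by (intro mult_strict_right_mono) auto
        then show ?thesis using u by simp
      qed (use R in simp)
      then show ?thesis unfolding F_def by (intro rep) (simp add: dist_norm norm_scaleC)
    qed
    have hol: "(\<lambda>w. \<psi> (F w)) holomorphic_on ball 0 1" "deriv (\<lambda>w. \<psi> (F w)) 0 = \<psi> (D x u)"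
      if "\<psi> \<in> dual_ball type_space" for \<psi>
      unfolding F_def
      by (rule holomorphic_along_line[where D = D and f = f and x = x, OF D that u R], assumption)+
    have 1: "\<exists>b\<in>Z. syn b = D x h \<and> NZ b \<le> 32 * K / R * norm h"
    proof -
      \<comment> \<open>1/16 is the largest weight that \<open>disc_representation\<close> admits in
        degree 1. Undoing it costs 16, and with the bound 2 K this gives the constant 32.\<close>
      define \<mu> where "\<mu> k = (if k = 1 then 1/16 else 0 :: complex)" for k :: nat
      have \<mu>: "cmod (\<mu> k) \<le> (1/8) * (1/2) ^ k" for k by (simp add: \<mu>_def)
      obtain b where b: "b \<in> Z" "NZ b \<le> 2 * K"
        "\<forall>\<psi>\<in>dual_ball type_space.
          \<psi> (syn b) = (\<Sum>k. \<mu> k * ((deriv ^^ k) (\<lambda>w. \<psi> (F w)) 0 / fact k))"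
        using disc_representation[of F K \<mu>, OF F K hol(1) \<mu>] by blast
      have "\<psi> (syn (\<lambda>n. (16 * \<zeta>) * b n)) = \<psi> (D x h)" if \<psi>: "\<psi> \<in> dual_ball type_space" for \<psi>
      proof -
        have "\<psi> (syn b) = \<mu> 1 * ((deriv ^^ 1) (\<lambda>w. \<psi> (F w)) 0 / fact 1)"
          unfolding b(3)[rule_format, OF \<psi>] by (subst suminf_finite[of "{1}"]) (auto simp: \<mu>_def)
        then have "16 * \<psi> (syn b) = \<psi> (D x u)" using hol(2)[OF \<psi>] by (simp add: \<mu>_def mult.commute)
        then show ?thesis
          using b(1) by (simp add: Dh syn_scale dual_ball_type_space(2)[OF \<psi>])
      qed
      then have "syn (\<lambda>n. (16 * \<zeta>) * b n) = D x h" by (rule dual_ball_separates)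
      moreover have "NZ (\<lambda>n. (16 * \<zeta>) * b n) \<le> 32 * K / R * norm h"
        unfolding conj_scale(2)[OF p b(1)]
        using mult_left_mono[OF b(2), of "16 * (norm h / R)"] R by (simp add: norm_mult nz mult_ac)
      ultimately show ?thesis using conj_scale(1)[OF p b(1)] by blast
    qed
    have 2: "\<exists>b\<in>Z. syn b = f (x + h) - f x - D x h \<and> NZ b \<le> 64 * K / R\<^sup>2 * (norm h)\<^sup>2" if h: "norm h \<le> R / 2"
    proof -
      have z12: "cmod \<zeta> \<le> 1/2" using h R by (simp add: nz field_simps)
      \<comment> \<open>The remainder is \<zeta>^2 times the sum over k \<ge> 2 of c_k
        \<zeta>^(k-2). For |\<zeta>| \<le> 1/2, division by 32 fits these weights under
        (1/8)(1/2)^k; undoing it gives the constant 64, and the extracted \<zeta>^2 gives the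
        quadratic bound.\<close>
      define \<mu> where "\<mu> k = (if k < 2 then 0 else \<zeta> ^ (k - 2) / 32)" for k :: nat
      have \<mu>: "cmod (\<mu> k) \<le> (1/8) * (1/2) ^ k" for k
      proof (cases "k < 2")
        case False
        then obtain l where l: "k = l + 2" by (metis add.commute le_Suc_ex not_less)
        have "cmod \<zeta> ^ l \<le> (1/2) ^ l" using z12 by (intro power_mono) auto
        then show ?thesis by (simp add: \<mu>_def l norm_divide norm_power)
      qed (simp add: \<mu>_def)
      obtain b where b: "b \<in> Z" "NZ b \<le> 2 * K"
        "\<forall>\<psi>\<in>dual_ball type_space.
          \<psi> (syn b) = (\<Sum>k. \<mu> k * ((deriv ^^ k) (\<lambda>w. \<psi> (F w)) 0 / fact k))"
        using disc_representation[of F K \<mu>, OF F K hol(1) \<mu>] by blast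
      have "\<psi> (syn (\<lambda>n. (32 * \<zeta>\<^sup>2) * b n)) = \<psi> (f (x + h) - f x - D x h)" if \<psi>: "\<psi> \<in> dual_ball type_space" for \<psi>
      proof -
        define c where "c k = (deriv ^^ k) (\<lambda>w. \<psi> (F w)) 0 / fact k" for k
        have lin: "linear \<psi>" using dual_ball_type_space(1)[OF \<psi>] by (rule bounded_linear.linear)
        have "(\<lambda>k. c k * \<zeta> ^ k) sums \<psi> (F \<zeta>)"
          using holomorphic_power_series[OF hol(1)[OF \<psi>], of \<zeta>] z12 by (simp add: c_def F_def)
        then have "(\<lambda>k. c k * \<zeta> ^ k - (if k \<in> {..<2} then c k * \<zeta> ^ k else 0)) sums (\<psi> (F \<zeta>) - (\<Sum>k<2. c k * \<zeta> ^ k))"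
          by (intro sums_diff sums_If_finite_set) auto
        also have "(\<lambda>k. c k * \<zeta> ^ k - (if k \<in> {..<2} then c k * \<zeta> ^ k else 0)) = (\<lambda>k. 32 * \<zeta>\<^sup>2 * (\<mu> k * c k))"
        proof
          fix k
          show "c k * \<zeta> ^ k - (if k \<in> {..<2} then c k * \<zeta> ^ k else 0) = 32 * \<zeta>\<^sup>2 * (\<mu> k * c k)"
          proof (cases "k < 2")
            case False
            then obtain l where "k = l + 2" by (metis add.commute le_Suc_ex not_less)
            then show ?thesis by (simp add: \<mu>_def power_add power2_eq_square)
          qed (simp add: \<mu>_def)
        qed
        finally have S: "(\<lambda>k. 32 * \<zeta>\<^sup>2 * (\<mu> k * c k)) sums (\<psi> (F \<zeta>) - (\<Sum>k<2. c k * \<zeta> ^ k))" .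
        have cnz: "32 * \<zeta>\<^sup>2 \<noteq> 0" using False R by (simp add: \<zeta>_def)
        have "summable (\<lambda>k. \<mu> k * c k)" by (rule summable_mult_D[OF sums_summable[OF S] cnz])
        then have "32 * \<zeta>\<^sup>2 * (\<Sum>k. \<mu> k * c k) = \<psi> (F \<zeta>) - (\<Sum>k<2. c k * \<zeta> ^ k)"
          by (rule suminf_mult[symmetric, THEN trans, OF _ sums_unique[OF S, symmetric]])
        moreover have "(\<Sum>k<2. c k * \<zeta> ^ k) = \<psi> (f x) + \<zeta> * \<psi> (D x u)"
          using hol(2)[OF \<psi>] by (simp add: numeral_2_eq_2 c_def F_def)
        moreover have "\<zeta> * \<psi> (D x u) = \<psi> (D x h)"
          by (simp add: Dh dual_ball_type_space(2)[OF \<psi>])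
        ultimately have "32 * \<zeta>\<^sup>2 * (\<Sum>k. \<mu> k * c k) = \<psi> (f (x + h) - f x - D x h)"
          using hu by (simp add: F_def linear_diff[OF lin])
        then show ?thesis
          using b(1) b(3)[rule_format, OF \<psi>] by (simp add: syn_scale dual_ball_type_space(2)[OF \<psi>] c_def)
      qed
      then have "syn (\<lambda>n. (32 * \<zeta>\<^sup>2) * b n) = f (x + h) - f x - D x h" by (rule dual_ball_separates)
      moreover have "NZ (\<lambda>n. (32 * \<zeta>\<^sup>2) * b n) \<le> 64 * K / R\<^sup>2 * (norm h)\<^sup>2"
      proof -
        have "32 * (norm h / R)\<^sup>2 * NZ b \<le> 32 * (norm h / R)\<^sup>2 * (2 * K)"
          using b(2) by (intro mult_left_mono) auto
        also have "\<dots> \<le> 64 * K / R\<^sup>2 * (norm h)\<^sup>2" using K by (simp add: power_divide divide_right_mono mult_right_mono)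
        finally show ?thesis
          unfolding conj_scale(2)[OF p b(1)] by (simp add: norm_mult nz norm_power)
      qed
      ultimately show ?thesis using conj_scale(1)[OF p b(1)] by blast
    qed
    show ?thesis
      using 1 2 by blast
  qed
qed

end

section \<open>Sizes of relatively compact sets\<close>

context cnormed
begin

lemma size_le:
  assumes "0 < p" "x \<in> gen_seqs I p X" "A \<subseteq> p_conv p X x"
  shows "compactness_size I p X A \<le> gen_norm I p X x"
  unfolding compactness_size_def
  using assms gen_norm_nonneg[OF assms(1)] by (intro cInf_lower bdd_belowI[where m = 0]) auto

lemma size_approx:
  assumes "relatively_compact I p X A" "0 < e"
  obtains x where "x \<in> gen_seqs I p X" "A \<subseteq> p_conv p X x" "gen_norm I p X x < compactness_size I p X A + e"
proof -
  let ?S = "{gen_norm I p X x | x. x \<in> gen_seqs I p X \<and> A \<subseteq> p_conv p X x}"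
  have "?S \<noteq> {}" using assms(1) by (auto simp: relatively_compact_def)
  moreover have "Inf ?S < compactness_size I p X A + e" using assms(2) by (simp add: compactness_size_def)
  ultimately have "\<exists>r\<in>?S. r < compactness_size I p X A + e" by (rule cInf_lessD)
  then show ?thesis using that by auto
qed

text \<open>Relative compactness keeps the infimum from being taken over the empty set.\<close>

lemma size_nonneg: "0 < p \<Longrightarrow> relatively_compact I p X A \<Longrightarrow> 0 \<le> compactness_size I p X A"
  unfolding compactness_size_def
  by (rule cInf_greatest) (auto simp: relatively_compact_def gen_norm_nonneg)

end

lemma p_conv_scale:
  fixes x :: "nat \<Rightarrow> 'a::complex_banach"
  assumes "s \<in> p_conv p type_space x"
  shows "c *\<^sub>C s \<in> p_conv p type_space (\<lambda>n. c *\<^sub>C x n)"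
proof -
  obtain a where a: "a \<in> cs_ball (conj_seq_space p)" "(\<lambda>n. a n *\<^sub>C x n) sums s"
    using assms by (auto simp: p_conv_def cs_sums_type_space)
  have "(\<lambda>n. a n *\<^sub>C c *\<^sub>C x n) sums (c *\<^sub>C s)"
    using bounded_linear.sums[OF bounded_linear_scaleC[of c] a(2)] by (simp add: scaleC_scaleC mult.commute)
  then show ?thesis using a(1) by (auto simp: p_conv_def cs_sums_type_space)
qed

section \<open>From factorizations to compact ranges\<close>

lemma factorization_size:
  fixes f :: "'e::complex_banach \<Rightarrow> 'f::complex_banach"
  assumes p: "1 \<le> p" and v: "\<And>x. x \<in> U \<Longrightarrow> 0 < v x"
    and G: "G \<in> conj_seq_quotients p" and S: "S \<in> ideal_operators I p G type_space"
    and g: "g \<in> H_ideal (inner_ideal I) p U v G" and fg: "\<And>x. x \<in> U \<Longrightarrow> f x = S (g x)"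
  shows "relatively_compact I p type_space (weighted_range U v type_space f)"
    "H_ideal_norm I p U v type_space f \<le> ideal_norm I p G type_space S * H_ideal_norm (inner_ideal I) p U v G g"
proof -
  obtain M where M: "closed_subspace (conj_seq_space p) M" "G = quotient_cspace (conj_seq_space p) M"
    using G by (auto simp: conj_seq_quotients_def)
  interpret q: seq_quotient p M using p M(1) by unfold_locales
  interpret G: cnormed G unfolding M(2) by (rule q.cnormed_quotient)
  interpret F: cnormed "type_space :: 'f cspace" by (rule cnormed_type_space)
  have p0: "0 < p" using p by simp
  define J where "J = inner_ideal I"
  let ?f = "weighted_range U v type_space f" and ?g = "weighted_range U v G g"
  have Sop: "\<And>c A. A \<in> cs_carrier G \<Longrightarrow> S (cs_scale G c A) = c *\<^sub>C S A"
    and Src: "relatively_compact I p type_space (S ` cs_ball G)"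
    using S by (auto simp: ideal_operators_def bounded_operator_def)
  have gC: "\<And>x. x \<in> U \<Longrightarrow> g x \<in> cs_carrier G" and grc: "relatively_compact J p G ?g"
    using g by (auto simp: H_ideal_def H_weighted_def holomorphic_into_def J_def)
  \<comment> \<open>\<open>inner_ideal\<close> never yields \<open>Kp\<close>, so \<open>g\<close>
    is always measured by the weak norm, the one that bounds hulls.\<close>
  have JW: "gen_norm J p G y = weak_norm p G y" for y by (cases I) (simp_all add: J_def)
  have sub: "?f \<subseteq> p_conv p type_space (\<lambda>n. of_real c *\<^sub>C x n)"
    if x: "S ` cs_ball G \<subseteq> p_conv p type_space x" and y: "y \<in> gen_seqs J p G" "?g \<subseteq> p_conv p G y"
      and c: "gen_norm J p G y \<le> c" "0 < c" for x y c
  proof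
    fix w assume "w \<in> ?f"
    then obtain u where u: "u \<in> U" "w = of_real (v u) *\<^sub>C f u" by (auto simp: weighted_range_def)
    define A where "A = cs_scale G (of_real (v u)) (g u)"
    have "A \<in> p_conv p G y" using y(2) u(1) by (auto simp: A_def weighted_range_def)
    from G.p_conv_norm_le[OF p G.gen_imp_weak(1)[OF p0 y(1)] this]
    have A: "A \<in> cs_carrier G" "cs_norm G A \<le> c" using c(1) by (simp_all add: JW)
    have "cs_scale G (of_real (1/c)) A \<in> cs_ball G"
      using A c(2) by (simp add: cs_ball_def G.norm_scale norm_divide)
    then have "of_real c *\<^sub>C S (cs_scale G (of_real (1/c)) A) \<in> p_conv p type_space (\<lambda>n. of_real c *\<^sub>C x n)"
      using x by (intro p_conv_scale) blast
    moreover have "of_real c *\<^sub>C S (cs_scale G (of_real (1/c)) A) = S A"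
      using A(1) c(2) by (simp add: Sop scaleC_scaleC)
    moreover have "S A = w" using u gC[OF u(1)] fg[OF u(1)] by (simp add: A_def Sop)
    ultimately show "w \<in> p_conv p type_space (\<lambda>n. of_real c *\<^sub>C x n)" by simp
  qed
  let ?s = "ideal_norm I p G type_space S" and ?t = "H_ideal_norm J p U v G g"
  have *: "relatively_compact I p type_space ?f \<and> H_ideal_norm I p U v type_space f \<le> (?s + e) * (?t + 2 * e)"
    if e: "0 < e" for e
  proof -
    obtain x where x: "x \<in> gen_seqs I p type_space" "S ` cs_ball G \<subseteq> p_conv p type_space x"
      "gen_norm I p type_space x < ?s + e"
      using F.size_approx[OF Src e] by (auto simp: ideal_norm_def)
    obtain y where y: "y \<in> gen_seqs J p G" "?g \<subseteq> p_conv p G y" "gen_norm J p G y < ?t + e"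
      using G.size_approx[OF grc e] by (auto simp: H_ideal_norm_def)
    \<comment> \<open>The extra \<open>e\<close> makes the radius positive, so that dividing by it
      is possible even when the norm of \<open>y\<close> is 0.\<close>
    define c where "c = gen_norm J p G y + e"
    have y0: "0 \<le> gen_norm J p G y" by (rule G.gen_norm_nonneg[OF p0 y(1)])
    have c: "gen_norm J p G y \<le> c" "0 < c" using y0 e by (auto simp: c_def)
    note s = sub[OF x(2) y(1,2) c]
    have x': "(\<lambda>n. of_real c *\<^sub>C x n) \<in> gen_seqs I p type_space"
      "gen_norm I p type_space (\<lambda>n. of_real c *\<^sub>C x n) \<le> c * gen_norm I p type_space x"
      using F.gen_scale[OF p0 x(1), of c] c(2) by auto
    have "H_ideal_norm I p U v type_space f \<le> c * gen_norm I p type_space x"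
      using F.size_le[OF p0 x'(1) s] x'(2) by (simp add: H_ideal_norm_def)
    also have "\<dots> \<le> (?t + 2 * e) * (?s + e)"
      using x(3) y(3) y0 e F.gen_norm_nonneg[OF p0 x(1)] by (intro mult_mono) (auto simp: c_def)
    finally have "H_ideal_norm I p U v type_space f \<le> (?s + e) * (?t + 2 * e)" by (simp add: mult.commute)
    then show ?thesis using x'(1) s by (auto simp: relatively_compact_def)
  qed
  show "relatively_compact I p type_space ?f" using *[of 1] by simp
  have "((\<lambda>e. (?s + e) * (?t + 2 * e)) \<longlongrightarrow> (?s + 0) * (?t + 2 * 0)) (at_right 0)"
    by (intro tendsto_intros)
  then have "H_ideal_norm I p U v type_space f \<le> (?s + 0) * (?t + 2 * 0)"
    by (rule tendsto_lowerbound) (use * in \<open>auto simp: eventually_at_right_less intro: eventually_mono[OF eventually_at_right_less]\<close>)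
  then show "H_ideal_norm I p U v type_space f \<le> ?s * H_ideal_norm (inner_ideal I) p U v G g"
    by (simp add: J_def)
qed

section \<open>Factoring through the quotient by the kernel\<close>

lemma scaleC_zero_right: "c *\<^sub>C (0 :: 'a::complex_banach) = 0"
  by (rule linear_0[OF bounded_linear.linear[OF bounded_linear_scaleC]])

context synthesis
begin

definition ker :: "(nat \<Rightarrow> complex) set"
  where "ker = {a \<in> Z. syn a = 0}"

lemma closed_ker: "closed_subspace (conj_seq_space p) ker"
  unfolding closed_subspace_def
proof (intro conjI ballI allI impI)
  fix a assume a: "a \<in> Z" and lim: "\<forall>\<epsilon>>0. \<exists>m\<in>ker. NZ (cs_diff (conj_seq_space p) a m) < \<epsilon>"
  have "norm (syn a) \<le> 0 + e" if e: "0 < e" for e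
  proof -
    \<comment> \<open>\<open>W + 1\<close> in place of \<open>W\<close> avoids division by 0 when
      \<open>Y\<close> has weak norm 0.\<close>
    have "0 < e / (W + 1)" using e W_nonneg by simp
    then obtain m where m: "m \<in> Z" "syn m = 0" "NZ (\<lambda>n. a n - m n) < e / (W + 1)"
      using lim by (auto simp: ker_def)
    have "norm (syn a) = norm (syn (\<lambda>n. a n - m n))" by (simp add: syn_diff[OF a m(1)] m(2))
    also have "\<dots> \<le> NZ (\<lambda>n. a n - m n) * W" by (rule syn_norm[OF syn_diff(1)[OF a m(1)]])
    also have "\<dots> \<le> e / (W + 1) * W" using m(3) W_nonneg by (intro mult_right_mono) auto
    also have "\<dots> \<le> e" using e W_nonneg by (simp add: field_simps)
    finally show ?thesis by simp
  qed
  then have "norm (syn a) \<le> 0" by (rule field_le_epsilon)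
  then show "a \<in> ker" using a by (simp add: ker_def)
qed (auto simp: ker_def conj_zero[OF p] syn_zero conj_add[OF p] syn_add conj_scale[OF p] syn_scale scaleC_zero_right)

sublocale seq_quotient p ker
  using p closed_ker by unfold_locales

text \<open>The inverse of the injection \<open>S\<close>, with a coset of the kernel written as a
  fibre of \<open>syn\<close>. Off the range of \<open>syn\<close> the fibre is empty and no element
  of the quotient, whence the range hypotheses below.\<close>

definition lift :: "'f \<Rightarrow> (nat \<Rightarrow> complex) set"
  where "lift y = {a \<in> Z. syn a = y}"

lemma syn_imageI: "a \<in> Z \<Longrightarrow> syn a = y \<Longrightarrow> y \<in> syn ` Z"
  by blast

lemma coset_eq_lift: "a \<in> Z \<Longrightarrow> coset a = lift (syn a)"
proof -
  assume a: "a \<in> Z"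
  have "b \<in> coset a \<longleftrightarrow> b \<in> lift (syn a)" for b
    using mem_coset_iff[OF a, of b] syn_diff[of b a] a by (auto simp: ker_def[symmetric] lift_def) (auto simp: ker_def)
  then show "coset a = lift (syn a)" by blast
qed

lemma lift_carrier: "y \<in> syn ` Z \<Longrightarrow> lift y \<in> cs_carrier Q"
  by (auto simp: Q_carrier simp flip: coset_eq_lift)

lemma lift_add:
  assumes "y \<in> syn ` Z" "z \<in> syn ` Z"
  shows "cs_add Q (lift y) (lift z) = lift (y + z)"
proof -
  obtain a b where ab: "a \<in> Z" "y = syn a" "b \<in> Z" "z = syn b" using assms by auto
  show ?thesis
    using Q_add[OF ab(1,3)] coset_eq_lift[OF ab(1)] coset_eq_lift[OF ab(3)]
      coset_eq_lift[OF conj_add(1)[OF p ab(1,3)]] syn_add[OF ab(1,3)] ab by simp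
qed

lemma lift_scale:
  assumes "y \<in> syn ` Z"
  shows "cs_scale Q c (lift y) = lift (c *\<^sub>C y)"
proof -
  obtain a where a: "a \<in> Z" "y = syn a" using assms by auto
  show ?thesis
    using Q_scale[OF a(1)] coset_eq_lift[OF a(1)] coset_eq_lift[OF conj_scale(1)[OF p a(1)]] syn_scale[OF a(1)] a
    by simp
qed

lemma lift_diff:
  assumes "y \<in> syn ` Z" "z \<in> syn ` Z"
  shows "cs_diff Q (lift y) (lift z) = lift (y - z)" "y - z \<in> syn ` Z"
proof -
  obtain a b where ab: "a \<in> Z" "y = syn a" "b \<in> Z" "z = syn b" using assms by auto
  show "cs_diff Q (lift y) (lift z) = lift (y - z)"
    using Q_diff[OF ab(1,3)] coset_eq_lift[OF ab(1)] coset_eq_lift[OF ab(3)]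
      coset_eq_lift[OF syn_diff(1)[OF ab(1,3)]] syn_diff(2)[OF ab(1,3)] ab by simp
  show "y - z \<in> syn ` Z" using syn_diff[OF ab(1,3)] ab by (intro syn_imageI) auto
qed

lemma lift_norm: "a \<in> Z \<Longrightarrow> cs_norm Q (lift (syn a)) \<le> NZ a"
  using Q_norm_le[OF _ self_coset, of a] by (simp flip: coset_eq_lift)

text \<open>\<open>syn\<close> is constant on each fibre, so the chosen representative does not
  affect the value on the carrier.\<close>

definition quotient_op :: "(nat \<Rightarrow> complex) set \<Rightarrow> 'f"
  where "quotient_op A = syn (SOME a. a \<in> A)"

lemma quotient_op_lift:
  assumes "y \<in> syn ` Z"
  shows "quotient_op (lift y) = y"
proof -
  have "\<exists>a. a \<in> lift y" using assms by (auto simp: lift_def)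
  then have "(SOME a. a \<in> lift y) \<in> lift y" by (rule someI_ex)
  then show ?thesis by (simp add: quotient_op_def lift_def)
qed

lemma Q_carrier_lift: "A \<in> cs_carrier Q \<Longrightarrow> \<exists>y\<in>syn ` Z. A = lift y"
  by (auto simp: Q_carrier coset_eq_lift)

lemma bounded_quotient_op: "bounded_operator Q type_space quotient_op"
  unfolding bounded_operator_def
proof (intro conjI ballI allI exI[of _ W])
  fix A B c assume A: "A \<in> cs_carrier Q"
  obtain y where y: "y \<in> syn ` Z" "A = lift y" using Q_carrier_lift[OF A] by blast
  obtain a where a: "a \<in> Z" "y = syn a" using y by blast
  show "quotient_op A \<in> cs_carrier type_space" by simp
  have "c *\<^sub>C y \<in> syn ` Z" using conj_scale(1)[OF p a(1)] a by (auto simp: image_iff syn_scale intro!: bexI[of _ "\<lambda>n. c * a n"])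
  then show "quotient_op (cs_scale Q c A) = cs_scale type_space c (quotient_op A)"
    using y by (simp add: lift_scale quotient_op_lift)
  have *: "norm y \<le> NZ b * W" if "b \<in> coset a" for b
    using that syn_norm[of b] a by (simp add: coset_eq_lift lift_def)
  show "cs_norm type_space (quotient_op A) \<le> W * cs_norm Q A"
  proof (cases "W = 0")
    case True
    then show ?thesis using *[OF self_coset[OF a(1)]] y by (simp add: quotient_op_lift)
  next
    case False
    then have W: "0 < W" using W_nonneg by simp
    have "norm y / W \<le> cs_norm Q (coset a)"
      using * W a(1) by (intro le_Q_norm) (auto simp: field_simps)
    then show ?thesis using W y a by (simp add: quotient_op_lift coset_eq_lift field_simps)
  qed
  assume B: "B \<in> cs_carrier Q"
  obtain z where z: "z \<in> syn ` Z" "B = lift z" using Q_carrier_lift[OF B] by blast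
  obtain b where b: "b \<in> Z" "z = syn b" using z by blast
  have "y + z \<in> syn ` Z" using conj_add(1)[OF p a(1) b(1)] a b
    by (auto simp: image_iff syn_add intro!: bexI[of _ "\<lambda>n. a n + b n"])
  then show "quotient_op (cs_add Q A B) = cs_add type_space (quotient_op A) (quotient_op B)"
    using y z by (simp add: lift_add quotient_op_lift)
qed

text \<open>A coset of norm at most 1 has representatives of norm below 1 + \<epsilon>, though
  possibly none of norm at most 1; the generating sequence is enlarged accordingly.\<close>

lemma quotient_op_ideal:
  assumes Y': "Y \<in> gen_seqs I p type_space" and \<epsilon>: "0 < \<epsilon>"
  shows "quotient_op \<in> ideal_operators I p Q type_space"
    "ideal_norm I p Q type_space quotient_op \<le> (1 + \<epsilon>) * gen_norm I p type_space Y"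
proof -
  interpret F: cnormed "type_space :: 'f cspace" by (rule cnormed_type_space)
  have p0: "0 < p" using p by simp
  have sub: "quotient_op ` cs_ball Q \<subseteq> p_conv p type_space (\<lambda>n. of_real (1 + \<epsilon>) *\<^sub>C Y n)"
  proof
    fix w assume "w \<in> quotient_op ` cs_ball Q"
    then obtain a where a: "a \<in> Z" "cs_norm Q (coset a) \<le> 1" "w = quotient_op (coset a)"
      by (auto simp: cs_ball_def Q_carrier)
    have "cs_norm Q (coset a) < 1 + \<epsilon>" using a(2) \<epsilon> by simp
    then obtain b where b: "b \<in> coset a" "b \<in> Z" "NZ b < 1 + \<epsilon>" using Q_norm_approx[OF a(1)] by blast
    have w: "w = syn b"
      using a(1,3) b(1) quotient_op_lift[of "syn a"] by (simp add: coset_eq_lift) (simp add: lift_def)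
    define c where "c = 1 / (1 + \<epsilon>)"
    have c: "0 < c" "c * (1 + \<epsilon>) = 1" using \<epsilon> by (simp_all add: c_def)
    have "NZ (\<lambda>n. of_real c * b n) = c * NZ b"
      using conj_scale(2)[OF p b(2), of "of_real c"] c(1) by simp
    also have "\<dots> \<le> c * (1 + \<epsilon>)" using b(3) c(1) by (intro mult_left_mono) auto
    finally have cb: "(\<lambda>n. of_real c * b n) \<in> cs_ball (conj_seq_space p)"
      using conj_scale(1)[OF p b(2), of "of_real c"] c(2) by (simp add: cs_ball_def)
    have "(of_real c * b n) *\<^sub>C of_real (1 + \<epsilon>) *\<^sub>C Y n = b n *\<^sub>C Y n" for n
    proof -
      have "of_real c * b n * of_real (1 + \<epsilon>) = of_real (c * (1 + \<epsilon>)) * b n"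
        by (simp only: of_real_mult mult_ac)
      also have "\<dots> = b n" unfolding c(2) by simp
      finally show ?thesis by (simp only: scaleC_scaleC)
    qed
    then have "(\<lambda>n. (of_real c * b n) *\<^sub>C of_real (1 + \<epsilon>) *\<^sub>C Y n) sums w"
      using syn_sums[OF b(2)] by (simp only: w)
    then show "w \<in> p_conv p type_space (\<lambda>n. of_real (1 + \<epsilon>) *\<^sub>C Y n)"
      unfolding p_conv_def mem_Collect_eq cs_sums_type_space type_space_simps
      by (rule bexI[OF _ cb])
  qed
  have "0 \<le> 1 + \<epsilon>" using \<epsilon> by simp
  note s = F.gen_scale[OF p0 Y' this, unfolded type_space_simps]
  show "quotient_op \<in> ideal_operators I p Q type_space"
    unfolding ideal_operators_def relatively_compact_def using bounded_quotient_op s(1) sub by blast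
  show "ideal_norm I p Q type_space quotient_op \<le> (1 + \<epsilon>) * gen_norm I p type_space Y"
    unfolding ideal_norm_def using F.size_le[OF p0 s(1) sub] s(2) by (rule order_trans)
qed

section \<open>Holomorphy and compactness of the lifted mapping\<close>

text \<open>The derivative of the lift at \<open>x\<close> is the lift of the derivative of
  \<open>f\<close>, which lies in the range of \<open>syn\<close> by
  \<open>taylor_representation\<close>. The same lemma bounds the remainder in the quotient norm
  quadratically, hence differentiability in \<open>Q\<close>.\<close>

lemma lift_holomorphic:
  fixes f :: "'e::complex_banach \<Rightarrow> 'f"
  assumes hol: "holomorphic_into type_space U f" and U: "open U" and v: "weight U v"
    and rep: "\<And>x. x \<in> U \<Longrightarrow> \<exists>a\<in>Z. syn a = of_real (v x) *\<^sub>C f x \<and> NZ a \<le> 1"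
  shows "holomorphic_into Q U (\<lambda>x. lift (f x))"
proof -
  have v0: "0 < v x" if "x \<in> U" for x using v that by (simp add: weight_def)
  have rep': "\<exists>a\<in>Z. syn a = f x \<and> NZ a \<le> 1 / v x" if x: "x \<in> U" for x
  proof -
    obtain a where a: "a \<in> Z" "syn a = of_real (v x) *\<^sub>C f x" "NZ a \<le> 1" using rep[OF x] by blast
    have "syn (\<lambda>n. of_real (1 / v x) * a n) = f x"
      using v0[OF x] syn_scale[OF a(1), of "of_real (1 / v x)"] by (simp add: a(2) scaleC_scaleC)
    moreover have "NZ (\<lambda>n. of_real (1 / v x) * a n) \<le> 1 / v x"
      using v0[OF x] a(3) conj_scale(2)[OF p a(1), of "of_real (1 / v x)"]
      by (simp add: norm_divide divide_right_mono)
    ultimately show ?thesis using conj_scale(1)[OF p a(1)] by blast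
  qed
  have "\<forall>y\<in>U. \<exists>L. (f has_derivative L) (at y) \<and> (\<forall>c h. L (c *\<^sub>C h) = c *\<^sub>C L h)"
    using hol by (simp add: holomorphic_into_type_space)
  then obtain D where D: "\<forall>y\<in>U. (f has_derivative D y) (at y) \<and> (\<forall>c h. D y (c *\<^sub>C h) = c *\<^sub>C D y h)"
    using bchoice[of U "\<lambda>y L. (f has_derivative L) (at y) \<and> (\<forall>c h. L (c *\<^sub>C h) = c *\<^sub>C L h)"] by blast
  show ?thesis
    unfolding holomorphic_into_def
  proof (intro conjI ballI)
    fix x assume "x \<in> U"
    then obtain a where "a \<in> Z" "syn a = f x" using rep' by blast
    then show "lift (f x) \<in> cs_carrier Q" by (intro lift_carrier syn_imageI)
  next
    fix x assume x: "x \<in> U"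
    \<comment> \<open>Continuity keeps \<open>v\<close> above \<open>v x / 2\<close> near
      \<open>x\<close>, so a single constant \<open>K\<close> bounds preimages of all nearby values
      of \<open>f\<close>.\<close>
    have "isCont v x" using v U x by (simp add: weight_def continuous_on_eq_continuous_at)
    then have "\<forall>\<^sub>F y in at x. v x / 2 < v y"
      using v0[OF x] by (intro order_tendstoD) (auto simp: isCont_def)
    then have "\<forall>\<^sub>F y in nhds x. v x / 2 < v y \<and> y \<in> U"
      using v0[OF x] eventually_nhds_in_open[OF U x] by (auto simp: eventually_at_filter elim: eventually_elim2)
    then obtain R where R: "0 < R" "\<And>y. y \<in> ball x R \<Longrightarrow> v x / 2 < v y \<and> y \<in> U"
      by (auto simp: eventually_nhds_metric dist_commute)
    define K where "K = 2 / v x"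
    have K: "0 \<le> K" using v0[OF x] by (simp add: K_def)
    have repK: "\<exists>a\<in>Z. syn a = f y \<and> NZ a \<le> K" if y: "y \<in> ball x R" for y
    proof -
      have "1 / v y \<le> K" using R(2)[OF y] v0[OF x] by (simp add: K_def field_simps)
      then show ?thesis using rep'[of y] R(2)[OF y] by (meson order_trans)
    qed
    have Dy: "(f has_derivative D y) (at y) \<and> (\<forall>c h. D y (c *\<^sub>C h) = c *\<^sub>C D y h)" if "y \<in> ball x R" for y
      using D R(2)[OF that] by blast
    note taylor = taylor_representation[where D = D and f = f and x = x and R = R and K = K, OF Dy repK R(1) K]
    have Dr: "D x h \<in> syn ` Z" for h
    proof -
      obtain b where "b \<in> Z" "syn b = D x h" using taylor[of h] by auto
      then show ?thesis by (rule syn_imageI)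
    qed
    have Dlin: "linear (D x)" using D x has_derivative_linear by blast
    have L: "bounded_operator type_space Q (\<lambda>h. lift (D x h))"
      unfolding bounded_operator_def
    proof (intro conjI ballI allI exI[of _ "32 * K / R"])
      fix h k :: 'e and c
      show "lift (D x h) \<in> cs_carrier Q" by (rule lift_carrier[OF Dr])
      show "lift (D x (cs_add type_space h k)) = cs_add Q (lift (D x h)) (lift (D x k))"
        by (simp add: lift_add[OF Dr Dr] linear_add[OF Dlin])
      show "lift (D x (cs_scale type_space c h)) = cs_scale Q c (lift (D x h))"
        using D x by (simp add: lift_scale[OF Dr])
      obtain b where b: "b \<in> Z" "syn b = D x h" "NZ b \<le> 32 * K / R * norm h" using taylor[of h] by auto
      show "cs_norm Q (lift (D x h)) \<le> 32 * K / R * cs_norm type_space h"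
        using lift_norm[OF b(1)] b(2,3) by simp
    qed
    let ?r = "\<lambda>h. cs_norm Q (cs_diff Q (cs_diff Q (lift (f (x + h))) (lift (f x))) (lift (D x h))) / norm h"
    have fr: "f y \<in> syn ` Z" if y: "y \<in> ball x R" for y
    proof -
      obtain b where "b \<in> Z" "syn b = f y" using repK[OF y] by auto
      then show ?thesis by (rule syn_imageI)
    qed
    have r: "0 \<le> ?r h \<and> ?r h \<le> 64 * K / R\<^sup>2 * norm h" if h: "h \<noteq> 0" "norm h < R / 2" for h
    proof -
      have xh: "x + h \<in> ball x R" "x \<in> ball x R" using h R(1) by (auto simp: dist_norm)
      note d1 = lift_diff[OF fr[OF xh(1)] fr[OF xh(2)]]
      note d2 = lift_diff[OF d1(2) Dr[of h]]
      have eq: "cs_diff Q (cs_diff Q (lift (f (x + h))) (lift (f x))) (lift (D x h)) = lift (f (x + h) - f x - D x h)"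
        by (simp add: d1(1) d2(1))
      obtain b where b: "b \<in> Z" "syn b = f (x + h) - f x - D x h" "NZ b \<le> 64 * K / R\<^sup>2 * (norm h)\<^sup>2"
        using taylor[of h] h by auto
      have "cs_norm Q (lift (f (x + h) - f x - D x h)) \<le> 64 * K / R\<^sup>2 * (norm h)\<^sup>2"
        using lift_norm[OF b(1)] b(2,3) by simp
      moreover have "0 \<le> cs_norm Q (lift (f (x + h) - f x - D x h))"
        by (intro cnormed.norm_nonneg[OF cnormed_quotient] lift_carrier d2(2))
      ultimately show ?thesis using h(1) unfolding eq by (simp add: divide_le_eq power2_eq_square mult.assoc)
    qed
    have ev: "\<forall>\<^sub>F h in at 0. h \<noteq> 0 \<and> norm h < R / 2"
      using R(1) by (auto simp: eventually_at intro!: exI[of _ "R/2"])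
    have "(?r \<longlongrightarrow> 0) (at 0)"
    proof (rule tendsto_sandwich[OF _ _ tendsto_const])
      show "\<forall>\<^sub>F h in at 0. 0 \<le> ?r h" using ev by eventually_elim (use r in blast)
      show "\<forall>\<^sub>F h in at 0. ?r h \<le> 64 * K / R\<^sup>2 * norm h" using ev by eventually_elim (use r in blast)
      show "((\<lambda>h. 64 * K / R\<^sup>2 * norm h) \<longlongrightarrow> 0) (at 0)"
        by (intro tendsto_mult_right_zero tendsto_norm_zero tendsto_ident_at)
    qed
    then show "\<exists>L. bounded_operator type_space Q L \<and>
      ((\<lambda>h. cs_norm Q (cs_diff Q (cs_diff Q (lift (f (x + h))) (lift (f x))) (L h)) / norm h) \<longlongrightarrow> 0) (at 0)"
      using L by blast
  qed
qed

lemma lift_H_ideal: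
  fixes f :: "'e::complex_banach \<Rightarrow> 'f"
  assumes hol: "holomorphic_into type_space U f" and U: "open U" and v: "weight U v"
    and \<theta>: "\<And>n. 0 \<le> \<theta> n" "\<And>n. \<theta> n \<le> 1" "antimono \<theta>" and J: "J = Kwp \<or> J = Kup \<and> \<theta> \<longlonglongrightarrow> 0"
    and rep: "\<And>x. x \<in> U \<Longrightarrow> \<exists>a\<in>cs_ball (conj_seq_space p). syn (\<lambda>n. a n * of_real (\<theta> n)) = of_real (v x) *\<^sub>C f x"
  shows "(\<lambda>x. lift (f x)) \<in> H_ideal J p U v Q" "H_ideal_norm J p U v Q (\<lambda>x. lift (f x)) \<le> 1"
    "\<And>x. x \<in> U \<Longrightarrow> f x = quotient_op (lift (f x))"
proof -
  interpret G: cnormed Q by (rule cnormed_quotient)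
  have v0: "0 < v x" if "x \<in> U" for x using v that by (simp add: weight_def)
  have \<theta>a: "(\<lambda>n. a n * of_real (\<theta> n)) \<in> Z" "NZ (\<lambda>n. a n * of_real (\<theta> n)) \<le> 1"
    if a: "a \<in> cs_ball (conj_seq_space p)" for a
  proof -
    have "cmod (a n * of_real (\<theta> n)) \<le> cmod (a n)" for n
      using \<theta> by (simp add: norm_mult mult_left_le)
    then show "(\<lambda>n. a n * of_real (\<theta> n)) \<in> Z" "NZ (\<lambda>n. a n * of_real (\<theta> n)) \<le> 1"
      using a conj_dominated[OF p, of a "\<lambda>n. a n * of_real (\<theta> n)"] by (auto simp: cs_ball_def)
  qed
  have rng: "f x \<in> syn ` Z" if x: "x \<in> U" for x
  proof -
    obtain a where a: "a \<in> cs_ball (conj_seq_space p)" "syn (\<lambda>n. a n * of_real (\<theta> n)) = of_real (v x) *\<^sub>C f x"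
      using rep[OF x] by blast
    have "syn (\<lambda>n. of_real (1 / v x) * (a n * of_real (\<theta> n))) = f x"
      using v0[OF x] syn_scale[OF \<theta>a(1)[OF a(1)], of "of_real (1 / v x)"] by (simp add: a(2) scaleC_scaleC)
    then show ?thesis by (rule syn_imageI[OF conj_scale(1)[OF p \<theta>a(1)[OF a(1)]]])
  qed
  show "f x = quotient_op (lift (f x))" if "x \<in> U" for x
    using quotient_op_lift[OF rng[OF that]] by simp
  define y where "y = (\<lambda>n. cs_scale Q (of_real (\<theta> n)) (basis n))"
  have y: "y \<in> gen_seqs J p Q" "gen_norm J p Q y \<le> 1"
    unfolding y_def using scaled_basis_gen[OF \<theta> J] by auto
  have wr: "\<exists>a\<in>cs_ball (conj_seq_space p). cs_scale Q (of_real (v x)) (lift (f x)) = coset (\<lambda>n. a n * of_real (\<theta> n))"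
    if x: "x \<in> U" for x
  proof -
    obtain a where a: "a \<in> cs_ball (conj_seq_space p)" "syn (\<lambda>n. a n * of_real (\<theta> n)) = of_real (v x) *\<^sub>C f x"
      using rep[OF x] by blast
    then show ?thesis using lift_scale[OF rng[OF x], of "of_real (v x)"] \<theta>a(1)[OF a(1)]
      by (intro bexI[of _ a]) (simp_all add: coset_eq_lift)
  qed
  have sub: "weighted_range U v Q (\<lambda>x. lift (f x)) \<subseteq> p_conv p Q y"
  proof
    fix A assume "A \<in> weighted_range U v Q (\<lambda>x. lift (f x))"
    then obtain a where a: "a \<in> cs_ball (conj_seq_space p)" "A = coset (\<lambda>n. a n * of_real (\<theta> n))"
      using wr by (auto simp: weighted_range_def)
    \<comment> \<open>The factors \<theta>_n move from the coefficients to the basis vectors, which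
      leaves coefficients in the unit ball.\<close>
    have "cs_sums Q (\<lambda>n. cs_scale Q (a n) (y n)) A"
      using Q_sums_basis[OF \<theta>a(1)[OF a(1)]] by (simp add: y_def a(2) basis_in)
    then show "A \<in> p_conv p Q y" using a(1) by (auto simp: p_conv_def)
  qed
  have "v x * cs_norm Q (lift (f x)) \<le> 1" if x: "x \<in> U" for x
  proof -
    obtain a where a: "a \<in> cs_ball (conj_seq_space p)"
      "cs_scale Q (of_real (v x)) (lift (f x)) = coset (\<lambda>n. a n * of_real (\<theta> n))" using wr[OF x] by blast
    have "cs_norm Q (cs_scale Q (of_real (v x)) (lift (f x))) \<le> 1"
      unfolding a(2) using Q_norm_le[OF \<theta>a(1)[OF a(1)] self_coset[OF \<theta>a(1)[OF a(1)]]] \<theta>a(2)[OF a(1)] by simp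
    then show ?thesis using v0[OF x] lift_carrier[OF rng[OF x]] by (simp add: G.norm_scale)
  qed
  moreover have "holomorphic_into Q U (\<lambda>x. lift (f x))"
  proof (rule lift_holomorphic[OF hol U v])
    fix x assume "x \<in> U"
    then obtain a where a: "a \<in> cs_ball (conj_seq_space p)" "syn (\<lambda>n. a n * of_real (\<theta> n)) = of_real (v x) *\<^sub>C f x"
      using rep by blast
    then show "\<exists>a\<in>Z. syn a = of_real (v x) *\<^sub>C f x \<and> NZ a \<le> 1" using \<theta>a[OF a(1)] by blast
  qed
  ultimately show "(\<lambda>x. lift (f x)) \<in> H_ideal J p U v Q"
    using y(1) sub by (auto simp: H_ideal_def H_weighted_def relatively_compact_def intro!: bdd_aboveI2)
  show "H_ideal_norm J p U v Q (\<lambda>x. lift (f x)) \<le> 1"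
    using G.size_le[OF _ y(1) sub] y(2) p by (simp add: H_ideal_norm_def)
qed

end

text \<open>Only \<open>Kup\<close> calls for a genuine null factor. In the other two cases the
  inner ideal is \<open>Kwp\<close>, and the constant factor 1 serves.\<close>

lemma gen_seqs_factor:
  fixes x :: "nat \<Rightarrow> 'f::complex_banach"
  assumes p: "1 \<le> p" and x: "x \<in> gen_seqs I p type_space" and \<epsilon>: "0 < \<epsilon>"
  obtains y \<theta> where "y \<in> gen_seqs I p type_space" "gen_norm I p type_space y \<le> gen_norm I p type_space x + \<epsilon>"
    "\<And>n. x n = of_real (\<theta> n) *\<^sub>C y n" "\<And>n. 0 \<le> \<theta> n" "\<And>n. \<theta> n \<le> 1" "antimono \<theta>"
    "inner_ideal I = Kwp \<or> inner_ideal I = Kup \<and> \<theta> \<longlonglongrightarrow> 0"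
proof (cases "I = Kup")
  case True
  obtain y \<theta> where "y \<in> uncond_seqs p type_space" "weak_norm p type_space y \<le> weak_norm p type_space x + \<epsilon>"
    "\<And>n. x n = cs_scale type_space (of_real (\<theta> n)) (y n)" "\<And>n. 0 \<le> \<theta> n" "\<And>n. \<theta> n \<le> 1" "antimono \<theta>" "\<theta> \<longlonglongrightarrow> 0"
    by (rule cnormed.uncond_factor[OF cnormed_type_space p, of x \<epsilon>]) (use x True \<epsilon> in auto)
  then show ?thesis using that[of y \<theta>] True by simp
next
  case False
  then show ?thesis using that[of x "\<lambda>_. 1"] x \<epsilon> by (cases I) (simp_all add: antimono_def)
qed

lemma factorization_exists:
  fixes f :: "'e::complex_banach \<Rightarrow> 'f::complex_banach"
  assumes U: "open U" and v: "weight U v" and p: "1 \<le> p" and hol: "holomorphic_into type_space U f"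
    and rc: "relatively_compact I p type_space (weighted_range U v type_space f)" and e: "0 < e"
  obtains G S g where "G \<in> conj_seq_quotients p" "S \<in> ideal_operators I p G type_space"
    "g \<in> H_ideal (inner_ideal I) p U v G" "\<forall>x\<in>U. f x = S (g x)"
    "ideal_norm I p G type_space S * H_ideal_norm (inner_ideal I) p U v G g \<le> H_ideal_norm I p U v type_space f + e"
proof -
  interpret F: cnormed "type_space :: 'f cspace" by (rule cnormed_type_space)
  have p0: "0 < p" using p by simp
  define s where "s = H_ideal_norm I p U v type_space f"
  have s: "0 \<le> s" unfolding s_def H_ideal_norm_def by (rule F.size_nonneg[OF p0 rc])
  \<comment> \<open>The estimate ends with (1 + \<epsilon>)(s + 2 \<epsilon>), which for \<epsilon>
    \<le> 1 is at most s + \<epsilon> (s + 4).\<close>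
  define \<epsilon> where "\<epsilon> = min 1 (e / (s + 4))"
  have \<epsilon>: "0 < \<epsilon>" "\<epsilon> \<le> 1" "\<epsilon> \<le> e / (s + 4)" using e s by (simp_all add: \<epsilon>_def)
  obtain x where x: "x \<in> gen_seqs I p type_space" "weighted_range U v type_space f \<subseteq> p_conv p type_space x"
    "gen_norm I p type_space x < s + \<epsilon>"
    using F.size_approx[OF rc \<epsilon>(1)] by (auto simp: s_def H_ideal_norm_def)
  obtain y \<theta> where y: "y \<in> gen_seqs I p type_space" "gen_norm I p type_space y \<le> gen_norm I p type_space x + \<epsilon>"
    and xy: "\<And>n. x n = of_real (\<theta> n) *\<^sub>C y n" and \<theta>: "\<And>n. 0 \<le> \<theta> n" "\<And>n. \<theta> n \<le> 1" "antimono \<theta>"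
    and J: "inner_ideal I = Kwp \<or> inner_ideal I = Kup \<and> \<theta> \<longlonglongrightarrow> 0"
    using gen_seqs_factor[OF p x(1) \<epsilon>(1)] by blast
  interpret synthesis p y using p F.gen_imp_weak(1)[OF p0 y(1)] by unfold_locales
  have rep: "\<exists>a\<in>cs_ball (conj_seq_space p). syn (\<lambda>n. a n * of_real (\<theta> n)) = of_real (v u) *\<^sub>C f u" if "u \<in> U" for u
  proof -
    have "of_real (v u) *\<^sub>C f u \<in> p_conv p type_space x" using x(2) that by (auto simp: weighted_range_def)
    then obtain a where "a \<in> cs_ball (conj_seq_space p)" "(\<lambda>n. a n *\<^sub>C x n) sums (of_real (v u) *\<^sub>C f u)"
      by (auto simp: p_conv_def cs_sums_type_space)
    then show ?thesis by (intro bexI[of _ a] syn_eqI) (simp_all add: xy scaleC_scaleC)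
  qed
  note g = lift_H_ideal[OF hol U v \<theta> J rep]
  note S = quotient_op_ideal[OF y(1) \<epsilon>(1)]
  show ?thesis
  proof (rule that[OF _ S(1) g(1)])
    show "\<forall>x\<in>U. f x = quotient_op (lift (f x))" using g(3) by blast
    show "Q \<in> conj_seq_quotients p" using closed_ker by (auto simp: conj_seq_quotients_def)
    have "ideal_norm I p Q type_space quotient_op * H_ideal_norm (inner_ideal I) p U v Q (\<lambda>x. lift (f x))
      \<le> ideal_norm I p Q type_space quotient_op * 1"
      using g(2) S(1) F.size_nonneg[OF p0] by (intro mult_left_mono) (auto simp: ideal_norm_def ideal_operators_def)
    also have "\<dots> \<le> (1 + \<epsilon>) * (s + 2 * \<epsilon>)"
      using S(2) x(3) y(2) \<epsilon>(1) by (auto intro: order_trans mult_left_mono)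
    also have "\<dots> \<le> s + \<epsilon> * (s + 4)" using \<epsilon>(1,2) mult_left_mono[of \<epsilon> 1 \<epsilon>] by (simp add: algebra_simps)
    also have "\<dots> \<le> s + e" using \<epsilon>(3) s by (simp add: pos_le_divide_eq)
    finally show "ideal_norm I p Q type_space quotient_op * H_ideal_norm (inner_ideal I) p U v Q (\<lambda>x. lift (f x))
      \<le> H_ideal_norm I p U v type_space f + e" by (simp add: s_def)
  qed
qed

theorem corollary2p11:
  fixes U :: "'e::complex_banach set" and v :: "'e \<Rightarrow> real"
    and f :: "'e \<Rightarrow> 'f::complex_banach" and p :: real and I :: compactness
  assumes "open U" and "weight U v" and "1 \<le> p" and "f \<in> H_weighted U v type_space"
  shows "(f \<in> H_ideal I p U v type_space \<longleftrightarrow>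
          (\<exists>G\<in>conj_seq_quotients p. \<exists>S\<in>ideal_operators I p G type_space.
            \<exists>g\<in>H_ideal (inner_ideal I) p U v G. \<forall>x\<in>U. f x = S (g x))) \<and>
         (f \<in> H_ideal I p U v type_space \<longrightarrow>
          H_ideal_norm I p U v type_space f =
            Inf {ideal_norm I p G type_space S * H_ideal_norm (inner_ideal I) p U v G g | G S g.
                  G \<in> conj_seq_quotients p \<and> S \<in> ideal_operators I p G type_space \<and>
                  g \<in> H_ideal (inner_ideal I) p U v G \<and> (\<forall>x\<in>U. f x = S (g x))})"
proof -
  define fac where "fac = (\<lambda>G S g. G \<in> conj_seq_quotients p \<and> S \<in> ideal_operators I p G (type_space :: 'f cspace) \<and>
                  g \<in> H_ideal (inner_ideal I) p U v G \<and> (\<forall>x\<in>U. f x = S (g x)))"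
  define prods where "prods = {ideal_norm I p G (type_space :: 'f cspace) S * H_ideal_norm (inner_ideal I) p U v G g | G S g. fac G S g}"
  let ?s = "H_ideal_norm I p U v type_space f"
  have v: "0 < v x" if "x \<in> U" for x using assms(2) that by (simp add: weight_def)
  have hol: "holomorphic_into type_space U f" using assms(4) by (simp add: H_weighted_def)
  have ideal: "f \<in> H_ideal I p U v type_space" and le: "?s \<le> ideal_norm I p G type_space S * H_ideal_norm (inner_ideal I) p U v G g"
    if "fac G S g" for G S g
  proof -
    have G: "G \<in> conj_seq_quotients p" "S \<in> ideal_operators I p G type_space"
      "g \<in> H_ideal (inner_ideal I) p U v G" "\<And>x. x \<in> U \<Longrightarrow> f x = S (g x)"
      using that by (auto simp: fac_def)
    from factorization_size[OF assms(3) v G] assms(4)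
    show "f \<in> H_ideal I p U v type_space" "?s \<le> ideal_norm I p G type_space S * H_ideal_norm (inner_ideal I) p U v G g"
      by (simp_all add: H_ideal_def)
  qed
  \<comment> \<open>The case \<open>e = 1\<close> gives the existence of a factorization; arbitrary
    \<open>e\<close> gives the upper bound for the infimum.\<close>
  have ex: "\<exists>G S g. fac G S g \<and> ideal_norm I p G type_space S * H_ideal_norm (inner_ideal I) p U v G g \<le> ?s + e"
    if f: "f \<in> H_ideal I p U v type_space" and e: "0 < e" for e
  proof -
    have "relatively_compact I p type_space (weighted_range U v type_space f)" using f by (simp add: H_ideal_def)
    then obtain G S g where "G \<in> conj_seq_quotients p" "S \<in> ideal_operators I p G (type_space :: 'f cspace)"
      "g \<in> H_ideal (inner_ideal I) p U v G" "\<forall>x\<in>U. f x = S (g x)"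
      "ideal_norm I p G type_space S * H_ideal_norm (inner_ideal I) p U v G g \<le> ?s + e"
      using factorization_exists[OF assms(1-3) hol _ e] by blast
    then have "fac G S g \<and> ideal_norm I p G type_space S * H_ideal_norm (inner_ideal I) p U v G g \<le> ?s + e"
      by (simp add: fac_def)
    then show ?thesis by (intro exI)
  qed
  have "f \<in> H_ideal I p U v type_space \<longleftrightarrow> (\<exists>G S g. fac G S g)"
    using ideal ex[of 1] zero_less_one by blast
  moreover have "?s = Inf prods" if f: "f \<in> H_ideal I p U v type_space"
  proof (rule antisym)
    have "prods \<noteq> {}" using ex[OF f zero_less_one] by (auto simp: prods_def)
    then show "?s \<le> Inf prods" by (rule cInf_greatest) (auto simp: prods_def le)
    show "Inf prods \<le> ?s"
    proof (rule field_le_epsilon)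
      fix e :: real assume "0 < e"
      from ex[OF f this] obtain r where "r \<in> prods" "r \<le> ?s + e" by (auto simp: prods_def)
      moreover have "bdd_below prods" by (rule bdd_belowI[of _ ?s]) (auto simp: prods_def le)
      ultimately show "Inf prods \<le> ?s + e" by (rule cInf_lower2)
    qed
  qed
  ultimately show ?thesis unfolding prods_def fac_def by blast
qed

end
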